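(* Let $\Delta$ be a thick polar space of rank $3$. Then $\Delta$ is Moufang. Furthermore, every root elation in each point residue can be written as an even self-projectivity of length $4$; that is, for every point $p$ of $\Delta$ and every root elation $\theta$ of $\mathrm{Res}_\Delta(p)$ there are points $p_0=p,p_1,p_2,p_3,p_4=p$ of $\Delta$ with $p_{i-1}$ opposite $p_i$ for $i=1,\dots,4$ such that $\theta=\mathrm{proj}^{p_3}_{p_4}\circ\mathrm{proj}^{p_2}_{p_3}\circ\mathrm{proj}^{p_1}_{p_2}\circ\mathrm{proj}^{p_0}_{p_1}$.
   Context: A point-line geometry is a set of points with a set of lines (subsets of the point set). Points $x,y$ on a common line are collinear, $x\perp y$ (each point is collinear to itself); $x^\perp$ is the set of points collinear to $x$. A (non-degenerate) polar space is a point-line geometry in which every line has at least three points and, for every point $x$, $x^\perp$ is a proper subspace (closed under lines meeting it in at least two points, not everything) meeting every line. Singular subspaces are subspaces of pairwise collinear points. Rank $n$: maximal singular subspaces are projective spaces of dimension $n-1$ (planes if $n=3$, lines if $n=2$; rank 2 polar spaces are generalized quadrangles). A rank 3 polar space is thick if every line is contained in at least three planes. Two points are opposite if not collinear. A collineation is a permutation of the points inducing a permutation of the lines. Roots and the Moufang property (for rank $n$). A polar frame is a set of $2n$ points $p_{-n},\dots,p_{-1},p_1,\dots,p_n$ with $p_i\perp p_j$ if and only if $i+j\ne0$. The corresponding apartment $\mathcal A$ is the set of all singular subspaces spanned by points of the frame. A root $\alpha$ of the first kind is obtained by choosing a frame point $p_i$ and removing from $\mathcal A$ all members containing $p_i$;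 its interior $\alpha^+$ consists of the members of $\mathcal A$ containing $p_{-i}$. A root $\alpha$ of the second kind is obtained by choosing two distinct collinear frame points $p_i,p_j$ and removing every member of $\mathcal A$ that contains $p_i$ or $p_j$ and is contained in a maximal member of $\mathcal A$ containing both; its interior $\alpha^+$ consists of the members of $\mathcal A$ that contain at least one of $p_{-i},p_{-j}$ and neither $p_i$ nor $p_j$. A root elation (for $\alpha$) is a collineation that fixes every point of every member of $\alpha^+$ and stabilizes every singular subspace incident with (containing or contained in) some member of $\alpha^+$. The polar space is Moufang if for every root $\alpha$ of either kind the group of root elations for $\alpha$ acts transitively on the set of apartments containing $\alpha$. Residues and projectivities. For a point $p$ of $\Delta$, $\mathrm{Res}_\Delta(p)$ is the generalized quadrangle (rank 2 polar space) whose points are the lines of $\Delta$ through $p$ and whose lines are the planes of $\Delta$ through $p$. For opposite points $p,b$, $\mathrm{proj}^p_b:\mathrm{Res}_\Delta(p)\to\mathrm{Res}_\Delta(b)$ maps a line $K$ through $p$ to the line joining $b$ to the unique point of $K$ collinear to $b$. A composition $\mathrm{proj}^{p_{s-1}}_{p_s}\circ\cdots\circ\mathrm{proj}^{p_0}_{p_1}$ (consecutive points opposite) is a projectivity of length $s$; it is a self-projectivity if $p_s=p_0$, and even if $s$ is even. *)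

theory Defs
  imports "HOL-Library.FuncSet"
begin

section \<open>Point-line geometries and polar spaces\<close>

record 'a geometry =
  points :: "'a set"
  lines :: "'a set set"

definition coll :: "'a geometry \<Rightarrow> 'a \<Rightarrow> 'a \<Rightarrow> bool" where
  "coll \<Delta> x y \<longleftrightarrow> x \<in> points \<Delta> \<and> y \<in> points \<Delta> \<and>
     (x = y \<or> (\<exists>l\<in>lines \<Delta>. x \<in> l \<and> y \<in> l))"

definition perp :: "'a geometry \<Rightarrow> 'a \<Rightarrow> 'a set" where
  "perp \<Delta> x = {y. coll \<Delta> x y}"

definition opposite :: "'a geometry \<Rightarrow> 'a \<Rightarrow> 'a \<Rightarrow> bool" where
  "opposite \<Delta> x y \<longleftrightarrow> x \<in> points \<Delta> \<and> y \<in> points \<Delta> \<and> \<not> coll \<Delta> x y"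

definition geo_subspace :: "'a geometry \<Rightarrow> 'a set \<Rightarrow> bool" where
  "geo_subspace \<Delta> S \<longleftrightarrow> S \<subseteq> points \<Delta> \<and>
     (\<forall>l\<in>lines \<Delta>. (\<exists>x\<in>l \<inter> S. \<exists>y\<in>l \<inter> S. x \<noteq> y) \<longrightarrow> l \<subseteq> S)"

definition singular_subspace :: "'a geometry \<Rightarrow> 'a set \<Rightarrow> bool" where
  "singular_subspace \<Delta> S \<longleftrightarrow> geo_subspace \<Delta> S \<and> (\<forall>x\<in>S. \<forall>y\<in>S. coll \<Delta> x y)"

definition geo_span :: "'a geometry \<Rightarrow> 'a set \<Rightarrow> 'a set" where
  "geo_span \<Delta> A = \<Inter> {S. geo_subspace \<Delta> S \<and> A \<subseteq> S}"

text \<open>Not \<open>card A \<ge> 3\<close>, since infinite sets have cardinality \<open>0\<close>.\<close>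

definition at_least_three :: "'b set \<Rightarrow> bool" where
  "at_least_three A \<longleftrightarrow> (\<exists>B\<subseteq>A. card B = 3)"

definition polar_space :: "'a geometry \<Rightarrow> bool" where
  "polar_space \<Delta> \<longleftrightarrow>
     (\<forall>l\<in>lines \<Delta>. l \<subseteq> points \<Delta> \<and> at_least_three l) \<and>
     (\<forall>x\<in>points \<Delta>. geo_subspace \<Delta> (perp \<Delta> x) \<and> perp \<Delta> x \<noteq> points \<Delta> \<and>
        (\<forall>l\<in>lines \<Delta>. perp \<Delta> x \<inter> l \<noteq> {}))"

definition induced :: "'a geometry \<Rightarrow> 'a set \<Rightarrow> 'a geometry" where
  "induced \<Delta> U = \<lparr>points = U, lines = {l \<in> lines \<Delta>. l \<subseteq> U}\<rparr>"

text \<open>The last conjunct is the Veblen--Young axiom.\<close>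

definition projective_space :: "'a geometry \<Rightarrow> bool" where
  "projective_space \<Gamma> \<longleftrightarrow>
     (\<forall>l\<in>lines \<Gamma>. l \<subseteq> points \<Gamma> \<and> at_least_three l) \<and>
     (\<forall>x\<in>points \<Gamma>. \<forall>y\<in>points \<Gamma>. x \<noteq> y \<longrightarrow> (\<exists>!l. l \<in> lines \<Gamma> \<and> x \<in> l \<and> y \<in> l)) \<and>
     (\<forall>a\<in>points \<Gamma>. \<forall>b\<in>points \<Gamma>. \<forall>c\<in>points \<Gamma>. \<forall>d\<in>points \<Gamma>.
        \<forall>ab\<in>lines \<Gamma>. \<forall>cd\<in>lines \<Gamma>. \<forall>ac\<in>lines \<Gamma>. \<forall>bd\<in>lines \<Gamma>.
          distinct [a, b, c, d] \<and> {a, b} \<subseteq> ab \<and> {c, d} \<subseteq> cd \<and> {a, c} \<subseteq> ac \<and> {b, d} \<subseteq> bd \<and>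
          ab \<inter> cd \<noteq> {} \<longrightarrow> ac \<inter> bd \<noteq> {})"

text \<open>Dimension \<open>d\<close>: the least number of points spanning the space is \<open>d + 1\<close>.\<close>

definition projective_space_of_dim :: "'a geometry \<Rightarrow> nat \<Rightarrow> bool" where
  "projective_space_of_dim \<Gamma> d \<longleftrightarrow> projective_space \<Gamma> \<and>
     (\<exists>B\<subseteq>points \<Gamma>. card B = d + 1 \<and> geo_span \<Gamma> B = points \<Gamma>) \<and>
     (\<forall>B\<subseteq>points \<Gamma>. finite B \<and> geo_span \<Gamma> B = points \<Gamma> \<longrightarrow> d + 1 \<le> card B)"

definition maximal_singular :: "'a geometry \<Rightarrow> 'a set \<Rightarrow> bool" where
  "maximal_singular \<Delta> M \<longleftrightarrow> singular_subspace \<Delta> M \<and>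
     (\<forall>S. singular_subspace \<Delta> S \<and> M \<subseteq> S \<longrightarrow> S = M)"

definition polar_space_of_rank :: "'a geometry \<Rightarrow> nat \<Rightarrow> bool" where
  "polar_space_of_rank \<Delta> n \<longleftrightarrow> polar_space \<Delta> \<and> 1 \<le> n \<and>
     (\<forall>M. maximal_singular \<Delta> M \<longrightarrow> projective_space_of_dim (induced \<Delta> M) (n - 1))"

definition planes :: "'a geometry \<Rightarrow> 'a set set" where
  "planes \<Delta> = {\<pi>. singular_subspace \<Delta> \<pi> \<and> projective_space_of_dim (induced \<Delta> \<pi>) 2}"

definition thick_rank3 :: "'a geometry \<Rightarrow> bool" where
  "thick_rank3 \<Delta> \<longleftrightarrow>
     (\<forall>l\<in>lines \<Delta>. at_least_three {\<pi> \<in> planes \<Delta>. l \<subseteq> \<pi>})"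

text \<open>Collineations are functions on the whole type; only their values on points matter.\<close>

definition collineation :: "'a geometry \<Rightarrow> ('a \<Rightarrow> 'a) \<Rightarrow> bool" where
  "collineation \<Delta> g \<longleftrightarrow>
     bij_betw g (points \<Delta>) (points \<Delta>) \<and> bij_betw (image g) (lines \<Delta>) (lines \<Delta>)"

section \<open>Apartments, roots and the Moufang property\<close>

definition frame_indices :: "nat \<Rightarrow> int set" where
  "frame_indices n = {- int n..int n} - {0}"

text \<open>The condition forces \<open>f\<close> to be injective on the index set: if \<open>f i = f j\<close> then
  \<open>f (- i)\<close> is not collinear to \<open>f j\<close>, hence \<open>j = i\<close>.\<close>

definition polar_frame :: "'a geometry \<Rightarrow> nat \<Rightarrow> (int \<Rightarrow> 'a) \<Rightarrow> bool" where
  "polar_frame \<Delta> n f \<longleftrightarrow> f ` frame_indices n \<subseteq> points \<Delta> \<and>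
     (\<forall>i\<in>frame_indices n. \<forall>j\<in>frame_indices n. coll \<Delta> (f i) (f j) \<longleftrightarrow> i + j \<noteq> 0)"

text \<open>The empty subspace belongs to every apartment and every root, but to no root interior,
  so it does not affect any of the notions below.\<close>

definition apartment :: "'a geometry \<Rightarrow> nat \<Rightarrow> (int \<Rightarrow> 'a) \<Rightarrow> 'a set set" where
  "apartment \<Delta> n f =
     {U. singular_subspace \<Delta> U \<and> (\<exists>B\<subseteq>f ` frame_indices n. U = geo_span \<Delta> B)}"

definition apartments :: "'a geometry \<Rightarrow> nat \<Rightarrow> 'a set set set" where
  "apartments \<Delta> n = {A. \<exists>f. polar_frame \<Delta> n f \<and> A = apartment \<Delta> n f}"

definition maximal_members :: "'a set set \<Rightarrow> 'a set set" where
  "maximal_members A = {M \<in> A. \<forall>U\<in>A. M \<subseteq> U \<longrightarrow> U = M}"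

definition root_first :: "'a set set \<Rightarrow> (int \<Rightarrow> 'a) \<Rightarrow> int \<Rightarrow> 'a set set" where
  "root_first A f i = A - {U \<in> A. f i \<in> U}"

definition interior_first :: "'a set set \<Rightarrow> (int \<Rightarrow> 'a) \<Rightarrow> int \<Rightarrow> 'a set set" where
  "interior_first A f i = {U \<in> A. f (- i) \<in> U}"

definition root_second :: "'a set set \<Rightarrow> (int \<Rightarrow> 'a) \<Rightarrow> int \<Rightarrow> int \<Rightarrow> 'a set set" where
  "root_second A f i j = A - {U \<in> A. (f i \<in> U \<or> f j \<in> U) \<and>
     (\<exists>M\<in>maximal_members A. f i \<in> M \<and> f j \<in> M \<and> U \<subseteq> M)}"

definition interior_second :: "'a set set \<Rightarrow> (int \<Rightarrow> 'a) \<Rightarrow> int \<Rightarrow> int \<Rightarrow> 'a set set" where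
  "interior_second A f i j =
     {U \<in> A. (f (- i) \<in> U \<or> f (- j) \<in> U) \<and> f i \<notin> U \<and> f j \<notin> U}"

text \<open>\<open>polar_root \<Delta> n \<alpha> \<alpha>i\<close>: \<open>\<alpha>\<close> is a root (of either kind) with interior \<open>\<alpha>i\<close>.\<close>

definition polar_root :: "'a geometry \<Rightarrow> nat \<Rightarrow> 'a set set \<Rightarrow> 'a set set \<Rightarrow> bool" where
  "polar_root \<Delta> n \<alpha> \<alpha>i \<longleftrightarrow> (\<exists>f. polar_frame \<Delta> n f \<and>
     ((\<exists>i\<in>frame_indices n.
         \<alpha> = root_first (apartment \<Delta> n f) f i \<and>
         \<alpha>i = interior_first (apartment \<Delta> n f) f i) \<or>
      (\<exists>i\<in>frame_indices n. \<exists>j\<in>frame_indices n. f i \<noteq> f j \<and> coll \<Delta> (f i) (f j) \<and>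
         \<alpha> = root_second (apartment \<Delta> n f) f i j \<and>
         \<alpha>i = interior_second (apartment \<Delta> n f) f i j)))"

text \<open>Root elations for a root depend on its interior \<open>\<alpha>i\<close> only.\<close>

definition root_elation_for :: "'a geometry \<Rightarrow> 'a set set \<Rightarrow> ('a \<Rightarrow> 'a) \<Rightarrow> bool" where
  "root_elation_for \<Delta> \<alpha>i g \<longleftrightarrow> collineation \<Delta> g \<and>
     (\<forall>U\<in>\<alpha>i. \<forall>x\<in>U. g x = x) \<and>
     (\<forall>S. singular_subspace \<Delta> S \<and> (\<exists>U\<in>\<alpha>i. U \<subseteq> S \<or> S \<subseteq> U) \<longrightarrow> g ` S = S)"

definition root_elation :: "'a geometry \<Rightarrow> nat \<Rightarrow> ('a \<Rightarrow> 'a) \<Rightarrow> bool" where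
  "root_elation \<Delta> n g \<longleftrightarrow> (\<exists>\<alpha> \<alpha>i. polar_root \<Delta> n \<alpha> \<alpha>i \<and> root_elation_for \<Delta> \<alpha>i g)"

definition moufang :: "'a geometry \<Rightarrow> nat \<Rightarrow> bool" where
  "moufang \<Delta> n \<longleftrightarrow> (\<forall>\<alpha> \<alpha>i. polar_root \<Delta> n \<alpha> \<alpha>i \<longrightarrow>
     (\<forall>A\<in>apartments \<Delta> n. \<forall>B\<in>apartments \<Delta> n. \<alpha> \<subseteq> A \<and> \<alpha> \<subseteq> B \<longrightarrow>
        (\<exists>g. root_elation_for \<Delta> \<alpha>i g \<and> image g ` A = B)))"

section \<open>Point residues and projections\<close>

text \<open>A plane through \<open>p\<close> is represented, as a line of the residue, by the set of lines
  through \<open>p\<close> that it contains.\<close>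

definition point_residue :: "'a geometry \<Rightarrow> 'a \<Rightarrow> 'a set geometry" where
  "point_residue \<Delta> p = \<lparr>points = {K \<in> lines \<Delta>. p \<in> K},
     lines = {{K \<in> lines \<Delta>. p \<in> K \<and> K \<subseteq> \<pi>} | \<pi>. \<pi> \<in> planes \<Delta> \<and> p \<in> \<pi>}\<rparr>"

definition residue_proj :: "'a geometry \<Rightarrow> 'a \<Rightarrow> 'a \<Rightarrow> 'a set \<Rightarrow> 'a set" where
  "residue_proj \<Delta> p b = (\<lambda>K\<in>points (point_residue \<Delta> p).
     THE M. M \<in> lines \<Delta> \<and> b \<in> M \<and> (THE x. x \<in> K \<and> coll \<Delta> b x) \<in> M)"

end

theory Submission
  imports Defs
begin

text \<open>
  Let \<open>c\<close> be a point and let \<open>q\<close>, \<open>q'\<close> be points opposite \<open>c\<close>. The key fact is that there is always a collineation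
  that stabilizes every line through \<open>c\<close> and maps \<open>q\<close> to \<open>q'\<close>; all root elations are of this type.

  Planes through \<open>c\<close> admit all elations with center \<open>c\<close>, since such elations arise by composing perspectivities
  \<open>x \<mapsto> x\<^sup>\<bottom> \<inter> \<rho>\<close> between opposite planes, and the permutation that an elation induces on a line \<open>K\<close> through \<open>c\<close>
  depends neither on the plane through \<open>K\<close> nor on the axis, only on the image of one point (this is where thickness is
  needed). Moving the point of every \<open>K\<close> collinear to \<open>q\<close> to the one collinear to \<open>q'\<close> therefore gives a
  well-defined collineation of the cone \<open>c\<^sup>\<bottom>\<close>. It extends along lines to the points opposite \<open>c\<close>: the image of \<open>y\<close>
  must have as trace on the cone the image of the trace of \<open>y\<close>, lifts along an edge are unique, and
  triangles and quadrangles lift to closed paths because geometric hyperplanes have connected complements.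

  In the quadrangle of lines and planes through \<open>p\<close>, a root elation is determined by the image of one point
  opposite the root's center. Hence it suffices to choose \<open>p\<^sub>1, p\<^sub>2, p\<^sub>3\<close>, with \<open>p\<^sub>2\<close> on the line through \<open>p\<close>
  representing a point of the interior of the root, such that the projectivity has the right fixed elements and the
  right value there.
\<close>

section \<open>Projective planes\<close>

text \<open>The obstacle in the extension step is that a point opposite \<open>c\<close> need not be
  determined by its trace on the cone, so having the transported trace is a relation and not a
  function. The trace is decisive only among points opposite \<open>c\<close> that are collinear to
  one given such point (\<open>trace_unique\<close>). Lifts can therefore be followed along edges,
  and the work lies in independence of the path. Instead of contracting arbitrary closed paths, one
  plane is lifted as a whole; a point opposite \<open>c\<close> with a neighbour in that plane
  opposite \<open>c\<close> is lifted from there, the others from such points.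

  Length four leaves just enough freedom for the projectivity. The point \<open>p1\<close> is any
  point opposite \<open>p\<close>. Putting \<open>p2\<close> on a line through \<open>p\<close>
  makes all planes on that line stable, whatever \<open>p1\<close> and \<open>p3\<close> are
  (\<open>proj4_stable\<close>). The point \<open>p3\<close> is then chosen to produce one
  prescribed value. Equality with the root elation \<open>\<theta>\<close> is obtained by showing
  that the inverse of \<open>\<theta>\<close> composed with the projectivity fixes every point of
  the residue.\<close>

lemma coll_sym: "coll \<Gamma> x y \<Longrightarrow> coll \<Gamma> y x"
  unfolding coll_def by blast

lemma coll_points: "coll \<Gamma> x y \<Longrightarrow> x \<in> points \<Gamma> \<and> y \<in> points \<Gamma>"
  unfolding coll_def by blast

lemma coll_refl: "x \<in> points \<Gamma> \<Longrightarrow> coll \<Gamma> x x"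
  unfolding coll_def by blast

lemma third_element:
  assumes "at_least_three A"
  shows "\<exists>z\<in>A. z \<noteq> a \<and> z \<noteq> b"
proof (rule ccontr)
  assume "\<not> ?thesis"
  then have s: "A \<subseteq> {a, b}" by blast
  obtain B where B: "B \<subseteq> A" "card B = 3"
    using assms unfolding at_least_three_def by blast
  then have "card B \<le> card {a, b}" using s by (intro card_mono) auto
  also have "\<dots> \<le> 2" by (simp add: card_insert_if)
  finally show False using B by simp
qed

lemma induced_simps [simp]: "points (induced \<Gamma> U) = U" "lines (induced \<Gamma> U) = {l \<in> lines \<Gamma>. l \<subseteq> U}"
  unfolding induced_def by simp_all

lemma geo_span_superset: "B \<subseteq> geo_span \<Gamma> B"
  unfolding geo_span_def by blast

lemma geo_span_least: "geo_subspace \<Gamma> S \<Longrightarrow> B \<subseteq> S \<Longrightarrow> geo_span \<Gamma> B \<subseteq> S"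
  unfolding geo_span_def by blast

lemma geo_span_subspace:
  assumes "B \<subseteq> points \<Gamma>" and "\<And>l. l \<in> lines \<Gamma> \<Longrightarrow> l \<subseteq> points \<Gamma>"
  shows "geo_subspace \<Gamma> (geo_span \<Gamma> B)"
proof -
  have "geo_subspace \<Gamma> (points \<Gamma>)" unfolding geo_subspace_def using assms by blast
  then have "geo_span \<Gamma> B \<subseteq> points \<Gamma>" using assms by (intro geo_span_least)
  moreover have "l \<subseteq> geo_span \<Gamma> B" if l: "l \<in> lines \<Gamma>"
    and xy: "x \<in> l \<inter> geo_span \<Gamma> B" "y \<in> l \<inter> geo_span \<Gamma> B" "x \<noteq> y" for l x y
  proof -
    have "l \<subseteq> S" if S: "geo_subspace \<Gamma> S" "B \<subseteq> S" for S
    proof -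
      have "x \<in> l \<inter> S" "y \<in> l \<inter> S" using xy geo_span_least[OF S] by auto
      then show ?thesis using S(1) l xy(3) unfolding geo_subspace_def by blast
    qed
    then show ?thesis unfolding geo_span_def by blast
  qed
  ultimately show ?thesis unfolding geo_subspace_def by blast
qed

text \<open>The dimension is given by spanning sets only, so the meeting of lines has to be
  extracted from it. By the Veblen-Young axiom the lines joining \<open>a\<close> to the points of
  the line \<open>n\<close> on \<open>b\<close> and \<open>c\<close> cover a subspace. It contains
  the spanning triple, hence every line meets \<open>n\<close>, and one more use of the axiom makes
  \<open>l\<close> and \<open>m\<close> meet.\<close>

lemma projective_plane_lines_meet:
  assumes pr: "projective_space_of_dim \<Gamma> 2"
    and l: "l \<in> lines \<Gamma>" and m: "m \<in> lines \<Gamma>"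
  shows "l \<inter> m \<noteq> {}"
proof -
  have ps: "projective_space \<Gamma>" using pr unfolding projective_space_of_dim_def by blast
  have sub: "\<And>l. l \<in> lines \<Gamma> \<Longrightarrow> l \<subseteq> points \<Gamma>"
    and three: "\<And>l. l \<in> lines \<Gamma> \<Longrightarrow> at_least_three l"
    and uq: "\<And>x y. x \<in> points \<Gamma> \<Longrightarrow> y \<in> points \<Gamma> \<Longrightarrow> x \<noteq> y \<Longrightarrow> \<exists>!l. l \<in> lines \<Gamma> \<and> x \<in> l \<and> y \<in> l"
    using conjunct1[OF ps[unfolded projective_space_def]]
      conjunct1[OF conjunct2[OF ps[unfolded projective_space_def]]] by blast+
  have vy: "ac \<inter> bd \<noteq> {}" if "ab \<in> lines \<Gamma>" "cd \<in> lines \<Gamma>" "ac \<in> lines \<Gamma>" "bd \<in> lines \<Gamma>"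
    "distinct [a, b, c, d]" "a \<in> ab" "b \<in> ab" "c \<in> cd" "d \<in> cd" "a \<in> ac" "c \<in> ac" "b \<in> bd" "d \<in> bd"
    "ab \<inter> cd \<noteq> {}" for a b c d ab cd ac bd
  proof -
    have P: "a \<in> points \<Gamma>" "b \<in> points \<Gamma>" "c \<in> points \<Gamma>" "d \<in> points \<Gamma>" using that sub by blast+
    have "\<forall>a\<in>points \<Gamma>. \<forall>b\<in>points \<Gamma>. \<forall>c\<in>points \<Gamma>. \<forall>d\<in>points \<Gamma>.
        \<forall>ab\<in>lines \<Gamma>. \<forall>cd\<in>lines \<Gamma>. \<forall>ac\<in>lines \<Gamma>. \<forall>bd\<in>lines \<Gamma>.
          distinct [a, b, c, d] \<and> {a, b} \<subseteq> ab \<and> {c, d} \<subseteq> cd \<and> {a, c} \<subseteq> ac \<and> {b, d} \<subseteq> bd \<and>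
          ab \<inter> cd \<noteq> {} \<longrightarrow> ac \<inter> bd \<noteq> {}"
      using conjunct2[OF conjunct2[OF ps[unfolded projective_space_def]]] .
    from this[rule_format, OF P that(1-4)] show ?thesis using that by blast
  qed
  obtain B where B: "B \<subseteq> points \<Gamma>" "card B = 3" "geo_span \<Gamma> B = points \<Gamma>"
    using pr unfolding projective_space_of_dim_def by auto
  then obtain a b c where abc: "B = {a, b, c}" "a \<noteq> b" "a \<noteq> c" "b \<noteq> c"
    by (auto simp: card_3_iff)
  have P: "a \<in> points \<Gamma>" "b \<in> points \<Gamma>" "c \<in> points \<Gamma>" using B abc by auto
  obtain n where n: "n \<in> lines \<Gamma>" "b \<in> n" "c \<in> n" using uq[of b c] P abc by blast
  \<comment> \<open>Otherwise two points would span, against the lower bound of three.\<close>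
  have an: "a \<notin> n"
  proof
    assume "a \<in> n"
    have "geo_subspace \<Gamma> (geo_span \<Gamma> {b, c})" using P sub by (intro geo_span_subspace) auto
    moreover have "b \<in> geo_span \<Gamma> {b, c}" "c \<in> geo_span \<Gamma> {b, c}" using geo_span_superset[of "{b,c}"] by auto
    ultimately have ns: "n \<subseteq> geo_span \<Gamma> {b, c}" using n abc unfolding geo_subspace_def by blast
    then have "B \<subseteq> geo_span \<Gamma> {b, c}" using \<open>a \<in> n\<close> n abc by auto
    then have "points \<Gamma> \<subseteq> geo_span \<Gamma> {b, c}" using geo_span_least \<open>geo_subspace \<Gamma> (geo_span \<Gamma> {b, c})\<close> B by metis
    moreover have "geo_span \<Gamma> {b, c} \<subseteq> points \<Gamma>" using \<open>geo_subspace \<Gamma> (geo_span \<Gamma> {b, c})\<close> unfolding geo_subspace_def by blast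
    ultimately have "geo_span \<Gamma> {b, c} = points \<Gamma>" by blast
    then have "2 + 1 \<le> card {b, c}" using pr P unfolding projective_space_of_dim_def by auto
    then show False using abc by (simp add: card_insert_if)
  qed
  define S where "S = {x \<in> points \<Gamma>. \<exists>y\<in>n. \<exists>k\<in>lines \<Gamma>. a \<in> k \<and> y \<in> k \<and> x \<in> k}"
  \<comment> \<open>In the general case the lines \<open>k1\<close> and \<open>k2\<close> meet in
    \<open>a\<close>; the axiom turns this into a meeting of the line on \<open>x1\<close>,
    \<open>x2\<close> with the line on \<open>y1\<close>, \<open>y2\<close>.\<close>
  have meetn: "k \<inter> n \<noteq> {}" if k: "k \<in> lines \<Gamma>" "x1 \<in> k" "x2 \<in> k" "x1 \<noteq> x2" "x1 \<in> S" "x2 \<in> S" for k x1 x2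
  proof (cases "a \<in> k")
    case True
    obtain x where x: "x \<in> k" "x \<in> S" "x \<noteq> a" using k by metis
    then obtain y k' where "y \<in> n" "k' \<in> lines \<Gamma>" "a \<in> k'" "y \<in> k'" "x \<in> k'" unfolding S_def by blast
    moreover have "k = k'" using uq[of x a] x calculation True k P sub by blast
    ultimately show ?thesis by blast
  next
    case False
    obtain y1 k1 where 1: "y1 \<in> n" "k1 \<in> lines \<Gamma>" "a \<in> k1" "y1 \<in> k1" "x1 \<in> k1" using k unfolding S_def by blast
    obtain y2 k2 where 2: "y2 \<in> n" "k2 \<in> lines \<Gamma>" "a \<in> k2" "y2 \<in> k2" "x2 \<in> k2" using k unfolding S_def by blast
    show ?thesis
    proof (cases "x1 = y1 \<or> x2 = y2")
      case True then show ?thesis using 1 2 k by blast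
    next
      case ne: False
      have k12: "k1 \<noteq> k2"
      proof
        assume "k1 = k2"
        then have "k = k1" using uq[of x1 x2] 1 2 k sub by blast
        then show False using 1 False by blast
      qed
      have u12: "z = a" if "z \<in> k1" "z \<in> k2" for z
        using uq[of z a] that 1 2 k12 P sub by blast
      have "y1 \<noteq> a" "y2 \<noteq> a" using 1 2 an by blast+
      moreover have "x1 \<noteq> a" "x2 \<noteq> a" using False k by blast+
      ultimately have "y1 \<noteq> y2" "x1 \<noteq> y2" "y1 \<noteq> x2" using u12 1 2 by metis+
      then have "distinct [x1, y1, x2, y2]" using ne k(4) by simp
      then show ?thesis using vy[of k1 k2 k n x1 y1 x2 y2] 1 2 k n by blast
    qed
  qed
  have "geo_subspace \<Gamma> S"
  proof -
    \<comment> \<open>For \<open>x\<close> on neither special position, the axiom is applied to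
      \<open>k0\<close> and \<open>k\<close>, which meet in \<open>x0\<close>: it makes the line
      \<open>a x\<close> meet \<open>n\<close>.\<close>
    have "k \<subseteq> S" if k: "k \<in> lines \<Gamma>" "x1 \<in> k" "x2 \<in> k" "x1 \<noteq> x2" "x1 \<in> S" "x2 \<in> S" for k x1 x2
    proof
      fix x assume x: "x \<in> k"
      obtain y where y: "y \<in> k" "y \<in> n" using meetn[OF k] by blast
      have xP: "x \<in> points \<Gamma>" using x k sub by blast
      show "x \<in> S"
      proof (cases "a \<in> k")
        case True then show ?thesis using k x y xP unfolding S_def by blast
      next
        case ak: False
        show ?thesis
        proof (cases "x \<in> n")
          case True
          obtain k' where "k' \<in> lines \<Gamma>" "a \<in> k'" "x \<in> k'" using uq[of a x] P xP True an by blast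
          then show ?thesis using True xP unfolding S_def by blast
        next
          case xn: False
          obtain x0 where x0: "x0 \<in> k" "x0 \<in> S" "x0 \<noteq> y" using k by metis
          show ?thesis
          proof (cases "x = x0")
            case True then show ?thesis using x0 by simp
          next
            case False
            obtain y0 k0 where 0: "y0 \<in> n" "k0 \<in> lines \<Gamma>" "a \<in> k0" "y0 \<in> k0" "x0 \<in> k0" using x0 unfolding S_def by blast
            obtain h where h: "h \<in> lines \<Gamma>" "a \<in> h" "x \<in> h" using uq[of a x] P xP ak x by blast
            have "y0 \<noteq> y"
            proof
              assume "y0 = y"
              then have "k0 = k" using uq[of y x0] x0 y 0 k sub by blast
              then show False using 0 ak by blast
            qed
            then have "distinct [a, y0, x, y]" using 0 an ak x y xn by auto
            then have "h \<inter> n \<noteq> {}" using vy[of k0 k h n a y0 x y] 0 k h n x y x0 by blast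
            then show ?thesis using h xP unfolding S_def by blast
          qed
        qed
      qed
    qed
    moreover have "S \<subseteq> points \<Gamma>" unfolding S_def by blast
    ultimately show ?thesis unfolding geo_subspace_def by (meson IntD1 IntD2)
  qed
  moreover have "B \<subseteq> S"
  proof -
    have "a \<in> S" using uq[of a b] abc P n unfolding S_def by blast
    moreover have "b \<in> S" using uq[of a b] abc P n unfolding S_def by blast
    moreover have "c \<in> S" using uq[of a c] abc P n unfolding S_def by blast
    ultimately show ?thesis using abc by blast
  qed
  ultimately have "points \<Gamma> \<subseteq> S" using geo_span_least[of \<Gamma> S B] B(3) by simp
  then have SP: "S = points \<Gamma>" unfolding S_def by blast
  have mn: "k \<inter> n \<noteq> {}" if k: "k \<in> lines \<Gamma>" for k
  proof -
    obtain x1 where "x1 \<in> k" using third_element[OF three[OF k]] by blast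
    moreover obtain x2 where "x2 \<in> k" "x2 \<noteq> x1" using third_element[OF three[OF k]] by blast
    ultimately show ?thesis using meetn[OF k, of x1 x2] SP sub k by blast
  qed
  obtain y where y: "y \<in> l" "y \<in> n" using mn[OF l] by blast
  obtain z where z: "z \<in> m" "z \<in> n" using mn[OF m] by blast
  show ?thesis
  proof (cases "y = z")
    case True then show ?thesis using y z by blast
  next
    case False
    \<comment> \<open>The line on \<open>x\<close> and \<open>w\<close> meets \<open>n\<close>, the
      line on \<open>y\<close> and \<open>z\<close>. The axiom turns this into a meeting of
      \<open>l\<close> and \<open>m\<close>.\<close>
    obtain x where x: "x \<in> l" "x \<noteq> y" "x \<noteq> z" using third_element[OF three[OF l]] by blast
    obtain w where w: "w \<in> m" "w \<noteq> y" "w \<noteq> z" using third_element[OF three[OF m]] by blast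
    show ?thesis
    proof (cases "x = w")
      case True then show ?thesis using x w by blast
    next
      case xw: False
      obtain k where k: "k \<in> lines \<Gamma>" "x \<in> k" "w \<in> k" using uq[of x w] xw x w l m sub by blast
      have "k \<inter> n \<noteq> {}" using mn k by blast
      then show ?thesis using vy[of k n l m x w y z] k n l m x w y z xw False by auto
    qed
  qed
qed

section \<open>Thick polar spaces of rank three\<close>

locale thick_polar3 =
  fixes \<Delta> :: "'a geometry"
  assumes rank3: "polar_space_of_rank \<Delta> 3" and thick: "thick_rank3 \<Delta>"
begin

abbreviation P where "P \<equiv> points \<Delta>"
abbreviation col (infix "\<sim>" 50) where "x \<sim> y \<equiv> coll \<Delta> x y"
definition jn where "jn x y = (THE l. l \<in> lines \<Delta> \<and> x \<in> l \<and> y \<in> l)"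
text \<open>Meaningful only for a line with a point not collinear to \<open>x\<close>, which is why
  \<open>pr_eq\<close> and \<open>pr\<close> carry the witness \<open>z\<close>.\<close>

definition pr where "pr x l = (THE y. y \<in> l \<and> x \<sim> y)"

section \<open>The axioms of a polar space in terms of points and lines\<close>

lemma polar: "polar_space \<Delta>"
  using rank3 unfolding polar_space_of_rank_def by blast

lemma line_sub: "l \<in> lines \<Delta> \<Longrightarrow> l \<subseteq> P"
  using polar unfolding polar_space_def by blast

lemma third: "l \<in> lines \<Delta> \<Longrightarrow> \<exists>z\<in>l. z \<noteq> a \<and> z \<noteq> b"
  using polar third_element[of l a b] unfolding polar_space_def by meson

lemma sym: "x \<sim> y \<Longrightarrow> y \<sim> x"
  by (rule coll_sym)

lemma colP: "x \<sim> y \<Longrightarrow> x \<in> P" "x \<sim> y \<Longrightarrow> y \<in> P"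
  by (auto dest: coll_points)

lemma line_coll: "l \<in> lines \<Delta> \<Longrightarrow> x \<in> l \<Longrightarrow> y \<in> l \<Longrightarrow> x \<sim> y"
  using line_sub unfolding coll_def by blast

lemma perp_line:
  assumes "l \<in> lines \<Delta>" "x \<in> l" "y \<in> l" "x \<noteq> y" "a \<sim> x" "a \<sim> y" "z \<in> l"
  shows "a \<sim> z"
proof -
  have "geo_subspace \<Delta> (perp \<Delta> a)" using polar assms colP unfolding polar_space_def by blast
  then have "l \<subseteq> perp \<Delta> a" using assms unfolding geo_subspace_def perp_def by blast
  then show ?thesis using assms unfolding perp_def by blast
qed

lemma meet_ex: "a \<in> P \<Longrightarrow> l \<in> lines \<Delta> \<Longrightarrow> \<exists>y\<in>l. a \<sim> y"
  using polar unfolding polar_space_def perp_def by blast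

lemma opp_ex: "x \<in> P \<Longrightarrow> \<exists>y\<in>P. \<not> x \<sim> y"
proof -
  assume "x \<in> P"
  then have "geo_subspace \<Delta> (perp \<Delta> x)" "perp \<Delta> x \<noteq> P" using polar unfolding polar_space_def by blast+
  then show ?thesis unfolding geo_subspace_def perp_def by blast
qed

text \<open>The rank hypothesis speaks of maximal singular subspaces only, so planes have to be
  produced by Zorn's lemma. It is applied to sets of pairwise collinear points: a maximal one is a
  subspace, since each point of a line joining two of its points is collinear to all of it.\<close>

lemma clique_maximal:
  assumes C: "\<And>x y. x \<in> C \<Longrightarrow> y \<in> C \<Longrightarrow> x \<sim> y"
  shows "\<exists>M\<in>planes \<Delta>. C \<subseteq> M \<and> maximal_singular \<Delta> M"
proof -
  define A where "A = {S. C \<subseteq> S \<and> (\<forall>x\<in>S. \<forall>y\<in>S. x \<sim> y)}"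
  have "\<exists>M\<in>A. \<forall>X\<in>A. M \<subseteq> X \<longrightarrow> X = M"
  proof (rule subset_Zorn_nonempty)
    show "A \<noteq> {}" using C unfolding A_def by blast
  next
    fix \<C> assume \<C>: "\<C> \<noteq> {}" "subset.chain A \<C>"
    then have A: "\<C> \<subseteq> A" and ch: "\<And>S T. S \<in> \<C> \<Longrightarrow> T \<in> \<C> \<Longrightarrow> S \<subseteq> T \<or> T \<subseteq> S"
      unfolding subset_chain_def by blast+
    have "x \<sim> y" if xy: "x \<in> \<Union>\<C>" "y \<in> \<Union>\<C>" for x y
    proof -
      obtain S T where ST: "S \<in> \<C>" "T \<in> \<C>" "x \<in> S" "y \<in> T" using xy by blast
      then have "\<exists>R\<in>\<C>. x \<in> R \<and> y \<in> R" using ch[of S T] by blast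
      then show ?thesis using A unfolding A_def by blast
    qed
    moreover have "C \<subseteq> \<Union>\<C>" using \<C>(1) A unfolding A_def by blast
    ultimately show "\<Union>\<C> \<in> A" unfolding A_def by blast
  qed
  then obtain M where M: "M \<in> A" and max: "\<And>X. X \<in> A \<Longrightarrow> M \<subseteq> X \<Longrightarrow> X = M" by blast
  have cl: "\<And>x y. x \<in> M \<Longrightarrow> y \<in> M \<Longrightarrow> x \<sim> y" and CM: "C \<subseteq> M" using M unfolding A_def by blast+
  have "l \<subseteq> M" if l: "l \<in> lines \<Delta>" "x \<in> l" "y \<in> l" "x \<in> M" "y \<in> M" "x \<noteq> y" for l x y
  proof
    fix z assume z: "z \<in> l"
    have "m \<sim> z" if "m \<in> M" for m using perp_line[OF l(1-3) l(6) _ _ z] cl l that by blast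
    moreover have "z \<sim> z" using line_coll l z by blast
    ultimately have "insert z M \<in> A" using CM cl sym unfolding A_def by blast
    then show "z \<in> M" using max by blast
  qed
  moreover have "M \<subseteq> P" using cl colP(1) by blast
  ultimately have "singular_subspace \<Delta> M" unfolding singular_subspace_def geo_subspace_def
    using cl by (meson IntD1 IntD2)
  then have "maximal_singular \<Delta> M" unfolding maximal_singular_def
  proof (intro conjI allI impI)
    fix S assume "singular_subspace \<Delta> S \<and> M \<subseteq> S"
    then show "S = M" using max CM unfolding A_def singular_subspace_def by blast
  qed
  moreover have "projective_space_of_dim (induced \<Delta> M) 2"
    using calculation rank3 unfolding polar_space_of_rank_def by simp
  ultimately show ?thesis using CM unfolding planes_def maximal_singular_def by blast
qed

text \<open>The axioms do not state that two points lie on at most one line. But the points of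
  \<open>l\<close> and \<open>m\<close> are pairwise collinear, so both lines lie in one plane, and
  there the projective axioms apply.\<close>

lemma line_unique:
  assumes "l \<in> lines \<Delta>" "m \<in> lines \<Delta>" "x \<in> l" "y \<in> l" "x \<in> m" "y \<in> m" "x \<noteq> y"
  shows "l = m"
proof -
  have "a \<sim> b" if "a \<in> l" "b \<in> m" for a b
    using perp_line[of m x y a b] line_coll assms that by blast
  then obtain M where M: "M \<in> planes \<Delta>" "l \<union> m \<subseteq> M"
    using clique_maximal[of "l \<union> m"] line_coll assms sym by blast
  then have "projective_space (induced \<Delta> M)" unfolding planes_def projective_space_of_dim_def by blast
  then have "\<forall>x\<in>points (induced \<Delta> M). \<forall>y\<in>points (induced \<Delta> M). x \<noteq> y \<longrightarrow>
      (\<exists>!l. l \<in> lines (induced \<Delta> M) \<and> x \<in> l \<and> y \<in> l)"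
    unfolding projective_space_def by (elim conjE)
  moreover have "x \<in> M" "y \<in> M" using M(2) assms(3,4) by blast+
  ultimately have "\<exists>!l. l \<in> lines (induced \<Delta> M) \<and> x \<in> l \<and> y \<in> l"
    using assms(7) by simp
  moreover have "l \<in> lines (induced \<Delta> M)" "m \<in> lines (induced \<Delta> M)" using M(2) assms(1,2) by auto
  ultimately show ?thesis using assms(3-6) by blast
qed

lemma jn_eq: "l \<in> lines \<Delta> \<Longrightarrow> x \<in> l \<Longrightarrow> y \<in> l \<Longrightarrow> x \<noteq> y \<Longrightarrow> jn x y = l"
  unfolding jn_def by (rule the_equality) (meson line_unique)+

lemma jn: assumes "x \<sim> y" "x \<noteq> y"
  shows "jn x y \<in> lines \<Delta>" "x \<in> jn x y" "y \<in> jn x y"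
proof -
  obtain l where "l \<in> lines \<Delta>" "x \<in> l" "y \<in> l" using assms unfolding coll_def by blast
  then show "jn x y \<in> lines \<Delta>" "x \<in> jn x y" "y \<in> jn x y" using jn_eq assms by metis+
qed

lemma pr_eq:
  assumes "l \<in> lines \<Delta>" "z \<in> l" "\<not> a \<sim> z" "y \<in> l" "a \<sim> y"
  shows "pr a l = y"
  unfolding pr_def using perp_line[of l] assms by blast

lemma pr:
  assumes "l \<in> lines \<Delta>" "z \<in> l" "\<not> a \<sim> z" "a \<in> P"
  shows "pr a l \<in> l" "a \<sim> pr a l"
proof -
  obtain y where "y \<in> l" "a \<sim> y" using meet_ex assms by blast
  then show "pr a l \<in> l" "a \<sim> pr a l" using pr_eq assms by metis+
qed

lemma perp_jn: "x \<sim> y \<Longrightarrow> x \<noteq> y \<Longrightarrow> a \<sim> x \<Longrightarrow> a \<sim> y \<Longrightarrow> z \<in> jn x y \<Longrightarrow> a \<sim> z"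
  using perp_line jn by blast

section \<open>Planes: incidence, maximality and existence\<close>

lemma plane_P: "\<pi> \<in> planes \<Delta> \<Longrightarrow> x \<in> \<pi> \<Longrightarrow> x \<in> P"
  and plane_coll: "\<pi> \<in> planes \<Delta> \<Longrightarrow> x \<in> \<pi> \<Longrightarrow> y \<in> \<pi> \<Longrightarrow> x \<sim> y"
  and plane_line: "\<pi> \<in> planes \<Delta> \<Longrightarrow> x \<in> \<pi> \<Longrightarrow> y \<in> \<pi> \<Longrightarrow> x \<noteq> y \<Longrightarrow> l \<in> lines \<Delta> \<Longrightarrow> x \<in> l \<Longrightarrow> y \<in> l \<Longrightarrow> l \<subseteq> \<pi>"
  unfolding planes_def singular_subspace_def geo_subspace_def by blast+

lemma plane_jn: "\<pi> \<in> planes \<Delta> \<Longrightarrow> x \<in> \<pi> \<Longrightarrow> y \<in> \<pi> \<Longrightarrow> x \<noteq> y \<Longrightarrow> jn x y \<in> lines \<Delta> \<and> jn x y \<subseteq> \<pi>"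
  using plane_line plane_coll jn by metis

lemma plane_meet:
  assumes "\<pi> \<in> planes \<Delta>" "l \<in> lines \<Delta>" "m \<in> lines \<Delta>" "l \<subseteq> \<pi>" "m \<subseteq> \<pi>"
  shows "\<exists>x. x \<in> l \<and> x \<in> m"
  using projective_plane_lines_meet[of "induced \<Delta> \<pi>" l m] assms unfolding planes_def by auto

text \<open>A plane contained in a line would be spanned by two points, against the lower bound of
  three in its dimension.\<close>

lemma plane_triangle:
  assumes "\<pi> \<in> planes \<Delta>"
  shows "\<exists>a b c. a \<in> \<pi> \<and> b \<in> \<pi> \<and> c \<in> \<pi> \<and> a \<noteq> b \<and> c \<notin> jn a b"
proof (rule ccontr)
  assume no: "\<not> ?thesis"
  have pd: "projective_space_of_dim (induced \<Delta> \<pi>) 2" using assms unfolding planes_def by blast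
  then obtain B where B: "B \<subseteq> \<pi>" "card B = 3"
    unfolding projective_space_of_dim_def by auto
  then obtain a b where ab: "a \<in> \<pi>" "b \<in> \<pi>" "a \<noteq> b" by (auto simp: card_3_iff)
  have "\<pi> \<subseteq> jn a b" using no ab by blast
  then have "geo_span (induced \<Delta> \<pi>) {a, b} = \<pi>"
  proof -
    have "\<pi> \<subseteq> S" if S: "geo_subspace (induced \<Delta> \<pi>) S" "{a, b} \<subseteq> S" for S
    proof -
      have "jn a b \<in> lines (induced \<Delta> \<pi>)" using plane_jn assms ab by simp
      moreover have "a \<in> jn a b" "b \<in> jn a b" using jn plane_coll ab assms by blast+
      ultimately have "jn a b \<subseteq> S" using S ab unfolding geo_subspace_def by blast
      then show ?thesis using \<open>\<pi> \<subseteq> jn a b\<close> by blast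
    qed
    moreover have "geo_subspace (induced \<Delta> \<pi>) \<pi>" unfolding geo_subspace_def by simp
    ultimately show ?thesis unfolding geo_span_def using ab by blast
  qed
  moreover have "\<forall>B\<subseteq>points (induced \<Delta> \<pi>). finite B \<and> geo_span (induced \<Delta> \<pi>) B = points (induced \<Delta> \<pi>) \<longrightarrow> 2 + 1 \<le> card B"
    using pd unfolding projective_space_of_dim_def by (elim conjE)
  ultimately have "2 + 1 \<le> card {a, b}" using ab by (metis induced_simps(1) empty_subsetI finite.emptyI finite_insert insert_subset)
  then show False using ab by (simp add: card_insert_if)
qed

lemma plane_off:
  assumes "\<pi> \<in> planes \<Delta>" "l \<in> lines \<Delta>"
  shows "\<exists>x\<in>\<pi>. x \<notin> l"
proof -
  obtain a b c where "a \<in> \<pi>" "b \<in> \<pi>" "c \<in> \<pi>" "a \<noteq> b" "c \<notin> jn a b" using plane_triangle assms by blast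
  then show ?thesis using jn_eq assms by metis
qed

text \<open>The join of \<open>a\<close> with another point of \<open>\<pi>\<close> meets
  \<open>l\<close>, which gives a second point of that join in \<open>\<rho>\<close>.\<close>

lemma plane_subset_eq:
  assumes "\<pi> \<in> planes \<Delta>" "\<rho> \<in> planes \<Delta>" "l \<in> lines \<Delta>" "l \<subseteq> \<pi>" "l \<subseteq> \<rho>" "a \<in> \<pi>" "a \<in> \<rho>" "a \<notin> l"
  shows "\<pi> \<subseteq> \<rho>"
proof
  fix x assume x: "x \<in> \<pi>"
  show "x \<in> \<rho>"
  proof (cases "x = a")
    case False
    have c: "a \<sim> x" using plane_coll assms x by blast
    have j: "jn a x \<in> lines \<Delta>" "jn a x \<subseteq> \<pi>" "a \<in> jn a x" "x \<in> jn a x" using plane_jn assms x jn[OF c] False by auto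
    obtain y where y: "y \<in> l" "y \<in> jn a x" using plane_meet[of \<pi> l "jn a x"] assms j by blast
    then have "y \<noteq> a" "y \<in> \<rho>" using assms by auto
    then have "jn a x \<subseteq> \<rho>" using plane_line[of \<rho> a y "jn a x"] assms j y by blast
    then show ?thesis using j by blast
  qed (use assms in simp)
qed

lemma plane_eq:
  assumes "\<pi> \<in> planes \<Delta>" "\<rho> \<in> planes \<Delta>" "l \<in> lines \<Delta>" "l \<subseteq> \<pi>" "l \<subseteq> \<rho>" "a \<in> \<pi>" "a \<in> \<rho>" "a \<notin> l"
  shows "\<pi> = \<rho>"
  by (rule subset_antisym[OF plane_subset_eq[OF assms] plane_subset_eq[OF assms(2,1,3,5,4,7,6,8)]])

lemma plane_has_line: "\<pi> \<in> planes \<Delta> \<Longrightarrow> \<exists>l a. l \<in> lines \<Delta> \<and> l \<subseteq> \<pi> \<and> a \<in> \<pi> \<and> a \<notin> l"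
  using plane_triangle plane_jn by metis

lemma plane_max:
  assumes "\<pi> \<in> planes \<Delta>" "x \<in> P" "\<And>y. y \<in> \<pi> \<Longrightarrow> x \<sim> y"
  shows "x \<in> \<pi>"
proof -
  have "y \<sim> z" if "y \<in> insert x \<pi>" "z \<in> insert x \<pi>" for y z
    using that assms(3) plane_coll[OF assms(1)] sym coll_refl[OF assms(2)] by (metis insertE)
  then obtain M where M: "M \<in> planes \<Delta>" "insert x \<pi> \<subseteq> M" using clique_maximal by meson
  obtain l a where "l \<in> lines \<Delta>" "l \<subseteq> \<pi>" "a \<in> \<pi>" "a \<notin> l" using plane_has_line assms by blast
  then have "\<pi> = M" using plane_eq[of \<pi> M l a] M assms by blast
  then show ?thesis using M by blast
qed

lemma plane_ex:
  assumes "l \<in> lines \<Delta>" "a \<in> P" "\<And>x. x \<in> l \<Longrightarrow> a \<sim> x"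
  shows "\<exists>\<pi>\<in>planes \<Delta>. l \<subseteq> \<pi> \<and> a \<in> \<pi>"
proof -
  have "y \<sim> z" if "y \<in> insert a l" "z \<in> insert a l" for y z
    using that assms(3) line_coll[OF assms(1)] sym coll_refl[OF assms(2)] by (metis insertE)
  then show ?thesis using clique_maximal[of "insert a l"] by (metis insert_subset)
qed

lemma plane_ex3:
  assumes "a \<sim> b" "b \<sim> c" "c \<sim> a" "a \<noteq> b"
  shows "\<exists>\<pi>\<in>planes \<Delta>. a \<in> \<pi> \<and> b \<in> \<pi> \<and> c \<in> \<pi>"
  using plane_ex[OF jn(1)[OF assms(1,4)] colP(2)[OF assms(2)] perp_jn[OF assms(1,4,3) sym[OF assms(2)]]]
    jn(2,3)[OF assms(1,4)] by blast

lemma plane_thick: "l \<in> lines \<Delta> \<Longrightarrow> \<exists>\<pi>\<in>planes \<Delta>. l \<subseteq> \<pi> \<and> \<pi> \<noteq> \<pi>1 \<and> \<pi> \<noteq> \<pi>2"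
  using third_element[of "{\<pi> \<in> planes \<Delta>. l \<subseteq> \<pi>}" \<pi>1 \<pi>2] thick[unfolded thick_rank3_def] by simp blast

section \<open>The trace of a point on a plane\<close>

definition tr where "tr \<pi> x = {y \<in> \<pi>. x \<sim> y}"

text \<open>Two lines of the plane through a point \<open>u\<close> not collinear to
  \<open>x\<close> contain one point each collinear to \<open>x\<close>. These two points span a
  line in the trace, and any point of the trace off that line would make \<open>x\<close> collinear
  to \<open>u\<close>.\<close>

lemma tr_line:
  assumes "\<pi> \<in> planes \<Delta>" "x \<in> P" "x \<notin> \<pi>"
  shows "tr \<pi> x \<in> lines \<Delta>"
proof -
  obtain u where u: "u \<in> \<pi>" "\<not> x \<sim> u" using plane_max assms by blast
  obtain l where l: "l \<in> lines \<Delta>" "l \<subseteq> \<pi>" "u \<in> l"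
  proof -
    obtain l0 where "l0 \<in> lines \<Delta>" "l0 \<subseteq> \<pi>" using plane_has_line assms by blast
    then obtain z where "z \<in> \<pi>" "z \<noteq> u" using third by blast
    then show ?thesis using plane_jn[of \<pi> u z] jn[of u z] plane_coll u assms that by blast
  qed
  obtain w where w: "w \<in> \<pi>" "w \<notin> l" using plane_off l assms by blast
  then have m: "jn u w \<in> lines \<Delta>" "jn u w \<subseteq> \<pi>" "u \<in> jn u w" "w \<in> jn u w"
    using plane_jn[of \<pi> u w] jn[of u w] plane_coll u l assms by blast+
  define a b where "a = pr x l" and "b = pr x (jn u w)"
  have ab: "a \<in> l" "x \<sim> a" "b \<in> jn u w" "x \<sim> b" unfolding a_def b_def using pr l m u assms by blast+
  have "a \<noteq> b"
  proof
    assume "a = b"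
    moreover have "a \<noteq> u" using ab u by blast
    ultimately have "l = jn u w" using line_unique[of l "jn u w" a u] ab l m by blast
    then show False using w m by blast
  qed
  have P: "a \<in> \<pi>" "b \<in> \<pi>" using ab l m by blast+
  have j: "jn a b \<in> lines \<Delta>" "jn a b \<subseteq> \<pi>" "a \<in> jn a b" "b \<in> jn a b"
    using plane_jn[of \<pi> a b] jn[of a b] plane_coll P \<open>a \<noteq> b\<close> assms by blast+
  have "jn a b \<subseteq> tr \<pi> x" unfolding tr_def using perp_line[of "jn a b" a b x] j ab \<open>a \<noteq> b\<close> by blast
  moreover have "y \<in> jn a b" if y: "y \<in> \<pi>" "x \<sim> y" for y
  proof (rule ccontr)
    assume n: "y \<notin> jn a b"
    have "u \<noteq> y" using u y by blast
    then have k: "jn u y \<in> lines \<Delta>" "jn u y \<subseteq> \<pi>" "u \<in> jn u y" "y \<in> jn u y"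
      using plane_jn[of \<pi> u y] jn[of u y] plane_coll y u assms by blast+
    obtain z where z: "z \<in> jn u y" "z \<in> jn a b" using plane_meet[OF assms(1) k(1) j(1)] k j by blast
    have "x \<sim> z" using perp_line[of "jn a b" a b x] j ab \<open>a \<noteq> b\<close> z by blast
    then have "x \<sim> u" using perp_line[of "jn u y" z y x u] k z y n by blast
    then show False using u by blast
  qed
  ultimately have "tr \<pi> x = jn a b" unfolding tr_def by blast
  then show ?thesis using j by simp
qed

lemma tr_sub: "tr \<pi> x \<subseteq> \<pi>" unfolding tr_def by blast

lemma plane_sub_line_eq:
  "l \<in> lines \<Delta> \<Longrightarrow> m \<in> lines \<Delta> \<Longrightarrow> l \<subseteq> m \<Longrightarrow> l = m"
  using third line_unique by (metis subsetD)

lemma plane_max3: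
  assumes "\<pi> \<in> planes \<Delta>" "p \<in> \<pi>" "q \<in> \<pi>" "r \<in> \<pi>" "p \<noteq> q" "r \<notin> jn p q" "x \<sim> p" "x \<sim> q" "x \<sim> r"
  shows "x \<in> \<pi>"
proof (rule ccontr)
  assume "x \<notin> \<pi>"
  then have "tr \<pi> x \<in> lines \<Delta>" using tr_line assms(1) colP(1)[OF assms(7)] by blast
  moreover have "p \<in> tr \<pi> x" "q \<in> tr \<pi> x" "r \<in> tr \<pi> x" unfolding tr_def using assms by blast+
  ultimately show False using jn_eq assms(5,6) by metis
qed

lemma plane_ex_line: "\<pi> \<in> planes \<Delta> \<Longrightarrow> \<exists>x y. x \<in> \<pi> \<and> y \<in> \<pi> \<and> x \<noteq> y"
  using plane_triangle by blast

lemma point_on_plane: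
  assumes "v \<in> P" shows "\<exists>\<pi>\<in>planes \<Delta>. v \<in> \<pi>"
  using clique_maximal[of "{v}"] assms coll_refl by (metis insert_subset singletonD)

text \<open>In a plane containing \<open>v\<close> and \<open>t\<close> take a line through
  \<open>v\<close> that misses \<open>t\<close>. By thickness it lies in a second plane, which
  cannot contain \<open>t\<close>.\<close>

lemma plane_avoid:
  assumes "v \<sim> t" "v \<noteq> t"
  shows "\<exists>\<rho>\<in>planes \<Delta>. v \<in> \<rho> \<and> t \<notin> \<rho>"
proof -
  have j: "jn v t \<in> lines \<Delta>" "v \<in> jn v t" "t \<in> jn v t" using jn assms by blast+
  obtain \<pi> where \<pi>: "\<pi> \<in> planes \<Delta>" "jn v t \<subseteq> \<pi>" using plane_thick[OF j(1)] by blast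
  obtain x where x: "x \<in> \<pi>" "x \<notin> jn v t" using plane_off \<pi> j by blast
  have "v \<sim> x" "v \<noteq> x" using plane_coll[OF \<pi>(1)] \<pi> j x by blast+
  then have k: "jn v x \<in> lines \<Delta>" "v \<in> jn v x" "x \<in> jn v x" using jn by blast+
  have kp: "jn v x \<subseteq> \<pi>" using plane_jn[OF \<pi>(1)] \<pi> j x \<open>v \<noteq> x\<close> by blast
  obtain \<rho> where \<rho>: "\<rho> \<in> planes \<Delta>" "jn v x \<subseteq> \<rho>" "\<rho> \<noteq> \<pi>" using plane_thick[OF k(1)] by blast
  have "t \<notin> jn v x" using line_unique[OF j(1) k(1) j(2) j(3) k(2) _ assms(2)] x k(3) by blast
  then have "t \<notin> \<rho>" using plane_eq[OF \<rho>(1) \<pi>(1) k(1) \<rho>(2) kp, of t] \<rho>(3) \<pi>(2) j(3) by blast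
  then show ?thesis using \<rho> k by blast
qed

section \<open>The quadrangle of points collinear to two opposite points\<close>

definition dp where "dp u v = {x. u \<sim> x \<and> v \<sim> x}"

lemma dp_jn:
  assumes "x \<in> dp u v" "y \<in> dp u v" "x \<sim> y" "x \<noteq> y" "z \<in> jn x y"
  shows "z \<in> dp u v"
  using perp_jn[OF assms(3,4) _ _ assms(5)] assms(1,2) unfolding dp_def by simp

text \<open>Lines through \<open>x\<close> in the quadrangle correspond to planes on the line
  \<open>u x\<close>, so thickness supplies a line different from those towards \<open>t1\<close>
  and \<open>t2\<close>. Callers pass the same point twice when only one line has to be
  avoided.\<close>

lemma dp_third:
  assumes uv: "\<not> u \<sim> v" and x: "x \<in> dp u v"
    and t1: "t1 \<in> dp u v" "t1 \<sim> x" "t1 \<noteq> x" and t2: "t2 \<in> dp u v" "t2 \<sim> x" "t2 \<noteq> x"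
  shows "\<exists>m\<in>dp u v. x \<sim> m \<and> x \<noteq> m \<and> \<not> t1 \<sim> m \<and> \<not> t2 \<sim> m"
proof -
  have ux: "u \<sim> x" "u \<noteq> x" "v \<sim> x" using x uv sym[of v x] unfolding dp_def by blast+
  have j: "jn u x \<in> lines \<Delta>" "u \<in> jn u x" "x \<in> jn u x" using jn ux by blast+
  have off: "t \<notin> jn u x" if t: "t \<in> dp u v" "t \<sim> x" "t \<noteq> x" for t
  proof
    assume "t \<in> jn u x"
    then have "v \<sim> u" using perp_line[OF j(1) _ j(3) t(3) _ ux(3) j(2)] t unfolding dp_def by blast
    then show False using uv sym by blast
  qed
  have ut1: "t1 \<sim> u" using t1(1) sym[of u t1] unfolding dp_def by blast
  obtain \<pi>1 where 1: "\<pi>1 \<in> planes \<Delta>" "jn u x \<subseteq> \<pi>1" "t1 \<in> \<pi>1"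
    using plane_ex[OF j(1) colP(1)[OF t1(2)] perp_jn[OF ux(1,2) ut1 t1(2)]] by blast
  have ut2: "t2 \<sim> u" using t2(1) sym[of u t2] unfolding dp_def by blast
  obtain \<pi>2 where 2: "\<pi>2 \<in> planes \<Delta>" "jn u x \<subseteq> \<pi>2" "t2 \<in> \<pi>2"
    using plane_ex[OF j(1) colP(1)[OF t2(2)] perp_jn[OF ux(1,2) ut2 t2(2)]] by blast
  obtain \<rho> where \<rho>: "\<rho> \<in> planes \<Delta>" "jn u x \<subseteq> \<rho>" "\<rho> \<noteq> \<pi>1" "\<rho> \<noteq> \<pi>2"
    using plane_thick[OF j(1), of \<pi>1 \<pi>2] by blast
  have n1: "t1 \<notin> \<rho>" using plane_eq[OF \<rho>(1) 1(1) j(1) \<rho>(2) 1(2) _ 1(3) off[OF t1]] \<rho>(3) by blast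
  have n2: "t2 \<notin> \<rho>" using plane_eq[OF \<rho>(1) 2(1) j(1) \<rho>(2) 2(2) _ 2(3) off[OF t2]] \<rho>(4) by blast
  have xu: "x \<in> \<rho>" "u \<in> \<rho>" using \<rho> j by blast+
  have "v \<notin> \<rho>" using plane_coll[OF \<rho>(1) xu(2)] uv by blast
  then have l: "tr \<rho> v \<in> lines \<Delta>" using tr_line \<rho>(1) colP(1)[OF ux(3)] by blast
  then obtain m where m: "m \<in> tr \<rho> v" "m \<noteq> x" using third by blast
  then have m': "m \<in> \<rho>" "v \<sim> m" unfolding tr_def by blast+
  have um: "u \<sim> m" "x \<sim> m" using plane_coll \<rho>(1) xu m'(1) by blast+
  have "m \<notin> jn u x"
  proof
    assume "m \<in> jn u x"
    then have "v \<sim> u" using perp_line[OF j(1) _ j(3) m(2) m'(2) ux(3) j(2)] by blast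
    then show False using uv sym by blast
  qed
  then have "\<not> t1 \<sim> m" "\<not> t2 \<sim> m"
    using plane_max3[OF \<rho>(1) xu(2,1) m'(1) ux(2) _ ut1 t1(2)] plane_max3[OF \<rho>(1) xu(2,1) m'(1) ux(2) _ ut2 t2(2)] n1 n2
    by blast+
  then show ?thesis using m' um m(2) unfolding dp_def by blast
qed

lemma dp_nbr:
  assumes uv: "\<not> u \<sim> v" and x: "x \<in> dp u v"
  shows "\<exists>m\<in>dp u v. x \<sim> m \<and> x \<noteq> m"
proof -
  have ux: "u \<sim> x" "u \<noteq> x" "v \<sim> x" using x uv sym[of v x] unfolding dp_def by blast+
  have j: "jn u x \<in> lines \<Delta>" "u \<in> jn u x" "x \<in> jn u x" using jn ux by blast+
  obtain \<rho> where \<rho>: "\<rho> \<in> planes \<Delta>" "jn u x \<subseteq> \<rho>" using plane_thick[OF j(1)] by blast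
  then have xu: "x \<in> \<rho>" "u \<in> \<rho>" using j by blast+
  have "v \<notin> \<rho>" using plane_coll[OF \<rho>(1) xu(2)] uv by blast
  then have l: "tr \<rho> v \<in> lines \<Delta>" using tr_line \<rho>(1) colP(1)[OF ux(3)] by blast
  then obtain m where m: "m \<in> tr \<rho> v" "m \<noteq> x" using third by blast
  then show ?thesis unfolding tr_def dp_def using plane_coll[OF \<rho>(1)] xu by blast
qed

lemma dp_non:
  assumes uv: "\<not> u \<sim> v" and x: "x \<in> dp u v"
  shows "\<exists>m\<in>dp u v. \<not> x \<sim> m"
proof -
  obtain m where m: "m \<in> dp u v" "x \<sim> m" "x \<noteq> m" using dp_nbr[OF uv x] by blast
  obtain w where "w \<in> dp u v" "\<not> x \<sim> w" using dp_third[OF uv m(1) x m(2,3) x m(2,3)] by blast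
  then show ?thesis by blast
qed

text \<open>Connectedness of the points of \<open>U\<close> not collinear to \<open>c\<close>,
  phrased as an induction rule; \<open>U\<close> will be the quadrangle \<open>dp u v\<close> or the
  whole point set. If \<open>a\<close> and \<open>b\<close> have no common neighbour of this kind,
  the path \<open>a\<close>, \<open>w\<close>, \<open>s'\<close>, \<open>b\<close> of length three
  works.\<close>

lemma hyperplane_complement_connected_gen:
  assumes UP: "U \<subseteq> P"
    and sub: "\<And>x y z. x \<in> U \<Longrightarrow> y \<in> U \<Longrightarrow> x \<sim> y \<Longrightarrow> x \<noteq> y \<Longrightarrow> z \<in> jn x y \<Longrightarrow> z \<in> U"
    and nbr: "\<And>x. x \<in> U \<Longrightarrow> \<exists>y\<in>U. x \<sim> y \<and> x \<noteq> y"
    and nd: "\<And>x t. x \<in> U \<Longrightarrow> t \<in> U \<Longrightarrow> x \<sim> t \<Longrightarrow> x \<noteq> t \<Longrightarrow> \<exists>m\<in>U. x \<sim> m \<and> \<not> t \<sim> m"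
    and a: "a \<in> U" "\<not> c \<sim> a" and b: "b \<in> U" "\<not> c \<sim> b" and Q: "Q a"
    and step: "\<And>x y. x \<in> U \<Longrightarrow> y \<in> U \<Longrightarrow> \<not> c \<sim> x \<Longrightarrow> \<not> c \<sim> y \<Longrightarrow> x \<sim> y \<Longrightarrow> Q x \<Longrightarrow> Q y"
  shows "Q b"
proof (cases "\<exists>w\<in>U. a \<sim> w \<and> w \<sim> b \<and> \<not> c \<sim> w")
  case True
  then show ?thesis using step a b Q by metis
next
  case False
  then have cm: "\<And>w. w \<in> U \<Longrightarrow> a \<sim> w \<Longrightarrow> w \<sim> b \<Longrightarrow> c \<sim> w" by blast
  have aP: "a \<in> P" "b \<in> P" using a b UP by blast+
  have nab: "\<not> a \<sim> b" using cm[OF b(1)] b(2) coll_refl[OF aP(2)] by blast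
  obtain y where y: "y \<in> U" "a \<sim> y" "a \<noteq> y" using nbr a by blast
  define L where "L = jn a y"
  have L: "L \<in> lines \<Delta>" "a \<in> L" unfolding L_def using jn y by blast+
  have LU: "\<And>z. z \<in> L \<Longrightarrow> z \<in> U" unfolding L_def using sub[OF a(1) y] .
  define t where "t = pr b L"
  have nba: "\<not> b \<sim> a" using nab sym by blast
  have t: "t \<in> L" "b \<sim> t" unfolding t_def using pr[OF L nba aP(2)] by blast+
  have ct: "c \<sim> t" using cm[OF LU[OF t(1)] line_coll[OF L t(1)] sym[OF t(2)]] .
  obtain w where w: "w \<in> L" "w \<noteq> a" "w \<noteq> t" using third[OF L(1)] by blast
  have cw: "\<not> c \<sim> w" using perp_line[OF L(1) w(1) t(1) w(3) _ ct L(2)] a(2) by blast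
  have aw: "a \<sim> w" using line_coll L w by blast
  have bw: "\<not> b \<sim> w" using cm[OF LU[OF w(1)] aw] cw sym[of b w] by blast
  have Qw: "Q w" using step[OF a(1) LU[OF w(1)] a(2) cw aw Q] .
  have bt: "b \<noteq> t" using ct b(2) by blast
  \<comment> \<open>The line \<open>M\<close> through \<open>b\<close> is not contained in the perp
    of \<open>t\<close>; this makes the projections of \<open>a\<close> and \<open>w\<close> on
    \<open>M\<close> distinct. Only the first of them is collinear to \<open>c\<close>, so
    \<open>s'\<close> lies in the complement.\<close>
  obtain m where m: "m \<in> U" "b \<sim> m" "\<not> t \<sim> m" using nd[OF b(1) LU[OF t(1)] t(2) bt] by blast
  have bm: "b \<noteq> m" using m t(2) sym by blast
  define M where "M = jn b m"
  have M: "M \<in> lines \<Delta>" "b \<in> M" "m \<in> M" unfolding M_def using jn m bm by blast+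
  have MU: "\<And>z. z \<in> M \<Longrightarrow> z \<in> U" unfolding M_def using sub[OF b(1) m(1,2) bm] .
  define s where "s = pr a M"
  have s: "s \<in> M" "a \<sim> s" unfolding s_def using pr[OF M(1,2) nab aP(1)] by blast+
  have cs: "c \<sim> s" using cm[OF MU[OF s(1)] s(2) line_coll[OF M(1) s(1) M(2)]] .
  define s' where "s' = pr w M"
  have nwb: "\<not> w \<sim> b" using bw sym by blast
  have wP: "w \<in> P" using LU w UP by blast
  have s': "s' \<in> M" "w \<sim> s'" unfolding s'_def using pr[OF M(1,2) nwb wP] by blast+
  have "s' \<noteq> s"
  proof
    assume "s' = s"
    then have "s \<sim> t" using perp_line[OF L(1) L(2) w(1) w(2)[symmetric] sym[OF s(2)] _ t(1)] s'(2) sym by blast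
    moreover have "s \<noteq> b" using s(2) nab by blast
    ultimately have "t \<sim> m" using perp_line[OF M(1) s(1) M(2) _ sym sym[OF t(2)] M(3)] by blast
    then show False using m by blast
  qed
  then have cs': "\<not> c \<sim> s'" using perp_line[OF M(1) s'(1) s(1) _ _ cs M(2)] b(2) by blast
  have "Q s'" using step[OF LU[OF w(1)] MU[OF s'(1)] cw cs' s'(2) Qw] .
  then show ?thesis using step[OF MU[OF s'(1)] b(1) cs' b(2) line_coll[OF M(1) s'(1) M(2)]] by blast
qed

lemma dp_connected:
  assumes uv: "\<not> u \<sim> v"
    and "a \<in> dp u v" "\<not> c \<sim> a" "b \<in> dp u v" "\<not> c \<sim> b" "Q a"
    and "\<And>x y. x \<in> dp u v \<Longrightarrow> y \<in> dp u v \<Longrightarrow> \<not> c \<sim> x \<Longrightarrow> \<not> c \<sim> y \<Longrightarrow> x \<sim> y \<Longrightarrow> Q x \<Longrightarrow> Q y"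
  shows "Q b"
proof (rule hyperplane_complement_connected_gen[where U = "dp u v" and a = a and c = c and Q = Q])
  show "dp u v \<subseteq> P" unfolding dp_def using colP(2) by blast
  show "\<exists>m\<in>dp u v. x \<sim> m \<and> \<not> t \<sim> m" if "x \<in> dp u v" "t \<in> dp u v" "x \<sim> t" "x \<noteq> t" for x t
    using dp_third[OF uv that(1,2) sym[OF that(3)] that(4)[symmetric] that(2) sym[OF that(3)] that(4)[symmetric]] by blast
  show "\<exists>y\<in>dp u v. x \<sim> y \<and> x \<noteq> y" if "x \<in> dp u v" for x using dp_nbr[OF uv that] .
  show "z \<in> dp u v" if "x \<in> dp u v" "y \<in> dp u v" "x \<sim> y" "x \<noteq> y" "z \<in> jn x y" for x y z
    using dp_jn[OF that] .
qed (fact assms)+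

lemma opp_connected:
  assumes "a \<in> P" "\<not> c \<sim> a" "b \<in> P" "\<not> c \<sim> b" "Q a"
    and "\<And>x y. x \<in> P \<Longrightarrow> y \<in> P \<Longrightarrow> \<not> c \<sim> x \<Longrightarrow> \<not> c \<sim> y \<Longrightarrow> x \<sim> y \<Longrightarrow> Q x \<Longrightarrow> Q y"
  shows "Q b"
proof (rule hyperplane_complement_connected_gen[where U = P and a = a and c = c and Q = Q])
  show "\<exists>m\<in>P. x \<sim> m \<and> \<not> t \<sim> m" if xt: "x \<in> P" "t \<in> P" "x \<sim> t" "x \<noteq> t" for x t
  proof -
    obtain \<rho> where \<rho>: "\<rho> \<in> planes \<Delta>" "x \<in> \<rho>" "t \<notin> \<rho>" using plane_avoid[OF xt(3,4)] by blast
    then obtain m where "m \<in> \<rho>" "\<not> t \<sim> m" using plane_max[OF _ xt(2)] by blast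
    then show ?thesis using \<rho> plane_coll plane_P by blast
  qed
  show "\<exists>y\<in>P. x \<sim> y \<and> x \<noteq> y" if x: "x \<in> P" for x
  proof -
    obtain \<pi> where \<pi>: "\<pi> \<in> planes \<Delta>" "x \<in> \<pi>" using point_on_plane x by blast
    then obtain y where "y \<in> \<pi>" "x \<noteq> y" using plane_ex_line by metis
    then show ?thesis using \<pi> plane_coll plane_P by blast
  qed
  show "z \<in> P" if "x \<sim> y" "x \<noteq> y" "z \<in> jn x y" for x y z
    using jn(1)[OF that(1,2)] line_sub that(3) by blast
qed (use assms in auto)

section \<open>Perspectivities and elations of planes\<close>

text \<open>If the traces agree, the common trace and \<open>x\<close> span a plane that also
  contains \<open>y\<close>. There the line \<open>x y\<close> of \<open>\<pi>\<close> meets the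
  trace, a line of \<open>\<rho>\<close>, although the planes are disjoint. With
  \<open>tr_surj\<close>, points of one plane thus correspond to lines of the other.\<close>

lemma tr_inj:
  assumes \<pi>: "\<pi> \<in> planes \<Delta>" and \<rho>: "\<rho> \<in> planes \<Delta>" and dis: "\<pi> \<inter> \<rho> = {}"
    and x: "x \<in> \<pi>" and y: "y \<in> \<pi>" and eq: "tr \<rho> x = tr \<rho> y"
  shows "x = y"
proof (rule ccontr)
  assume ne: "x \<noteq> y"
  have "x \<notin> \<rho>" using x dis by blast
  then have m: "tr \<rho> x \<in> lines \<Delta>" using tr_line \<rho> plane_P \<pi> x by blast
  obtain r1 where r1: "r1 \<in> tr \<rho> x" using third[OF m] by blast
  obtain r2 where r2: "r2 \<in> tr \<rho> x" "r2 \<noteq> r1" using third[OF m] by blast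
  have c: "x \<sim> r1" "x \<sim> r2" "y \<sim> r1" "y \<sim> r2" "r1 \<in> \<rho>" "r2 \<in> \<rho>" using r1 r2(1) eq unfolding tr_def by blast+
  have j: "jn r1 r2 = tr \<rho> x" using jn_eq[OF m r1 r2(1)] r2(2) by blast
  have nx: "x \<notin> jn r1 r2" using j \<open>x \<notin> \<rho>\<close> unfolding tr_def by blast
  obtain \<sigma> where \<sigma>: "\<sigma> \<in> planes \<Delta>" "r1 \<in> \<sigma>" "r2 \<in> \<sigma>" "x \<in> \<sigma>"
    using plane_ex3[OF plane_coll[OF \<rho> c(5,6)] sym[OF c(2)] c(1)] r2(2) by blast
  have "y \<in> \<sigma>" using plane_max3[OF \<sigma> _ nx c(3,4) plane_coll[OF \<pi> y x]] r2(2) by blast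
  then have k: "jn x y \<in> lines \<Delta>" "jn x y \<subseteq> \<sigma>" "jn x y \<subseteq> \<pi>" using plane_jn ne \<sigma> \<pi> x y by blast+
  have "jn r1 r2 \<subseteq> \<sigma>" using plane_jn[OF \<sigma>(1-3)] r2(2) by blast
  then obtain z where "z \<in> jn x y" "z \<in> tr \<rho> x" using plane_meet[OF \<sigma>(1) k(1) m k(2)] j by auto
  then show False using k(3) tr_sub dis by blast
qed

lemma tr_line_disjoint:
  assumes "\<pi> \<in> planes \<Delta>" "\<rho> \<in> planes \<Delta>" "\<pi> \<inter> \<rho> = {}" "x \<in> \<pi>"
  shows "tr \<rho> x \<in> lines \<Delta>"
  using tr_line[OF assms(2) plane_P[OF assms(1,4)]] assms by blast

lemma two_points: "l \<in> lines \<Delta> \<Longrightarrow> \<exists>x y. x \<in> l \<and> y \<in> l \<and> x \<noteq> y"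
  using third by metis

text \<open>The traces on \<open>\<pi>\<close> of two points of \<open>m\<close> meet, and the trace
  of the meeting point contains both of them.\<close>

lemma tr_surj:
  assumes \<pi>: "\<pi> \<in> planes \<Delta>" and \<rho>: "\<rho> \<in> planes \<Delta>" and dis: "\<pi> \<inter> \<rho> = {}"
    and m: "m \<in> lines \<Delta>" "m \<subseteq> \<rho>"
  shows "\<exists>x\<in>\<pi>. tr \<rho> x = m"
proof -
  obtain r1 r2 where r: "r1 \<in> m" "r2 \<in> m" "r1 \<noteq> r2" using two_points m by blast
  have dis': "\<rho> \<inter> \<pi> = {}" using dis by blast
  have R: "r1 \<in> \<rho>" "r2 \<in> \<rho>" using r m by blast+
  obtain x where x: "x \<in> tr \<pi> r1" "x \<in> tr \<pi> r2"
    using plane_meet[OF \<pi> tr_line_disjoint[OF \<rho> \<pi> dis' R(1)] tr_line_disjoint[OF \<rho> \<pi> dis' R(2)] tr_sub tr_sub] by blast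
  then have x': "x \<in> \<pi>" "x \<sim> r1" "x \<sim> r2" unfolding tr_def using sym by blast+
  then have "r1 \<in> tr \<rho> x" "r2 \<in> tr \<rho> x" using R unfolding tr_def by blast+
  then have "tr \<rho> x = m" using line_unique[OF tr_line_disjoint[OF \<pi> \<rho> dis x'(1)] m(1) _ _ r] by blast
  then show ?thesis using x' by blast
qed

lemma line_eq_tr:
  assumes \<pi>: "\<pi> \<in> planes \<Delta>" and \<rho>: "\<rho> \<in> planes \<Delta>" and dis: "\<pi> \<inter> \<rho> = {}"
    and l: "l \<in> lines \<Delta>" "l \<subseteq> \<pi>"
  shows "\<exists>r\<in>\<rho>. l = tr \<pi> r"
  using tr_surj[OF \<rho> \<pi> _ l] dis by blast

text \<open>A point-to-line correspondence followed by a line-to-point one, hence a collineation of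
  planes and not a correlation.\<close>

definition persp where "persp \<rho> \<pi>' x = (THE y. y \<in> \<pi>' \<and> tr \<rho> y = tr \<rho> x)"

lemma persp_eq:
  assumes "\<pi>' \<in> planes \<Delta>" "\<rho> \<in> planes \<Delta>" "\<pi>' \<inter> \<rho> = {}" "y \<in> \<pi>'" "tr \<rho> y = tr \<rho> x"
  shows "persp \<rho> \<pi>' x = y"
  unfolding persp_def using assms tr_inj[OF assms(1-3)] by (intro the_equality) auto

lemma persp_in:
  assumes "\<pi> \<in> planes \<Delta>" "\<rho> \<in> planes \<Delta>" "\<pi> \<inter> \<rho> = {}" "\<pi>' \<in> planes \<Delta>" "\<pi>' \<inter> \<rho> = {}" "x \<in> \<pi>"
  shows "persp \<rho> \<pi>' x \<in> \<pi>'" "tr \<rho> (persp \<rho> \<pi>' x) = tr \<rho> x"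
proof -
  obtain y where "y \<in> \<pi>'" "tr \<rho> y = tr \<rho> x"
    using tr_surj[OF assms(4,2,5) tr_line_disjoint[OF assms(1,2,3,6)] tr_sub] by blast
  then show "persp \<rho> \<pi>' x \<in> \<pi>'" "tr \<rho> (persp \<rho> \<pi>' x) = tr \<rho> x"
    using persp_eq[OF assms(4,2,5)] by auto
qed

lemma persp_inverse:
  assumes "\<pi> \<in> planes \<Delta>" "\<rho> \<in> planes \<Delta>" "\<pi> \<inter> \<rho> = {}" "\<pi>' \<in> planes \<Delta>" "\<pi>' \<inter> \<rho> = {}" "x \<in> \<pi>"
  shows "persp \<rho> \<pi> (persp \<rho> \<pi>' x) = x"
  using persp_eq[OF assms(1-3,6)] persp_in[OF assms] by simp

lemma persp_bij:
  assumes "\<pi> \<in> planes \<Delta>" "\<rho> \<in> planes \<Delta>" "\<pi> \<inter> \<rho> = {}" "\<pi>' \<in> planes \<Delta>" "\<pi>' \<inter> \<rho> = {}"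
  shows "bij_betw (persp \<rho> \<pi>') \<pi> \<pi>'"
  using persp_in(1)[OF assms] persp_in(1)[OF assms(4,2,5,1,3)] persp_inverse[OF assms] persp_inverse[OF assms(4,2,5,1,3)]
  by (intro bij_betw_byWitness[where f' = "persp \<rho> \<pi>"]) blast+

text \<open>Whether a point lies on the trace of \<open>r\<close> can be read off from its own trace
  on \<open>\<rho>\<close>, which the perspectivity preserves. Every line is such a trace by
  \<open>line_eq_tr\<close>, so this is why lines go to lines.\<close>

lemma persp_tr:
  assumes "\<pi> \<in> planes \<Delta>" "\<rho> \<in> planes \<Delta>" "\<pi> \<inter> \<rho> = {}" "\<pi>' \<in> planes \<Delta>" "\<pi>' \<inter> \<rho> = {}" "r \<in> \<rho>"
  shows "persp \<rho> \<pi>' ` tr \<pi> r = tr \<pi>' r"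
proof -
  have i: "x \<in> tr \<sigma> r \<longleftrightarrow> x \<in> \<sigma> \<and> r \<in> tr \<rho> x" for x \<sigma>
    unfolding tr_def using assms(6) sym by blast
  have 1: "persp \<rho> \<pi>' x \<in> tr \<pi>' r" if "x \<in> tr \<pi> r" for x
    using persp_in[OF assms(1-5)] that by (simp add: i)
  have 2: "persp \<rho> \<pi> x \<in> tr \<pi> r" if "x \<in> tr \<pi>' r" for x
    using persp_in[OF assms(4,2,5,1,3)] that by (simp add: i)
  have "x \<in> persp \<rho> \<pi>' ` tr \<pi> r" if "x \<in> tr \<pi>' r" for x
    using persp_inverse[OF assms(4,2,5,1,3), of x] 2[OF that] that tr_sub by (metis image_eqI subsetD)
  then show ?thesis using 1 by blast
qed

lemma persp_line:
  assumes "\<pi> \<in> planes \<Delta>" "\<rho> \<in> planes \<Delta>" "\<pi> \<inter> \<rho> = {}" "\<pi>' \<in> planes \<Delta>" "\<pi>' \<inter> \<rho> = {}"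
    "l \<in> lines \<Delta>" "l \<subseteq> \<pi>"
  shows "persp \<rho> \<pi>' ` l \<in> lines \<Delta> \<and> persp \<rho> \<pi>' ` l \<subseteq> \<pi>'"
proof -
  obtain r where r: "r \<in> \<rho>" "l = tr \<pi> r" using line_eq_tr[OF assms(1-3,6,7)] by blast
  have "\<rho> \<inter> \<pi>' = {}" using assms by blast
  then show ?thesis using persp_tr[OF assms(1-5) r(1)] r tr_sub tr_line_disjoint[OF assms(2,4) _ r(1)] by auto
qed

section \<open>Elations of a plane\<close>

definition elation where "elation d F \<pi> e \<longleftrightarrow> bij_betw e \<pi> \<pi> \<and> (\<forall>l\<in>lines \<Delta>. l \<subseteq> \<pi> \<longrightarrow> e ` l \<in> lines \<Delta>) \<and>
  (\<forall>x\<in>F. e x = x) \<and> (\<forall>l\<in>lines \<Delta>. l \<subseteq> \<pi> \<and> d \<in> l \<longrightarrow> e ` l = l)"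

lemma elation_bij: "elation d F \<pi> e \<Longrightarrow> bij_betw e \<pi> \<pi>"
  and elation_line: "elation d F \<pi> e \<Longrightarrow> l \<in> lines \<Delta> \<Longrightarrow> l \<subseteq> \<pi> \<Longrightarrow> e ` l \<in> lines \<Delta>"
  and elation_axis: "elation d F \<pi> e \<Longrightarrow> x \<in> F \<Longrightarrow> e x = x"
  and elation_center: "elation d F \<pi> e \<Longrightarrow> l \<in> lines \<Delta> \<Longrightarrow> l \<subseteq> \<pi> \<Longrightarrow> d \<in> l \<Longrightarrow> e ` l = l"
  unfolding elation_def by blast+

lemma elation_id: "elation d F \<pi> id"
  unfolding elation_def by simp

text \<open>The image of \<open>y\<close> is forced: it lies on the line \<open>d y\<close>, and on
  the line joining the image of \<open>q\<close> to the fixed point where \<open>q y\<close> meets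
  the axis.\<close>

lemma elation_unique_aux:
  assumes \<pi>: "\<pi> \<in> planes \<Delta>" and F: "F \<in> lines \<Delta>" "F \<subseteq> \<pi>" "d \<in> F"
    and e: "elation d F \<pi> e" and e': "elation d F \<pi> e'" and q: "q \<in> \<pi>" "q \<notin> F" "e q = e' q"
    and y: "y \<in> \<pi>" "y \<notin> F" "y \<notin> jn d q"
  shows "e y = e' y"
proof -
  have D: "d \<in> \<pi>" "d \<noteq> q" "d \<noteq> y" using F q y by blast+
  have dq: "jn d q \<in> lines \<Delta>" "d \<in> jn d q" "q \<in> jn d q" using jn[OF plane_coll[OF \<pi> D(1) q(1)] D(2)] by blast+
  have dy: "jn d y \<in> lines \<Delta>" "d \<in> jn d y" "y \<in> jn d y" using jn[OF plane_coll[OF \<pi> D(1) y(1)] D(3)] by blast+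
  have dyp: "jn d y \<subseteq> \<pi>" using plane_jn[OF \<pi> D(1) y(1) D(3)] by blast
  have qy: "q \<noteq> y" using dq(3) y(3) by blast
  define m where "m = jn q y"
  have m: "m \<in> lines \<Delta>" "q \<in> m" "y \<in> m" unfolding m_def using jn[OF plane_coll[OF \<pi> q(1) y(1)] qy] by blast+
  have mp: "m \<subseteq> \<pi>" unfolding m_def using plane_jn[OF \<pi> q(1) y(1) qy] by blast
  obtain a where a: "a \<in> m" "a \<in> F" using plane_meet[OF \<pi> m(1) F(1) mp F(2)] by blast
  have ad: "a \<noteq> d" using line_unique[OF m(1) dq(1) m(2) _ dq(3) dq(2) D(2)[symmetric]] a(1) m(3) y(3) by blast
  have "e q \<in> \<pi>" using bij_betwE[OF elation_bij[OF e]] q(1) by blast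
  then have eq: "e q \<notin> F" using elation_axis[OF e, of "e q"] elation_bij[OF e] q unfolding bij_betw_def inj_on_def by metis
  have ea: "e a = a" "e' a = a" using elation_axis[OF e a(2)] elation_axis[OF e' a(2)] by blast+
  have L: "e ` m \<in> lines \<Delta>" "e' ` m \<in> lines \<Delta>" using elation_line[OF e m(1) mp] elation_line[OF e' m(1) mp] by blast+
  have I: "e q \<in> e ` m" "a \<in> e ` m" "e q \<in> e' ` m" "a \<in> e' ` m" using m(2) a(1) ea q(3) by (metis image_eqI)+
  have "e q \<noteq> a" using eq a(2) by blast
  then have me: "e ` m = e' ` m" using line_unique[OF L I] by blast
  have "e ` m \<noteq> jn d y"
  proof
    assume "e ` m = jn d y"
    then have "jn d y = F" using line_unique[OF dy(1) F(1) _ dy(2) a(2) F(3) ad] I(2) by blast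
    then show False using dy(3) y(2) by blast
  qed
  moreover have "e y \<in> e ` m" "e' y \<in> e ` m" using m(3) me by blast+
  moreover have "e y \<in> jn d y" "e' y \<in> jn d y" using elation_center[OF e dy(1) dyp dy(2)] elation_center[OF e' dy(1) dyp dy(2)] dy(3) by blast+
  ultimately show ?thesis using line_unique[OF L(1) dy(1), of "e y" "e' y"] by blast
qed

lemma line_meet_eq:
  assumes "l \<in> lines \<Delta>" "m \<in> lines \<Delta>" "l \<noteq> m" "x \<in> l" "x \<in> m" "y \<in> l" "y \<in> m"
  shows "x = y"
  using line_unique[OF assms(1,2,4) assms(6,5,7)] assms(3) by blast

text \<open>Points of the line \<open>d q\<close> escape the previous argument. They are treated by
  replacing \<open>q\<close> with a point \<open>q1\<close> off that line, where agreement is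
  already known.\<close>

lemma elation_unique:
  assumes \<pi>: "\<pi> \<in> planes \<Delta>" and F: "F \<in> lines \<Delta>" "F \<subseteq> \<pi>" "d \<in> F"
    and e: "elation d F \<pi> e" and e': "elation d F \<pi> e'" and q: "q \<in> \<pi>" "q \<notin> F" "e q = e' q"
    and y: "y \<in> \<pi>"
  shows "e y = e' y"
proof (cases "y \<in> F")
  case True
  then show ?thesis using elation_axis[OF e] elation_axis[OF e'] by simp
next
  case yF: False
  have D: "d \<in> \<pi>" "d \<noteq> q" using F q by blast+
  have dq: "jn d q \<in> lines \<Delta>" "d \<in> jn d q" "q \<in> jn d q" using jn[OF plane_coll[OF \<pi> D(1) q(1)] D(2)] by blast+
  show ?thesis
  proof (cases "y \<in> jn d q")
    case False
    then show ?thesis using elation_unique_aux[OF \<pi> F e e' q y yF] by blast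
  next
    case True
    obtain f where f: "f \<in> F" "f \<noteq> d" using third[OF F(1)] by blast
    have fp: "f \<in> \<pi>" "f \<noteq> q" using f F q by blast+
    have fq: "jn f q \<in> lines \<Delta>" "f \<in> jn f q" "q \<in> jn f q" using jn[OF plane_coll[OF \<pi> fp(1) q(1)] fp(2)] by blast+
    obtain q1 where q1: "q1 \<in> jn f q" "q1 \<noteq> f" "q1 \<noteq> q" using third[OF fq(1)] by blast
    have q1p: "q1 \<in> \<pi>" using plane_jn[OF \<pi> fp(1) q(1) fp(2)] q1 by blast
    have q1F: "q1 \<notin> F" using line_unique[OF fq(1) F(1) q1(1) fq(2) _ f(1) q1(2)] fq(3) q(2) by blast
    have "jn f q \<noteq> jn d q"
    proof
      assume "jn f q = jn d q"
      then have "jn d q = F" using line_unique[OF dq(1) F(1) _ dq(2) f(1) F(3) f(2)] fq(2) by blast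
      then show False using dq(3) q(2) by blast
    qed
    then have q1d: "q1 \<notin> jn d q" using line_meet_eq[OF fq(1) dq(1) _ q1(1) _ fq(3) dq(3)] q1(3) by blast
    have e1: "e q1 = e' q1" using elation_unique_aux[OF \<pi> F e e' q q1p q1F q1d] .
    have "d \<noteq> q1" using q1d dq by blast
    then have dq1: "jn d q1 \<in> lines \<Delta>" "d \<in> jn d q1" "q1 \<in> jn d q1" using jn[OF plane_coll[OF \<pi> D(1) q1p]] by blast+
    have "y \<noteq> d" using yF F(3) by blast
    then have "y \<notin> jn d q1" using line_unique[OF dq1(1) dq(1) _ dq1(2) True dq(2)] dq1(3) q1d by blast
    then show ?thesis using elation_unique_aux[OF \<pi> F e e' q1p q1F e1 y yF] by blast
  qed
qed

lemma plane_avoid2: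
  assumes l: "l \<in> lines \<Delta>" and a: "a \<notin> l" and b: "b \<notin> l"
  shows "\<exists>\<delta>\<in>planes \<Delta>. l \<subseteq> \<delta> \<and> a \<notin> \<delta> \<and> b \<notin> \<delta>"
proof -
  \<comment> \<open>A point off \<open>l\<close> lies in at most one plane on \<open>l\<close>, so a
    third plane avoids both points. If no plane contains \<open>l\<close> and the point, the value
    of \<open>SOME\<close> is arbitrary and does no harm.\<close>
  define p where "p a = (SOME \<pi>. \<pi> \<in> planes \<Delta> \<and> l \<subseteq> \<pi> \<and> a \<in> \<pi>)" for a
  have p: "\<pi> = p a" if h: "\<pi> \<in> planes \<Delta>" "l \<subseteq> \<pi>" "a \<in> \<pi>" "a \<notin> l" for \<pi> a
  proof -
    have "p a \<in> planes \<Delta> \<and> l \<subseteq> p a \<and> a \<in> p a" unfolding p_def by (rule someI[of _ \<pi>]) (use h in blast)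
    then show ?thesis using plane_eq[OF h(1) _ l h(2) _ h(3) _ h(4)] by blast
  qed
  obtain \<delta> where "\<delta> \<in> planes \<Delta>" "l \<subseteq> \<delta>" "\<delta> \<noteq> p a" "\<delta> \<noteq> p b" using plane_thick[OF l, of "p a" "p b"] by blast
  then show ?thesis using p a b by blast
qed

text \<open>The plane is spanned by \<open>r\<close> and its trace on \<open>\<delta>\<close>. That
  trace is at the same time the trace of \<open>d\<close> on the new plane, so the points there
  collinear to \<open>d\<close> lie in \<open>\<delta>\<close>, as \<open>elation_persp\<close>
  requires.\<close>

lemma opposite_plane:
  assumes \<delta>: "\<delta> \<in> planes \<Delta>" "d \<in> \<delta>" "e \<in> \<delta>" and r: "e \<sim> r" "\<not> d \<sim> r"
  shows "\<exists>\<rho>\<in>planes \<Delta>. e \<in> \<rho> \<and> r \<in> \<rho> \<and> d \<notin> \<rho> \<and> tr \<delta> r \<subseteq> \<rho> \<and> tr \<delta> r \<in> lines \<Delta> \<and> (\<forall>x\<in>\<rho>. d \<sim> x \<longrightarrow> x \<in> \<delta>)"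
proof -
  have rn: "r \<notin> \<delta>" using plane_coll[OF \<delta>(1,2)] r by blast
  have rP: "r \<in> P" using colP(2)[OF r(1)] .
  have l: "tr \<delta> r \<in> lines \<Delta>" using tr_line[OF \<delta>(1) rP rn] .
  have "\<And>x. x \<in> tr \<delta> r \<Longrightarrow> r \<sim> x" unfolding tr_def by blast
  then obtain \<rho> where \<rho>: "\<rho> \<in> planes \<Delta>" "tr \<delta> r \<subseteq> \<rho>" "r \<in> \<rho>"
    using plane_ex[OF l rP] by blast
  have "e \<in> tr \<delta> r" unfolding tr_def using \<delta> sym[OF r(1)] by blast
  moreover have d: "d \<notin> \<rho>" using plane_coll[OF \<rho>(1) _ \<rho>(3)] r by blast
  moreover have "x \<in> \<delta>" if x: "x \<in> \<rho>" "d \<sim> x" for x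
  proof -
    have L: "tr \<rho> d \<in> lines \<Delta>" using tr_line[OF \<rho>(1) plane_P[OF \<delta>(1,2)] d] .
    have "tr \<delta> r \<subseteq> tr \<rho> d" using \<rho>(2) plane_coll[OF \<delta>(1,2)] unfolding tr_def by blast
    then have "tr \<delta> r = tr \<rho> d" using plane_sub_line_eq[OF l L] by blast
    then show ?thesis using x unfolding tr_def by blast
  qed
  ultimately show ?thesis using \<rho> l by blast
qed

text \<open>A second common point \<open>a\<close> would make \<open>e\<close> collinear to the
  triangle \<open>d\<close>, \<open>a\<close>, \<open>u\<close> of \<open>\<pi>\<close>, so
  \<open>e\<close> would lie in \<open>\<pi>\<close> and be collinear to \<open>f\<close>.\<close>

lemma planes_meet_in_point:
  assumes \<pi>: "\<pi> \<in> planes \<Delta>" "d \<in> \<pi>" "u \<in> \<pi>" "f \<in> \<pi>" and \<delta>: "\<delta> \<in> planes \<Delta>" "d \<in> \<delta>" "e \<in> \<delta>" "u \<notin> \<delta>"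
    and e: "e \<sim> u" "\<not> f \<sim> e" and a: "a \<in> \<pi>" "a \<in> \<delta>"
  shows "a = d"
proof (rule ccontr)
  assume ad: "a \<noteq> d"
  have "u \<notin> jn d a" using plane_jn[OF \<delta>(1,2) a(2)] ad \<delta>(4) by blast
  then have "e \<in> \<pi>" using plane_max3[OF \<pi>(1,2) a(1) \<pi>(3) _ _ plane_coll[OF \<delta>(1,3,2)] plane_coll[OF \<delta>(1,3) a(2)] e(1)] ad by blast
  then show False using plane_coll[OF \<pi>(1,4)] e(2) by blast
qed

text \<open>A line through \<open>d\<close> in \<open>\<pi>\<close> is the trace of a point
  \<open>r0\<close> of \<open>\<rho>\<close> collinear to \<open>d\<close>, so \<open>r0\<close>
  lies in \<open>\<delta>\<close>. The line \<open>d r0\<close> meets \<open>k\<close> in a point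
  \<open>r1\<close> of \<open>\<rho>'\<close>, and \<open>r0\<close> and \<open>r1\<close> have
  equal traces on every plane through \<open>d\<close>. Hence the second perspectivity undoes the
  first on this line.\<close>

lemma elation_persp:
  assumes pl: "\<pi> \<in> planes \<Delta>" "\<rho> \<in> planes \<Delta>" "\<pi>' \<in> planes \<Delta>" "\<rho>' \<in> planes \<Delta>" "\<delta> \<in> planes \<Delta>"
    and dis: "\<pi> \<inter> \<rho> = {}" "\<pi>' \<inter> \<rho> = {}" "\<pi> \<inter> \<rho>' = {}" "\<pi>' \<inter> \<rho>' = {}"
    and F: "F \<subseteq> \<pi>" "F \<subseteq> \<pi>'" "d \<in> F"
    and \<rho>: "\<And>x. x \<in> \<rho> \<Longrightarrow> d \<sim> x \<Longrightarrow> x \<in> \<delta>" "d \<in> \<delta>" "d \<notin> \<rho>"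
    and \<rho>': "k \<in> lines \<Delta>" "k \<subseteq> \<delta>" "k \<subseteq> \<rho>'" "d \<notin> \<rho>'"
  shows "elation d F \<pi> (persp \<rho>' \<pi> \<circ> persp \<rho> \<pi>')"
  unfolding elation_def
proof (intro conjI ballI impI; (elim conjE)?)
  show "bij_betw (persp \<rho>' \<pi> \<circ> persp \<rho> \<pi>') \<pi> \<pi>"
    using bij_betw_trans[OF persp_bij[OF pl(1,2) dis(1) pl(3) dis(2)] persp_bij[OF pl(3,4) dis(4) pl(1) dis(3)]] .
next
  fix l assume l: "l \<in> lines \<Delta>" "l \<subseteq> \<pi>"
  show "(persp \<rho>' \<pi> \<circ> persp \<rho> \<pi>') ` l \<in> lines \<Delta>"
    using persp_line[OF pl(1,2) dis(1) pl(3) dis(2) l] persp_line[OF pl(3,4) dis(4) pl(1) dis(3)]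
    by (metis image_comp)
next
  fix x assume "x \<in> F"
  then have x: "x \<in> \<pi>" "x \<in> \<pi>'" using F by blast+
  have "persp \<rho> \<pi>' x = x" using persp_eq[OF pl(3,2) dis(2) x(2) refl] .
  moreover have "persp \<rho>' \<pi> x = x" using persp_eq[OF pl(1,4) dis(3) x(1) refl] .
  ultimately show "(persp \<rho>' \<pi> \<circ> persp \<rho> \<pi>') x = x" by simp
next
  fix l assume l: "l \<in> lines \<Delta>" "l \<subseteq> \<pi>" "d \<in> l"
  obtain r0 where r0: "r0 \<in> \<rho>" "l = tr \<pi> r0" using line_eq_tr[OF pl(1,2) dis(1) l(1,2)] by blast
  have "d \<sim> r0" using l(3) r0(2) sym[of r0 d] unfolding tr_def by blast
  then have r0\<delta>: "r0 \<in> \<delta>" using \<rho>(1) r0(1) by blast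
  have r0d: "d \<noteq> r0" using r0(1) \<rho>(3) by blast
  have D: "jn d r0 \<in> lines \<Delta>" "jn d r0 \<subseteq> \<delta>" using plane_jn[OF pl(5) \<rho>(2) r0\<delta> r0d] by blast+
  have D2: "d \<in> jn d r0" "r0 \<in> jn d r0" using jn[OF \<open>d \<sim> r0\<close> r0d] by blast+
  obtain r1 where r1: "r1 \<in> jn d r0" "r1 \<in> k" using plane_meet[OF pl(5) D(1) \<rho>'(1) D(2) \<rho>'(2)] by blast
  have r1d: "r1 \<noteq> d" and r1\<rho>: "r1 \<in> \<rho>'" using r1(2) \<rho>'(3,4) by blast+
  have t: "tr \<sigma> r0 = tr \<sigma> r1" if \<sigma>: "\<sigma> \<in> planes \<Delta>" "d \<in> \<sigma>" for \<sigma>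
  proof -
    have "r0 \<sim> y \<longleftrightarrow> r1 \<sim> y" if y: "y \<in> \<sigma>" for y
    proof -
      have yd: "y \<sim> d" using plane_coll[OF \<sigma>(1) y \<sigma>(2)] .
      show ?thesis
        using perp_line[OF D(1) D2 r0d yd _ r1(1)] perp_line[OF D(1) D2(1) r1(1) r1d[symmetric] yd _ D2(2)] sym by blast
    qed
    then show ?thesis unfolding tr_def by blast
  qed
  have d: "d \<in> \<pi>" "d \<in> \<pi>'" using F by blast+
  have "persp \<rho> \<pi>' ` l = tr \<pi>' r1" using persp_tr[OF pl(1,2) dis(1) pl(3) dis(2) r0(1)] t[OF pl(3) d(2)] r0(2) by simp
  then have "persp \<rho>' \<pi> ` persp \<rho> \<pi>' ` l = tr \<pi> r1" using persp_tr[OF pl(3,4) dis(4) pl(1) dis(3) r1\<rho>] by simp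
  also have "\<dots> = l" using t[OF pl(1) d(1)] r0(2) by simp
  finally show "(persp \<rho>' \<pi> \<circ> persp \<rho> \<pi>') ` l = l" by (simp add: image_comp)
qed

lemma tr_eq_jn:
  assumes "\<rho> \<in> planes \<Delta>" "x \<in> P" "x \<notin> \<rho>" "e \<in> \<rho>" "r \<in> \<rho>" "e \<noteq> r" "x \<sim> e" "x \<sim> r"
  shows "tr \<rho> x = jn e r"
  using jn_eq[OF tr_line[OF assms(1-3)] _ _ assms(6)] assms unfolding tr_def by blast

text \<open>The plane \<open>\<pi>3\<close> shares the axis with \<open>\<pi>1\<close>, the plane \<open>\<pi>4\<close> shares the axis with \<open>\<pi>2\<close>, and
  \<open>\<pi>3 \<inter> \<pi>4\<close> is a line. Both elations go through the same two opposite planes \<open>\<rho>\<close> and \<open>\<rho>'\<close>, so they agree on \<open>Q\<close>.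
  All lines through \<open>d\<close> are preserved since \<open>\<rho>\<close> and \<open>\<rho>'\<close> both meet the plane \<open>\<delta>\<close> through \<open>d\<close> in a line.\<close>

lemma elation_pair:
  assumes Q: "Q \<in> lines \<Delta>" "d \<in> Q" "q \<in> Q" "q \<noteq> d" "q' \<in> Q" "q' \<noteq> d"
    and p1: "\<pi>1 \<in> planes \<Delta>" "Q \<subseteq> \<pi>1" "F1 \<in> lines \<Delta>" "F1 \<subseteq> \<pi>1" "d \<in> F1" "F1 \<noteq> Q"
    and p2: "\<pi>2 \<in> planes \<Delta>" "Q \<subseteq> \<pi>2" "F2 \<in> lines \<Delta>" "F2 \<subseteq> \<pi>2" "d \<in> F2" "F2 \<noteq> Q"
    and ne: "\<pi>1 \<noteq> \<pi>2"
  shows "\<exists>e1 e2. elation d F1 \<pi>1 e1 \<and> elation d F2 \<pi>2 e2 \<and> e1 q = q' \<and> e2 q = q' \<and> (\<forall>x\<in>Q. e1 x = e2 x)"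
proof -
  have dqP: "d \<in> P" "q \<in> P" "q' \<in> P" using line_sub Q by blast+
  have dq: "d \<sim> q" "d \<sim> q'" "q \<sim> q'" using line_coll[OF Q(1)] Q by blast+
  have jQ: "jn d q = Q" using jn_eq[OF Q(1-3)] Q(4) by blast
  obtain f1 where f1: "f1 \<in> F1" "f1 \<noteq> d" using third[OF p1(3)] by blast
  obtain f2 where f2: "f2 \<in> F2" "f2 \<noteq> d" using third[OF p2(3)] by blast
  have f1Q: "f1 \<notin> Q" using line_unique[OF p1(3) Q(1) f1(1) p1(5) _ Q(2) f1(2)] p1(6) by blast
  have f2Q: "f2 \<notin> Q" using line_unique[OF p2(3) Q(1) f2(1) p2(5) _ Q(2) f2(2)] p2(6) by blast
  have I1: "d \<in> \<pi>1" "q \<in> \<pi>1" "f1 \<in> \<pi>1" "q' \<in> \<pi>1" using p1 Q f1 by blast+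
  have I2: "d \<in> \<pi>2" "q \<in> \<pi>2" "f2 \<in> \<pi>2" "q' \<in> \<pi>2" using p2 Q f2 by blast+
  have c1: "f1 \<sim> d" "f1 \<sim> q" "f1 \<sim> q'" using plane_coll[OF p1(1)] I1 by blast+
  have c2: "f2 \<sim> d" "f2 \<sim> q" "f2 \<sim> q'" using plane_coll[OF p2(1)] I2 by blast+
  have nf: "\<not> f1 \<sim> f2"
  proof
    assume "f1 \<sim> f2"
    then have "f2 \<in> \<pi>1" using plane_max3[OF p1(1) I1(1-3) Q(4)[symmetric] _ c2(1,2) sym] f1Q jQ by blast
    then show False using plane_eq[OF p1(1) p2(1) Q(1) p1(2) p2(2) _ I2(3) f2Q] ne by blast
  qed
  have D1: "d \<in> dp f1 f2" "q \<in> dp f1 f2" unfolding dp_def using c1 c2 by blast+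
  \<comment> \<open>The intermediate image of \<open>q\<close>. As it is collinear to
    \<open>f1\<close> and \<open>f2\<close>, the planes \<open>\<pi>3\<close> and
    \<open>\<pi>4\<close> share the line \<open>d q2\<close>.\<close>
  obtain q2 where q2: "q2 \<in> dp f1 f2" "d \<sim> q2" "d \<noteq> q2" "\<not> q \<sim> q2"
    using dp_third[OF nf D1(1) D1(2) sym[OF dq(1)] Q(4) D1(2) sym[OF dq(1)] Q(4)] by blast
  have q2f: "f1 \<sim> q2" "f2 \<sim> q2" using q2(1) unfolding dp_def by blast+
  have nq': "\<not> q' \<sim> q2"
    using perp_line[OF Q(1) Q(2,5) Q(6)[symmetric] sym[OF q2(2)] _ Q(3)] q2(4) sym by blast
  have D2: "d \<in> dp q q2" "f1 \<in> dp q q2" "f2 \<in> dp q q2"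
    unfolding dp_def using sym dq q2(2) c1 c2 q2f by blast+
  \<comment> \<open>This will be a common point of \<open>\<rho>\<close> and \<open>\<rho>'\<close>.
    Since it is collinear to neither \<open>f1\<close> nor \<open>f2\<close>, it lies outside all
    four planes, which \<open>planes_meet_in_point\<close> turns into disjointness.\<close>
  obtain e where e: "e \<in> dp q q2" "d \<sim> e" "d \<noteq> e" "\<not> f1 \<sim> e" "\<not> f2 \<sim> e"
    using dp_third[OF q2(4) D2(1) D2(2) c1(1) f1(2) D2(3) c2(1) f2(2)] by blast
  have eq: "e \<sim> q" "e \<sim> q2" using e(1) sym unfolding dp_def by blast+
  have eq': "e \<sim> q'" using perp_line[OF Q(1-3) Q(4)[symmetric] sym[OF e(2)] eq(1) Q(5)] .
  have D3: "d \<in> dp q' q2" "e \<in> dp q' q2" unfolding dp_def using sym dq q2(2) eq eq' by blast+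
  \<comment> \<open>The line \<open>e r\<close> will be the common trace of \<open>q\<close> and
    \<open>q2\<close> on \<open>\<rho>\<close>, and \<open>e r'\<close> that of \<open>q2\<close>
    and \<open>q'\<close> on \<open>\<rho>'\<close>; this sends \<open>q\<close> to
    \<open>q2\<close> and then to \<open>q'\<close>.\<close>
  obtain r where r: "r \<in> dp q q2" "e \<sim> r" "e \<noteq> r" "\<not> d \<sim> r"
    using dp_third[OF q2(4) e(1) D2(1) e(2,3) D2(1) e(2,3)] by blast
  obtain r' where r': "r' \<in> dp q' q2" "e \<sim> r'" "e \<noteq> r'" "\<not> d \<sim> r'"
    using dp_third[OF nq' D3(2) D3(1) e(2,3) D3(1) e(2,3)] by blast
  have E: "jn d e \<in> lines \<Delta>" "d \<in> jn d e" "e \<in> jn d e" using jn[OF e(2,3)] by blast+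
  have qE: "q \<notin> jn d e"
  proof
    assume "q \<in> jn d e"
    then have "jn d e = Q" using line_unique[OF E(1) Q(1) E(2) _ Q(2,3)] Q(4) by blast
    then have "f1 \<sim> e" using perp_line[OF Q(1-3) Q(4)[symmetric] c1(1,2)] E(3) by blast
    then show False using e by blast
  qed
  have q2E: "q2 \<notin> jn d e" using perp_jn[OF e(2,3) sym[OF dq(1)] sym[OF eq(1)]] q2(4) by blast
  obtain \<delta> where \<delta>: "\<delta> \<in> planes \<Delta>" "jn d e \<subseteq> \<delta>" "q \<notin> \<delta>" "q2 \<notin> \<delta>"
    using plane_avoid2[OF E(1) qE q2E] by blast
  have \<delta>i: "d \<in> \<delta>" "e \<in> \<delta>" using \<delta> E by blast+
  obtain \<rho> where \<rho>: "\<rho> \<in> planes \<Delta>" "e \<in> \<rho>" "r \<in> \<rho>" "d \<notin> \<rho>" "tr \<delta> r \<subseteq> \<rho>" "tr \<delta> r \<in> lines \<Delta>"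
    and \<rho>d: "\<And>x. x \<in> \<rho> \<Longrightarrow> d \<sim> x \<Longrightarrow> x \<in> \<delta>" using opposite_plane[OF \<delta>(1) \<delta>i r(2,4)] by blast
  obtain \<rho>' where \<rho>': "\<rho>' \<in> planes \<Delta>" "e \<in> \<rho>'" "r' \<in> \<rho>'" "d \<notin> \<rho>'" "tr \<delta> r' \<subseteq> \<rho>'" "tr \<delta> r' \<in> lines \<Delta>"
    and \<rho>'d: "\<And>x. x \<in> \<rho>' \<Longrightarrow> d \<sim> x \<Longrightarrow> x \<in> \<delta>" using opposite_plane[OF \<delta>(1) \<delta>i r'(2,4)] by blast
  obtain \<pi>3 where p3: "\<pi>3 \<in> planes \<Delta>" "d \<in> \<pi>3" "f1 \<in> \<pi>3" "q2 \<in> \<pi>3"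
    using plane_ex3[OF sym[OF c1(1)] q2f(1) sym[OF q2(2)]] f1(2) by blast
  obtain \<pi>4 where p4: "\<pi>4 \<in> planes \<Delta>" "d \<in> \<pi>4" "f2 \<in> \<pi>4" "q2 \<in> \<pi>4"
    using plane_ex3[OF sym[OF c2(1)] q2f(2) sym[OF q2(2)]] f2(2) by blast
  \<comment> \<open>A common point with \<open>\<rho>\<close> or \<open>\<rho>'\<close> would be
    collinear to \<open>d\<close>, hence lie in \<open>\<delta>\<close>, hence be \<open>d\<close>,
    which neither plane contains.\<close>
  have dis: "\<pi> \<inter> \<rho> = {}" "\<pi> \<inter> \<rho>' = {}"
    if "\<pi> \<in> planes \<Delta>" "d \<in> \<pi>" "u \<in> \<pi>" "f \<in> \<pi>" "u \<notin> \<delta>" "e \<sim> u" "\<not> f \<sim> e" for \<pi> u f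
    using planes_meet_in_point[OF that(1-4) \<delta>(1) \<delta>i that(5-7)] \<rho>d \<rho>'d \<rho>(4) \<rho>'(4) plane_coll[OF that(1,2)] by blast+
  note d1 = dis[OF p1(1) I1(1,2,3) \<delta>(3) eq(1) e(4)]
  note d2 = dis[OF p2(1) I2(1,2,3) \<delta>(3) eq(1) e(5)]
  note d3 = dis[OF p3(1,2,4,3) \<delta>(4) eq(2) e(4)]
  note d4 = dis[OF p4(1,2,4,3) \<delta>(4) eq(2) e(5)]
  have F13: "F1 \<subseteq> \<pi>3" using plane_line[OF p3(1-3) f1(2)[symmetric] p1(3,5) f1(1)] .
  have F24: "F2 \<subseteq> \<pi>4" using plane_line[OF p4(1-3) f2(2)[symmetric] p2(3,5) f2(1)] .
  have k': "tr \<delta> r' \<subseteq> \<delta>" by (rule tr_sub)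
  define e1 where "e1 = persp \<rho>' \<pi>1 \<circ> persp \<rho> \<pi>3"
  define e2 where "e2 = persp \<rho>' \<pi>2 \<circ> persp \<rho> \<pi>4"
  have el1: "elation d F1 \<pi>1 e1" unfolding e1_def
    using elation_persp[OF p1(1) \<rho>(1) p3(1) \<rho>'(1) \<delta>(1) d1(1) d3(1) d1(2) d3(2) p1(4) F13 p1(5) \<rho>d \<delta>i(1) \<rho>(4) \<rho>'(6) k' \<rho>'(5,4)] .
  have el2: "elation d F2 \<pi>2 e2" unfolding e2_def
    using elation_persp[OF p2(1) \<rho>(1) p4(1) \<rho>'(1) \<delta>(1) d2(1) d4(1) d2(2) d4(2) p2(4) F24 p2(5) \<rho>d \<delta>i(1) \<rho>(4) \<rho>'(6) k' \<rho>'(5,4)] .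
  have rq: "q \<sim> r" "q2 \<sim> r" using r(1) unfolding dp_def by blast+
  have rq': "q' \<sim> r'" "q2 \<sim> r'" using r'(1) unfolding dp_def by blast+
  have n\<rho>: "q \<notin> \<rho>" "q2 \<notin> \<rho>" "q' \<notin> \<rho>'" "q2 \<notin> \<rho>'" using d1 d3 I1 p3 by blast+
  have q2P: "q2 \<in> P" using colP(2)[OF q2(2)] .
  have "tr \<rho> q2 = tr \<rho> q"
    using tr_eq_jn[OF \<rho>(1) dqP(2) n\<rho>(1) \<rho>(2,3) r(3) sym[OF eq(1)] rq(1)]
      tr_eq_jn[OF \<rho>(1) q2P n\<rho>(2) \<rho>(2,3) r(3) sym[OF eq(2)] rq(2)] by simp
  then have x1: "persp \<rho> \<pi>3 q = q2" "persp \<rho> \<pi>4 q = q2"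
    using persp_eq[OF p3(1) \<rho>(1) d3(1) p3(4)] persp_eq[OF p4(1) \<rho>(1) d4(1) p4(4)] by blast+
  have "tr \<rho>' q' = tr \<rho>' q2"
    using tr_eq_jn[OF \<rho>'(1) dqP(3) n\<rho>(3) \<rho>'(2,3) r'(3) sym[OF eq'] rq'(1)]
      tr_eq_jn[OF \<rho>'(1) q2P n\<rho>(4) \<rho>'(2,3) r'(3) sym[OF eq(2)] rq'(2)] by simp
  then have x2: "persp \<rho>' \<pi>1 q2 = q'" "persp \<rho>' \<pi>2 q2 = q'"
    using persp_eq[OF p1(1) \<rho>'(1) d1(2) I1(4)] persp_eq[OF p2(1) \<rho>'(1) d2(2) I2(4)] by blast+
  \<comment> \<open>\<open>Q\<close> and \<open>Q2\<close> are traces of \<open>e\<close>, a point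
    of both \<open>\<rho>\<close> and \<open>\<rho>'\<close>, so \<open>Q\<close> goes to
    \<open>Q2\<close> and back. As \<open>Q2\<close> lies in \<open>\<pi>3\<close> and in
    \<open>\<pi>4\<close>, the two elations have the same intermediate point.\<close>
  have "e1 x = e2 x" if x: "x \<in> Q" for x
  proof -
    define Q2 where "Q2 = jn d q2"
    have Q2: "Q2 \<in> lines \<Delta>" "d \<in> Q2" "q2 \<in> Q2" unfolding Q2_def using jn[OF q2(2,3)] by blast+
    have Q2p: "Q2 \<subseteq> \<pi>3" "Q2 \<subseteq> \<pi>4" unfolding Q2_def using plane_jn p3 p4 q2(3) by blast+
    have e\<pi>: "e \<notin> \<pi>1" "e \<notin> \<pi>3" using d1 d3 \<rho>(2) by blast+
    have eP: "e \<in> P" using colP(1)[OF eq(1)] .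
    have t1: "tr \<pi>1 e = Q" using tr_eq_jn[OF p1(1) eP e\<pi>(1) I1(1,2) Q(4)[symmetric] sym[OF e(2)] eq(1)] jQ by simp
    have t3: "tr \<pi>3 e = Q2" unfolding Q2_def using tr_eq_jn[OF p3(1) eP e\<pi>(2) p3(2,4) q2(3) sym[OF e(2)] eq(2)] .
    define y where "y = persp \<rho> \<pi>3 x"
    have x\<pi>: "x \<in> \<pi>1" "x \<in> \<pi>2" using x p1 p2 by blast+
    have y: "y \<in> Q2" "tr \<rho> y = tr \<rho> x" unfolding y_def
      using persp_tr[OF p1(1) \<rho>(1) d1(1) p3(1) d3(1) \<rho>(2)] t1 t3 x
        persp_in(2)[OF p1(1) \<rho>(1) d1(1) p3(1) d3(1) x\<pi>(1)] by blast+
    have y4: "persp \<rho> \<pi>4 x = y" using persp_eq[OF p4(1) \<rho>(1) d4(1) _ y(2)] y(1) Q2p by blast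
    define z where "z = persp \<rho>' \<pi>1 y"
    have y3: "y \<in> \<pi>3" using y Q2p by blast
    have z: "z \<in> Q" "tr \<rho>' z = tr \<rho>' y" unfolding z_def
      using persp_tr[OF p3(1) \<rho>'(1) d3(2) p1(1) d1(2) \<rho>'(2)] t1 t3 y(1)
        persp_in(2)[OF p3(1) \<rho>'(1) d3(2) p1(1) d1(2) y3] by blast+
    have "persp \<rho>' \<pi>2 y = z" using persp_eq[OF p2(1) \<rho>'(1) d2(2) _ z(2)] z(1) p2(2) by blast
    then show ?thesis unfolding e1_def e2_def using y_def y4 z_def by simp
  qed
  then show ?thesis using el1 el2 x1 x2 e1_def e2_def by (metis comp_apply)
qed

lemma line_through:
  assumes "\<pi> \<in> planes \<Delta>" "Q \<in> lines \<Delta>" "d \<in> Q" "Q \<subseteq> \<pi>"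
  shows "\<exists>F\<in>lines \<Delta>. F \<subseteq> \<pi> \<and> d \<in> F \<and> F \<noteq> Q"
proof -
  obtain x where x: "x \<in> \<pi>" "x \<notin> Q" using plane_off assms by blast
  have d: "d \<in> \<pi>" "d \<noteq> x" using assms x by blast+
  have "jn d x \<in> lines \<Delta> \<and> jn d x \<subseteq> \<pi>" using plane_jn[OF assms(1) d(1) x(1) d(2)] .
  moreover have "d \<in> jn d x" "x \<in> jn d x" using jn[OF plane_coll[OF assms(1) d(1) x(1)] d(2)] by blast+
  ultimately show ?thesis using x(2) by blast
qed

text \<open>\<open>elation_pair\<close> only provides some pair of agreeing elations, and for
  distinct planes. Comparing both planes with a third one on \<open>Q\<close> and using uniqueness
  inside each plane covers all elations, including the case \<open>\<pi>1 = \<pi>2\<close>.\<close>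

lemma elation_agree:
  assumes Q: "Q \<in> lines \<Delta>" "d \<in> Q" "q \<in> Q" "q \<noteq> d" "q' \<in> Q" "q' \<noteq> d"
    and p1: "\<pi>1 \<in> planes \<Delta>" "Q \<subseteq> \<pi>1" "F1 \<in> lines \<Delta>" "F1 \<subseteq> \<pi>1" "d \<in> F1" "F1 \<noteq> Q"
    and p2: "\<pi>2 \<in> planes \<Delta>" "Q \<subseteq> \<pi>2" "F2 \<in> lines \<Delta>" "F2 \<subseteq> \<pi>2" "d \<in> F2" "F2 \<noteq> Q"
    and e: "elation d F1 \<pi>1 e1" "elation d F2 \<pi>2 e2" "e1 q = q'" "e2 q = q'" and x: "x \<in> Q"
  shows "e1 x = e2 x"
proof -
  obtain \<pi>3 where p3: "\<pi>3 \<in> planes \<Delta>" "Q \<subseteq> \<pi>3" and n: "\<pi>3 \<noteq> \<pi>1" "\<pi>3 \<noteq> \<pi>2"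
    using plane_thick[OF Q(1), of \<pi>1 \<pi>2] by blast
  obtain F3 where F3: "F3 \<in> lines \<Delta>" "F3 \<subseteq> \<pi>3" "d \<in> F3" "F3 \<noteq> Q"
    using line_through[OF p3(1) Q(1,2) p3(2)] by blast
  note p3 = p3 F3
  have off: "q \<notin> F" if "F \<in> lines \<Delta>" "d \<in> F" "F \<noteq> Q" for F
    using line_unique[OF that(1) Q(1) _ that(2) Q(3,2,4)] that(3) by blast
  obtain E1 E3 where E: "elation d F1 \<pi>1 E1" "elation d F3 \<pi>3 E3" "E1 q = q'" "E3 q = q'" "\<forall>x\<in>Q. E1 x = E3 x"
    using elation_pair[OF Q p1 p3] n by blast
  obtain E2 E3' where E': "elation d F2 \<pi>2 E2" "elation d F3 \<pi>3 E3'" "E2 q = q'" "E3' q = q'" "\<forall>x\<in>Q. E2 x = E3' x"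
    using elation_pair[OF Q p2 p3] n by blast
  have q: "q \<in> \<pi>1" "q \<in> \<pi>2" "q \<in> \<pi>3" and xp: "x \<in> \<pi>1" "x \<in> \<pi>2" "x \<in> \<pi>3" using p1 p2 p3 Q x by blast+
  have "e1 x = E1 x" using elation_unique[OF p1(1,3,4,5) e(1) E(1) q(1) off[OF p1(3,5,6)] _ xp(1)] e E by simp
  moreover have "e2 x = E2 x" using elation_unique[OF p2(1,3,4,5) e(2) E'(1) q(2) off[OF p2(3,5,6)] _ xp(2)] e E' by simp
  moreover have "E3 x = E3' x" using elation_unique[OF p3(1,3,4,5) E(2) E'(2) q(3) off[OF p3(3,5,6)] _ xp(3)] E E' by simp
  ultimately show ?thesis using E(5) E'(5) x by simp
qed

text \<open>One half of \<open>elation_pair\<close>, with an arbitrary second plane on the line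
  \<open>d q\<close>.\<close>

lemma elation_ex:
  assumes \<pi>: "\<pi> \<in> planes \<Delta>" and F: "F \<in> lines \<Delta>" "F \<subseteq> \<pi>" "d \<in> F"
    and q: "q \<in> \<pi>" "q \<notin> F" and q': "q' \<in> jn d q" "q' \<noteq> d"
  shows "\<exists>e. elation d F \<pi> e \<and> e q = q'"
proof -
  have dq: "d \<noteq> q" "d \<in> \<pi>" using q F by blast+
  then have Q: "jn d q \<in> lines \<Delta>" "d \<in> jn d q" "q \<in> jn d q" "jn d q \<subseteq> \<pi>"
    using jn[OF plane_coll[OF \<pi> dq(2) q(1)] dq(1)] plane_jn[OF \<pi> dq(2) q(1) dq(1)] by blast+
  obtain \<pi>2 where p2: "\<pi>2 \<in> planes \<Delta>" "jn d q \<subseteq> \<pi>2" "\<pi>2 \<noteq> \<pi>" using plane_thick[OF Q(1)] by blast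
  obtain F2 where F2: "F2 \<in> lines \<Delta>" "F2 \<subseteq> \<pi>2" "d \<in> F2" "F2 \<noteq> jn d q"
    using line_through[OF p2(1) Q(1,2) p2(2)] by blast
  have "F \<noteq> jn d q" using Q(3) q by blast
  then show ?thesis using elation_pair[OF Q(1-3) dq(1)[symmetric] q' \<pi> Q(4) F _ p2(1,2) F2 p2(3)[symmetric]] by blast
qed

section \<open>Collineations of a cone\<close>

text \<open>The restriction to \<open>Q\<close> of any elation with center \<open>d\<close> mapping \<open>q\<close> to \<open>q'\<close>; by \<open>elation_agree\<close> the choice
  of the plane and of the axis (other than \<open>Q\<close>) does not matter.\<close>

definition translation where "translation d Q q q' x = (SOME y. \<exists>\<pi> F e. \<pi> \<in> planes \<Delta> \<and> Q \<subseteq> \<pi> \<and> F \<in> lines \<Delta> \<and> F \<subseteq> \<pi> \<and> d \<in> F \<and>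
  F \<noteq> Q \<and> elation d F \<pi> e \<and> e q = q' \<and> y = e x)"

lemma translation_eq:
  assumes Q: "Q \<in> lines \<Delta>" "d \<in> Q" "q \<in> Q" "q \<noteq> d" "q' \<in> Q" "q' \<noteq> d"
    and p: "\<pi> \<in> planes \<Delta>" "Q \<subseteq> \<pi>" "F \<in> lines \<Delta>" "F \<subseteq> \<pi>" "d \<in> F" "F \<noteq> Q"
    and e: "elation d F \<pi> e" "e q = q'" and x: "x \<in> Q"
  shows "translation d Q q q' x = e x"
  unfolding translation_def
proof (rule some_equality)
  show "\<exists>\<pi> F e'. \<pi> \<in> planes \<Delta> \<and> Q \<subseteq> \<pi> \<and> F \<in> lines \<Delta> \<and> F \<subseteq> \<pi> \<and> d \<in> F \<and>
    F \<noteq> Q \<and> elation d F \<pi> e' \<and> e' q = q' \<and> e x = e' x" using p e by blast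
next
  fix y assume "\<exists>\<pi> F e. \<pi> \<in> planes \<Delta> \<and> Q \<subseteq> \<pi> \<and> F \<in> lines \<Delta> \<and> F \<subseteq> \<pi> \<and> d \<in> F \<and>
    F \<noteq> Q \<and> elation d F \<pi> e \<and> e q = q' \<and> y = e x"
  then obtain \<pi>' F' e' where h: "\<pi>' \<in> planes \<Delta>" "Q \<subseteq> \<pi>'" "F' \<in> lines \<Delta>" "F' \<subseteq> \<pi>'" "d \<in> F'"
    "F' \<noteq> Q" "elation d F' \<pi>' e'" "e' q = q'" "y = e' x" by blast
  show "y = e x" unfolding h(9) using elation_agree[OF Q h(1-6) p h(7) e(1) h(8) e(2) x] .
qed

lemma translation_id:
  assumes Q: "Q \<in> lines \<Delta>" "d \<in> Q" "q \<in> Q" "q \<noteq> d" and x: "x \<in> Q"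
  shows "translation d Q q q x = x"
proof -
  obtain \<pi> where \<pi>: "\<pi> \<in> planes \<Delta>" "Q \<subseteq> \<pi>" using plane_thick[OF Q(1)] by blast
  obtain F where F: "F \<in> lines \<Delta>" "F \<subseteq> \<pi>" "d \<in> F" "F \<noteq> Q" using line_through[OF \<pi>(1) Q(1,2) \<pi>(2)] by blast
  show ?thesis using translation_eq[OF Q Q(3,4) \<pi> F elation_id _ x] by simp
qed

text \<open>The vertex needs its own clause because it does not determine a line of the
  cone.\<close>

definition cone_map where
  "cone_map c q q' x = (if x = c then c else translation c (jn c x) (pr q (jn c x)) (pr q' (jn c x)) x)"

text \<open>The traces of \<open>q\<close> and \<open>q'\<close> on \<open>\<pi>\<close> meet in a
  point \<open>f0\<close> that has to stay fixed, which suggests the line \<open>c f0\<close> as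
  axis. The elation with this axis that moves one further point of the first trace correctly maps
  the whole trace to the second one, so it moves all feet correctly and is the cone map by
  \<open>translation_eq\<close>.\<close>

lemma cone_map_plane:
  assumes q: "q \<in> P" "\<not> q \<sim> c" and q': "q' \<in> P" "\<not> q' \<sim> c" and \<pi>: "\<pi> \<in> planes \<Delta>" "c \<in> \<pi>"
  shows "\<exists>F e. F \<in> lines \<Delta> \<and> F \<subseteq> \<pi> \<and> c \<in> F \<and> elation c F \<pi> e \<and> (\<forall>x\<in>\<pi>. cone_map c q q' x = e x) \<and>
    (\<forall>x\<in>\<pi>. q \<sim> x \<longleftrightarrow> q' \<sim> e x)"
proof -
  have n: "q \<notin> \<pi>" "q' \<notin> \<pi>" using plane_coll[OF \<pi>(1) _ \<pi>(2)] q q' by blast+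
  define l l' where "l = tr \<pi> q" and "l' = tr \<pi> q'"
  have l: "l \<in> lines \<Delta>" "l' \<in> lines \<Delta>" "l \<subseteq> \<pi>" "l' \<subseteq> \<pi>" unfolding l_def l'_def
    using tr_line[OF \<pi>(1)] q q' n tr_sub by blast+
  have il: "x \<in> l \<longleftrightarrow> x \<in> \<pi> \<and> q \<sim> x" "x \<in> l' \<longleftrightarrow> x \<in> \<pi> \<and> q' \<sim> x" for x unfolding l_def l'_def tr_def by blast+
  have cl: "c \<notin> l" "c \<notin> l'" using il q q' by blast+
  obtain f0 where f0: "f0 \<in> l" "f0 \<in> l'" using plane_meet[OF \<pi>(1) l] by blast
  have cf: "c \<noteq> f0" "f0 \<in> \<pi>" using cl f0 l by blast+
  define F where "F = jn c f0"
  have F: "F \<in> lines \<Delta>" "F \<subseteq> \<pi>" "c \<in> F" "f0 \<in> F" unfolding F_def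
    using jn[OF plane_coll[OF \<pi> cf(2)] cf(1)] plane_jn[OF \<pi> cf(2,1)] by blast+
  obtain k where k: "k \<in> l" "k \<noteq> f0" using third[OF l(1)] by blast
  have ck: "c \<noteq> k" "k \<in> \<pi>" using cl k l by blast+
  have kF: "k \<notin> F" using line_unique[OF F(1) l(1) F(4) _ f0(1) k(1)] k(2) cl(1) F(3) by blast
  define K where "K = jn c k"
  have K: "K \<in> lines \<Delta>" "K \<subseteq> \<pi>" "c \<in> K" "k \<in> K" unfolding K_def
    using jn[OF plane_coll[OF \<pi> ck(2)] ck(1)] plane_jn[OF \<pi> ck(2,1)] by blast+
  have KF: "K \<noteq> F" using K kF by blast
  define k' where "k' = pr q' K"
  have k': "k' \<in> K" "q' \<sim> k'" unfolding k'_def using pr[OF K(1,3) q'(2,1)] by blast+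
  have k'l: "k' \<in> l'" "k' \<noteq> c" using il k' K(2) q' by blast+
  obtain e where e: "elation c F \<pi> e" "e k = k'"
    using elation_ex[OF \<pi>(1) F(1,2,3) ck(2) kF] k'(1) k'l(2) unfolding K_def by blast
  have fk': "f0 \<noteq> k'" using line_meet_eq[OF K(1) F(1) KF _ F(4) K(3) F(3)] cf(1) k'(1) by blast
  have ef0: "e f0 = f0" using elation_axis[OF e(1) F(4)] .
  have "f0 \<in> e ` l" "k' \<in> e ` l" using ef0 e(2) f0(1) k(1) by (metis image_eqI)+
  then have ell: "e ` l = l'" using line_unique[OF elation_line[OF e(1) l(1,3)] l(2) _ _ f0(2) k'l(1) fk'] by blast
  have inj: "inj_on e \<pi>" and sur: "e ` \<pi> = \<pi>" using elation_bij[OF e(1)] unfolding bij_betw_def by blast+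
  have iff: "q \<sim> x \<longleftrightarrow> q' \<sim> e x" if x: "x \<in> \<pi>" for x
  proof -
    have "x \<in> l \<longleftrightarrow> e x \<in> l'" using inj_on_image_mem_iff[OF inj x l(3)] ell by simp
    then show ?thesis using il x sur by blast
  qed
  have "cone_map c q q' x = e x" if x: "x \<in> \<pi>" for x
  proof (cases "x = c")
    case True
    then show ?thesis using elation_axis[OF e(1) F(3)] unfolding cone_map_def by simp
  next
    case False
    define X where "X = jn c x"
    have X: "X \<in> lines \<Delta>" "X \<subseteq> \<pi>" "c \<in> X" "x \<in> X" unfolding X_def
      using jn[OF plane_coll[OF \<pi> x]] plane_jn[OF \<pi> x] False by blast+
    have a: "pr q X \<in> X" "q \<sim> pr q X" using pr[OF X(1,3) q(2,1)] by blast+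
    have a': "pr q' X \<in> X" "q' \<sim> pr q' X" using pr[OF X(1,3) q'(2,1)] by blast+
    have ac: "pr q X \<noteq> c" "pr q' X \<noteq> c" using a a' q q' by metis+
    have "e (pr q X) \<in> X" using elation_center[OF e(1) X(1-3)] a(1) by blast
    moreover have "q' \<sim> e (pr q X)" using iff[of "pr q X"] a X by blast
    ultimately have ea: "e (pr q X) = pr q' X" using pr_eq[OF X(1,3) q'(2)] by metis
    have cm: "cone_map c q q' x = translation c X (pr q X) (pr q' X) x" unfolding cone_map_def X_def using False by simp
    show ?thesis
    proof (cases "X = F")
      case True
      \<comment> \<open>On the axis the feet of \<open>q\<close> and \<open>q'\<close> coincide, so
        the cone map is the identity there, like \<open>e\<close>.\<close>
      have ex: "e y = y" if "y \<in> X" for y using elation_axis[OF e(1)] that True by blast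
      then have "pr q' X = pr q X" using ea a(1) by simp
      then show ?thesis using translation_id[OF X(1,3) a(1) ac(1) X(4)] ex[OF X(4)] cm by simp
    next
      case False
      then show ?thesis using translation_eq[OF X(1,3) a(1) ac(1) a'(1) ac(2) \<pi>(1) X(2) F(1,2,3) _ e(1) ea X(4)] cm by simp
    qed
  qed
  then show ?thesis using F e(1) iff by blast
qed

section \<open>Permutations of the cone that stabilize every line through the vertex\<close>

definition cone_aut where "cone_aut c g \<longleftrightarrow> c \<in> P \<and> g c = c \<and> bij_betw g (perp \<Delta> c) (perp \<Delta> c) \<and>
  (\<forall>K\<in>lines \<Delta>. c \<in> K \<longrightarrow> g ` K = K) \<and> (\<forall>l\<in>lines \<Delta>. l \<subseteq> perp \<Delta> c \<longrightarrow> g ` l \<in> lines \<Delta>)"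

lemma cone_plane_ex: "c \<sim> x \<Longrightarrow> \<exists>\<pi>\<in>planes \<Delta>. c \<in> \<pi> \<and> x \<in> \<pi>"
  using clique_maximal[of "{c, x}"] colP sym coll_refl by (metis insertE insert_subset singletonD)

lemma cone_map_aut:
  assumes q: "q \<in> P" "\<not> q \<sim> c" and q': "q' \<in> P" "\<not> q' \<sim> c" and c: "c \<in> P"
  shows "cone_aut c (cone_map c q q')"
proof -
  let ?g = "cone_map c q q'"
  have gc: "?g c = c" unfolding cone_map_def by simp
  have ex: "\<exists>F e. elation c F \<pi> e \<and> (\<forall>x\<in>\<pi>. ?g x = e x)" if "\<pi> \<in> planes \<Delta>" "c \<in> \<pi>" for \<pi>
    using cone_map_plane[OF q q' that] by blast
  have K: "?g ` K = K" if K: "K \<in> lines \<Delta>" "c \<in> K" for K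
  proof -
    obtain \<pi> where \<pi>: "\<pi> \<in> planes \<Delta>" "K \<subseteq> \<pi>" using plane_thick[OF K(1)] by blast
    obtain F e where e: "elation c F \<pi> e" "\<forall>x\<in>\<pi>. ?g x = e x" using ex[OF \<pi>(1)] \<pi>(2) K by blast
    have "?g ` K = e ` K" using e(2) \<pi>(2) by (intro image_cong) auto
    then show ?thesis using elation_center[OF e(1) K(1) \<pi>(2) K(2)] by simp
  qed
  have L: "?g ` l \<in> lines \<Delta>" if l: "l \<in> lines \<Delta>" "l \<subseteq> perp \<Delta> c" for l
  proof (cases "c \<in> l")
    case True then show ?thesis using K l by simp
  next
    case False
    have "\<And>x. x \<in> l \<Longrightarrow> c \<sim> x" using l(2) unfolding perp_def by blast
    then obtain \<pi> where \<pi>: "\<pi> \<in> planes \<Delta>" "l \<subseteq> \<pi>" "c \<in> \<pi>" using plane_ex[OF l(1) c] by blast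
    obtain F e where e: "elation c F \<pi> e" "\<forall>x\<in>\<pi>. ?g x = e x" using ex[OF \<pi>(1,3)] by blast
    have "?g ` l = e ` l" using e(2) \<pi>(2) by (intro image_cong) auto
    then show ?thesis using elation_line[OF e(1) l(1) \<pi>(2)] by simp
  qed
  have pl: "\<exists>\<pi> F e. \<pi> \<in> planes \<Delta> \<and> c \<in> \<pi> \<and> x \<in> \<pi> \<and> elation c F \<pi> e \<and> (\<forall>x\<in>\<pi>. ?g x = e x)" if "c \<sim> x" for x
    using cone_plane_ex[OF that] ex by blast
  have inj: "x = y" if xy: "c \<sim> x" "c \<sim> y" "?g x = ?g y" for x y
  proof -
    \<comment> \<open>Points with the same image might lie in different planes. Since an image stays
      on the line through \<open>c\<close>, they lie on one line and so in a common plane, where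
      elations are injective.\<close>
    have *: "y' = c \<or> (?g y' \<noteq> c \<and> ?g y' \<in> jn c y')" if y': "c \<sim> y'" for y'
    proof -
      obtain \<pi> F e where e: "\<pi> \<in> planes \<Delta>" "c \<in> \<pi>" "y' \<in> \<pi>" "elation c F \<pi> e" "\<forall>x\<in>\<pi>. ?g x = e x" using pl[OF y'] by blast
      have "y' = c" if "?g y' = c"
        using that gc e elation_bij[OF e(4)] unfolding bij_betw_def inj_on_def by metis
      moreover have "?g y' \<in> jn c y'" if "y' \<noteq> c" using K[OF jn(1,2)[OF y' that[symmetric]]] jn(3)[OF y' that[symmetric]] by blast
      ultimately show ?thesis by blast
    qed
    show ?thesis
    proof (cases "x = c")
      case True
      then show ?thesis using *[OF xy(2)] xy(3) gc by metis
    next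
      case False
      then have gx: "?g x \<noteq> c" "?g x \<in> jn c x" using *[OF xy(1)] by blast+
      then have yc: "y \<noteq> c" using xy(3) gc by metis
      then have gy: "?g x \<in> jn c y" using *[OF xy(2)] xy(3) by metis
      have jx: "jn c x \<in> lines \<Delta>" "c \<in> jn c x" "x \<in> jn c x" using jn[OF xy(1)] False by blast+
      have jy: "jn c y \<in> lines \<Delta>" "c \<in> jn c y" "y \<in> jn c y" using jn[OF xy(2)] yc by blast+
      have "jn c x = jn c y" using line_unique[OF jx(1) jy(1) gx(2) jx(2) gy jy(2) gx(1)] .
      then have yx: "y \<in> jn c x" using jy by simp
      obtain \<pi> F e where e: "\<pi> \<in> planes \<Delta>" "c \<in> \<pi>" "x \<in> \<pi>" "elation c F \<pi> e" "\<forall>x\<in>\<pi>. ?g x = e x" using pl[OF xy(1)] by blast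
      have "y \<in> \<pi>" using plane_jn[OF e(1-3)] False yx by blast
      then show ?thesis using e xy(3) elation_bij[OF e(4)] unfolding bij_betw_def inj_on_def by metis
    qed
  qed
  have "?g ` perp \<Delta> c = perp \<Delta> c"
  proof (intro subset_antisym subsetI)
    fix y assume "y \<in> ?g ` perp \<Delta> c"
    then obtain x where x: "c \<sim> x" "y = ?g x" unfolding perp_def by blast
    obtain \<pi> F e where e: "\<pi> \<in> planes \<Delta>" "c \<in> \<pi>" "x \<in> \<pi>" "elation c F \<pi> e" "\<forall>x\<in>\<pi>. ?g x = e x" using pl[OF x(1)] by blast
    have "y \<in> \<pi>" using x(2) e(3,5) bij_betwE[OF elation_bij[OF e(4)]] by simp
    then show "y \<in> perp \<Delta> c" using plane_coll[OF e(1,2)] unfolding perp_def by blast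
  next
    fix y assume "y \<in> perp \<Delta> c"
    then have "c \<sim> y" unfolding perp_def by simp
    then obtain \<pi> F e where e: "\<pi> \<in> planes \<Delta>" "c \<in> \<pi>" "y \<in> \<pi>" "elation c F \<pi> e" "\<forall>x\<in>\<pi>. ?g x = e x" using pl by blast
    obtain x where "x \<in> \<pi>" "y = e x" using elation_bij[OF e(4)] e(3) unfolding bij_betw_def by blast
    then have "y = ?g x" "c \<sim> x" using e(5) plane_coll[OF e(1,2)] by auto
    then show "y \<in> ?g ` perp \<Delta> c" unfolding perp_def by blast
  qed
  then have "bij_betw ?g (perp \<Delta> c) (perp \<Delta> c)" using inj unfolding bij_betw_def inj_on_def perp_def by blast
  then show ?thesis unfolding cone_aut_def using c gc K L by blast
qed

lemma cone_map_perp: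
  assumes q: "q \<in> P" "\<not> q \<sim> c" and q': "q' \<in> P" "\<not> q' \<sim> c" and x: "c \<sim> x"
  shows "x \<sim> q \<longleftrightarrow> cone_map c q q' x \<sim> q'"
proof -
  obtain \<pi> where \<pi>: "\<pi> \<in> planes \<Delta>" "c \<in> \<pi>" "x \<in> \<pi>" using cone_plane_ex x by blast
  show ?thesis using cone_map_plane[OF q q' \<pi>(1,2)] \<pi>(3) sym by metis
qed

lemma cone_map_fix:
  assumes q: "q \<in> P" "\<not> q \<sim> c" and x: "c \<sim> x" "c \<noteq> x" "pr q (jn c x) = pr q' (jn c x)"
  shows "cone_map c q q' x = x"
proof -
  note j = jn[OF x(1,2)]
  have "pr q (jn c x) \<in> jn c x" "q \<sim> pr q (jn c x)" using pr[OF j(1,2) q(2,1)] by blast+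
  then show ?thesis unfolding cone_map_def using translation_id[OF j(1,2) _ _ j(3)] x q by metis
qed

text \<open>In a plane on \<open>K\<close> the cone map is an elation. Either \<open>x\<close> is on
  its axis, which is then \<open>K\<close>, or a point off the axis is fixed and the elation is the
  identity.\<close>

lemma cone_map_fix_line:
  assumes q: "q \<in> P" "\<not> q \<sim> c" and q': "q' \<in> P" "\<not> q' \<sim> c"
    and K: "K \<in> lines \<Delta>" "c \<in> K" "x \<in> K" "x \<noteq> c" "cone_map c q q' x = x" "y \<in> K"
  shows "cone_map c q q' y = y"
proof -
  obtain \<pi> where \<pi>: "\<pi> \<in> planes \<Delta>" "K \<subseteq> \<pi>" using plane_thick[OF K(1)] by blast
  have i: "c \<in> \<pi>" "x \<in> \<pi>" "y \<in> \<pi>" using \<pi> K by blast+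
  obtain F e where e: "F \<in> lines \<Delta>" "F \<subseteq> \<pi>" "c \<in> F" "elation c F \<pi> e" "\<forall>x\<in>\<pi>. cone_map c q q' x = e x"
    using cone_map_plane[OF q q' \<pi>(1) i(1)] by blast
  show ?thesis
  proof (cases "x \<in> F")
    case True
    then have "K = F" using line_unique[OF K(1) e(1) K(3,2) _ e(3) K(4)] by blast
    then show ?thesis using elation_axis[OF e(4)] e(5) i K by simp
  next
    case False
    then show ?thesis using elation_unique[OF \<pi>(1) e(1-4) elation_id i(2) False _ i(3)] e(5) i K(5) by simp
  qed
qed

lemma cone_aut_fix: "cone_aut c g \<Longrightarrow> g c = c"
  and cone_aut_P: "cone_aut c g \<Longrightarrow> c \<in> P"
  and cone_aut_bij: "cone_aut c g \<Longrightarrow> bij_betw g (perp \<Delta> c) (perp \<Delta> c)"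
  and cone_aut_K: "cone_aut c g \<Longrightarrow> K \<in> lines \<Delta> \<Longrightarrow> c \<in> K \<Longrightarrow> g ` K = K"
  unfolding cone_aut_def by blast+

lemma cone_aut_line: "cone_aut c g \<Longrightarrow> l \<in> lines \<Delta> \<Longrightarrow> (\<And>x. x \<in> l \<Longrightarrow> c \<sim> x) \<Longrightarrow> g ` l \<in> lines \<Delta>"
  unfolding cone_aut_def perp_def by blast

lemma cone_aut_in: "cone_aut c g \<Longrightarrow> c \<sim> x \<Longrightarrow> c \<sim> g x"
  using bij_betwE[OF cone_aut_bij] unfolding perp_def by blast

lemma cone_aut_inj: "cone_aut c g \<Longrightarrow> c \<sim> x \<Longrightarrow> c \<sim> y \<Longrightarrow> g x = g y \<Longrightarrow> x = y"
  using cone_aut_bij[of c g] unfolding bij_betw_def inj_on_def perp_def by blast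

lemma cone_aut_surj: "cone_aut c g \<Longrightarrow> c \<sim> y \<Longrightarrow> \<exists>x. c \<sim> x \<and> y = g x"
  using cone_aut_bij[of c g] unfolding bij_betw_def perp_def by blast

lemma cone_aut_jn: "cone_aut c g \<Longrightarrow> c \<sim> x \<Longrightarrow> x \<noteq> c \<Longrightarrow> g x \<in> jn c x \<and> g x \<noteq> c"
  using cone_aut_K[of c g "jn c x"] jn[of c x] cone_aut_inj[of c g x c] cone_aut_fix[of c g] coll_refl cone_aut_P
  by (metis image_eqI)

text \<open>If \<open>a\<close> and \<open>b\<close> are collinear points of the cone other than
  \<open>c\<close>, every point of \<open>c a\<close> is collinear to every point of
  \<open>c b\<close>. Collinearity in the cone thus depends only on the lines through
  \<open>c\<close>, which \<open>g\<close> stabilizes.\<close>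

lemma cone_aut_coll:
  assumes g: "cone_aut c g" and x: "c \<sim> x" and y: "c \<sim> y"
  shows "x \<sim> y \<longleftrightarrow> g x \<sim> g y"
proof (cases "x = c \<or> y = c")
  case True
  then show ?thesis using cone_aut_in[OF g] cone_aut_fix[OF g] x y sym by metis
next
  case False
  have *: "a' \<sim> b'" if h: "c \<sim> a" "a \<noteq> c" "a' \<in> jn c a" "c \<sim> b" "b \<noteq> c" "b' \<in> jn c b" "a \<sim> b" for a a' b b'
  proof -
    have "b \<sim> a'" using perp_jn[OF h(1) h(2)[symmetric] sym[OF h(4)] sym[OF h(7)] h(3)] .
    moreover have "c \<sim> a'" using line_coll[OF jn(1,2)[OF h(1) h(2)[symmetric]] h(3)] .
    ultimately show ?thesis using perp_jn[OF h(4) h(5)[symmetric] _ _ h(6)] sym by blast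
  qed
  have gx: "g x \<in> jn c x" "g x \<noteq> c" "g y \<in> jn c y" "g y \<noteq> c" using cone_aut_jn[OF g] False x y by blast+
  have "x \<in> jn c (g x)"
    using jn_eq[OF jn(1,2)[OF x] gx(1)] jn(3)[OF x] gx(2) False by metis
  moreover have "y \<in> jn c (g y)"
    using jn_eq[OF jn(1,2)[OF y] gx(3)] jn(3)[OF y] gx(4) False by metis
  ultimately show ?thesis using *[of x "g x" y "g y"] *[of "g x" x "g y" y] False x y gx cone_aut_in[OF g] by blast
qed

text \<open>Lifting this inverse will yield the inverse of a lift of \<open>g\<close>.\<close>

lemma cone_aut_inv:
  assumes g: "cone_aut c g"
  shows "cone_aut c (inv_into (perp \<Delta> c) g)"
proof -
  let ?h = "inv_into (perp \<Delta> c) g"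
  note b = cone_aut_bij[OF g]
  have hg: "?h (g x) = x" if "c \<sim> x" for x using bij_betw_inv_into_left[OF b] that unfolding perp_def by blast
  have cc: "c \<sim> c" using coll_refl cone_aut_P[OF g] .
  have hl: "?h ` g ` l = l" if "\<And>x. x \<in> l \<Longrightarrow> c \<sim> x" for l
    using hg that by (auto simp: image_iff)
  have K: "?h ` K = K" if K: "K \<in> lines \<Delta>" "c \<in> K" for K
    using hl[of K] cone_aut_K[OF g K] line_coll[OF K] by metis
  have "?h ` l \<in> lines \<Delta>" if l: "l \<in> lines \<Delta>" "l \<subseteq> perp \<Delta> c" for l
  proof -
    obtain x y where xy: "x \<in> l" "y \<in> l" "x \<noteq> y" using two_points[OF l(1)] by blast
    have cxy: "c \<sim> x" "c \<sim> y" using xy l unfolding perp_def by blast+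
    obtain x0 where x0: "c \<sim> x0" "x = g x0" using cone_aut_surj[OF g cxy(1)] by blast
    obtain y0 where y0: "c \<sim> y0" "y = g y0" using cone_aut_surj[OF g cxy(2)] by blast
    have c0: "x0 \<sim> y0" "x0 \<noteq> y0" using cone_aut_coll[OF g x0(1) y0(1)] line_coll[OF l(1) xy(1,2)] x0 y0 xy(3) by auto
    have m: "jn x0 y0 \<in> lines \<Delta>" "x0 \<in> jn x0 y0" "y0 \<in> jn x0 y0" using jn[OF c0] by blast+
    have mc: "c \<sim> z" if "z \<in> jn x0 y0" for z using perp_jn[OF c0 x0(1) y0(1) that] .
    have "g ` jn x0 y0 = l"
      using line_unique[OF cone_aut_line[OF g m(1) mc] l(1) _ _ xy] m x0 y0 by blast
    then have "?h ` l = jn x0 y0" using hl[of "jn x0 y0"] mc by metis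
    then show ?thesis using m by simp
  qed
  then show ?thesis unfolding cone_aut_def
    using bij_betw_inv_into[OF b] K hg[OF cc] cone_aut_fix[OF g] cone_aut_P[OF g] by auto
qed

section \<open>Points opposite the vertex and their traces on the cone\<close>

lemma foot:
  assumes y: "y \<in> P" "\<not> c \<sim> y" and z: "\<not> c \<sim> z" and yz: "y \<sim> z" "y \<noteq> z" and c: "c \<in> P"
  defines "k \<equiv> pr c (jn y z)"
  shows "k \<in> jn y z" "c \<sim> k" "k \<sim> y" "k \<sim> z" "k \<noteq> y" "z \<in> jn y k"
proof -
  note j = jn[OF yz]
  show k: "k \<in> jn y z" "c \<sim> k" unfolding k_def using pr[OF j(1,2) y(2) c] by blast+
  then show "k \<sim> y" "k \<sim> z" using line_coll[OF j(1)] j by blast+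
  show ky: "k \<noteq> y" using k y by blast
  show "z \<in> jn y k" using jn_eq[OF j(1,2) k(1) ky[symmetric]] j(3) by blast
qed

lemma affine_third:
  assumes "y \<in> P" "\<not> c \<sim> y" "y \<sim> m" "y \<noteq> m" "c \<in> P"
  shows "\<exists>z\<in>jn y m. z \<noteq> y \<and> \<not> c \<sim> z"
proof -
  note j = jn[OF assms(3,4)]
  obtain z where z: "z \<in> jn y m" "z \<noteq> y" "z \<noteq> pr c (jn y m)" using third[OF j(1)] by blast
  then have "\<not> c \<sim> z" using pr_eq[OF j(1,2) assms(2)] by blast
  then show ?thesis using z by blast
qed

text \<open>If \<open>z\<close> and \<open>w\<close> were distinct and collinear, each point of the
  common trace would be collinear to the foot of the line \<open>z w\<close>; but
  \<open>dp c z\<close> contains a point that is not. If they were not collinear, the foot of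
  \<open>y z\<close> would lie in both traces, so \<open>w\<close> would be collinear to two points
  of \<open>y z\<close> and hence to \<open>z\<close>.\<close>

lemma trace_unique:
  assumes c: "c \<in> P" and z: "z \<in> P" "\<not> c \<sim> z" and w: "w \<in> P" "\<not> c \<sim> w" and y: "y \<in> P" "\<not> c \<sim> y"
    and yz: "y \<sim> z" and yw: "y \<sim> w" and t: "\<And>x. c \<sim> x \<Longrightarrow> x \<sim> z \<longleftrightarrow> x \<sim> w"
  shows "z = w"
proof (rule ccontr)
  assume ne: "z \<noteq> w"
  show False
  proof (cases "z \<sim> w")
    case True
    note k = foot[OF z w(2) True ne c]
    have "pr c (jn z w) \<in> dp c z" unfolding dp_def using k sym by blast
    then obtain x where x: "c \<sim> x" "z \<sim> x" "\<not> pr c (jn z w) \<sim> x" using dp_non[OF z(2)] unfolding dp_def by blast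
    have "x \<sim> w" using t[OF x(1)] sym[OF x(2)] by blast
    then have "x \<sim> pr c (jn z w)" using perp_jn[OF True ne sym[OF x(2)] _ k(1)] by blast
    then show False using x(3) sym by blast
  next
    case False
    have yz': "y \<noteq> z" using yw False by blast
    note k = foot[OF y z(2) yz yz' c]
    have "pr c (jn y z) \<sim> w" using t[OF k(2)] k(4) by blast
    then have "w \<sim> z" using perp_jn[OF sym[OF k(3)] k(5)[symmetric] sym[OF yw] sym k(6)] by blast
    then show False using False sym by blast
  qed
qed

text \<open>Thickness gives a second plane on the line \<open>y w\<close>, and a line through
  \<open>y\<close> in it contains a further point not collinear to \<open>c\<close>. This is used to
  leave a plane without untied points outside it.\<close>

lemma outside_plane:
  assumes \<sigma>: "\<sigma> \<in> planes \<Delta>" "y \<in> \<sigma>" "w \<in> \<sigma>" "y \<noteq> w" and y: "\<not> c \<sim> y" and c: "c \<in> P"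
  shows "\<exists>z. y \<sim> z \<and> w \<sim> z \<and> \<not> c \<sim> z \<and> z \<notin> \<sigma>"
proof -
  have yP: "y \<in> P" using plane_P \<sigma> by blast
  have j: "jn y w \<in> lines \<Delta>" "y \<in> jn y w" "w \<in> jn y w" "jn y w \<subseteq> \<sigma>"
    using jn[OF plane_coll[OF \<sigma>(1-3)] \<sigma>(4)] plane_jn[OF \<sigma>] by blast+
  obtain \<tau> where \<tau>: "\<tau> \<in> planes \<Delta>" "jn y w \<subseteq> \<tau>" "\<tau> \<noteq> \<sigma>" using plane_thick[OF j(1)] by blast
  obtain x where x: "x \<in> \<tau>" "x \<notin> jn y w" using plane_off[OF \<tau>(1) j(1)] by blast
  have i: "y \<in> \<tau>" "w \<in> \<tau>" "y \<noteq> x" using \<tau> j x by blast+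
  have xs: "x \<notin> \<sigma>" using plane_eq[OF \<tau>(1) \<sigma>(1) j(1) \<tau>(2) j(4) x(1) _ x(2)] \<tau>(3) by blast
  note k = jn[OF plane_coll[OF \<tau>(1) i(1) x(1)] i(3)]
  obtain z where z: "z \<in> jn y x" "z \<noteq> y" "\<not> c \<sim> z"
    using affine_third[OF yP y plane_coll[OF \<tau>(1) i(1) x(1)] i(3) c] by blast
  have zt: "z \<in> \<tau>" using plane_jn[OF \<tau>(1) i(1) x(1) i(3)] z(1) by blast
  have "z \<notin> \<sigma>"
  proof
    assume "z \<in> \<sigma>"
    then have "jn y x \<subseteq> \<sigma>" using plane_line[OF \<sigma>(1,2) _ z(2)[symmetric] k(1,2) z(1)] by blast
    then show False using k(3) xs by blast
  qed
  then show ?thesis using plane_coll[OF \<tau>(1) i(1) zt] plane_coll[OF \<tau>(1) i(2) zt] z(3) by blast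
qed

end

section \<open>Extending a collineation of a cone\<close>

locale cone_lift = thick_polar3 +
  fixes c g
  assumes g: "cone_aut c g"
begin

text \<open>\<open>R y y'\<close>: the point \<open>y'\<close> is a possible image of \<open>y\<close>. It need not be unique, because opposite points may have
  the same trace on the cone.\<close>

definition R where "R y y' \<longleftrightarrow> y \<in> P \<and> \<not> c \<sim> y \<and> y' \<in> P \<and> \<not> c \<sim> y' \<and> (\<forall>x. c \<sim> x \<longrightarrow> (x \<sim> y \<longleftrightarrow> g x \<sim> y'))"

lemma RD: "R y y' \<Longrightarrow> y \<in> P" "R y y' \<Longrightarrow> \<not> c \<sim> y" "R y y' \<Longrightarrow> y' \<in> P" "R y y' \<Longrightarrow> \<not> c \<sim> y'"
  "R y y' \<Longrightarrow> c \<sim> x \<Longrightarrow> x \<sim> y \<longleftrightarrow> g x \<sim> y'"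
  unfolding R_def by blast+

lemma cP: "c \<in> P"
  using cone_aut_P[OF g] .

lemma lift_unique:
  assumes "R z z'" "R z z''" "y' \<in> P" "\<not> c \<sim> y'" "y' \<sim> z'" "y' \<sim> z''"
  shows "z' = z''"
proof (rule trace_unique[OF cP RD(3,4)[OF assms(1)] RD(3,4)[OF assms(2)] assms(3-6)])
  fix x assume "c \<sim> x"
  then obtain x0 where x0: "c \<sim> x0" "x = g x0" using cone_aut_surj[OF g] by blast
  show "x \<sim> z' \<longleftrightarrow> x \<sim> z''" using RD(5)[OF assms(1) x0(1)] RD(5)[OF assms(2) x0(1)] x0(2) by simp
qed

text \<open>The image has to lie on the line from \<open>y'\<close> to the image of the foot of
  \<open>y z\<close>. Requiring collinearity with \<open>g u\<close> for a single point
  \<open>u\<close> of the trace of \<open>z\<close> selects a point there, and the remaining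
  collinearities turn out to follow.\<close>

lemma lift_ex:
  assumes R: "R y y'" and z: "\<not> c \<sim> z" and yz: "y \<sim> z" "y \<noteq> z"
  shows "\<exists>z'. R z z' \<and> y' \<sim> z' \<and> z' \<in> jn y' (g (pr c (jn y z)))"
proof -
  note y = RD(1,2)[OF R] and y' = RD(3,4)[OF R]
  have zP: "z \<in> P" using colP(2)[OF yz(1)] .
  define k where "k = pr c (jn y z)"
  have k: "k \<in> jn y z" "c \<sim> k" "k \<sim> y" "k \<sim> z" "k \<noteq> y" "z \<in> jn y k"
    unfolding k_def using foot[OF y z yz cP] by blast+
  have gk: "c \<sim> g k" "g k \<sim> y'" using cone_aut_in[OF g k(2)] RD(5)[OF R k(2)] k(3) by blast+
  have gky: "y' \<noteq> g k" using gk y' by blast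
  note m = jn[OF sym[OF gk(2)] gky]
  have "k \<in> dp c z" unfolding dp_def using k sym by blast
  then obtain u where u: "u \<in> dp c z" "\<not> k \<sim> u" using dp_non[OF z] by blast
  have cu: "c \<sim> u" "u \<sim> z" using u(1) sym unfolding dp_def by blast+
  have ngu: "\<not> g u \<sim> g k" using cone_aut_coll[OF g cu(1) k(2)] u(2) sym by blast
  have guP: "g u \<in> P" using colP(2)[OF cone_aut_in[OF g cu(1)]] .
  define z' where "z' = pr (g u) (jn y' (g k))"
  have z': "z' \<in> jn y' (g k)" "g u \<sim> z'" unfolding z'_def using pr[OF m(1,3) ngu guP] by blast+
  have z'P: "z' \<in> P" using line_sub m(1) z'(1) by blast
  have yz': "y' \<sim> z'" using line_coll[OF m(1,2) z'(1)] .
  have z'k: "z' \<noteq> g k" using z'(2) ngu by blast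
  have cz': "\<not> c \<sim> z'" using perp_line[OF m(1) z'(1) m(3) z'k _ gk(1) m(2)] y'(2) by blast
  \<comment> \<open>Points of the trace of \<open>z\<close> collinear to the foot \<open>k\<close>
    also belong to the trace of \<open>y\<close>.\<close>
  have A: "g v \<sim> z'" if v: "c \<sim> v" "v \<sim> z" "v \<sim> k" for v
  proof -
    have "v \<sim> y" using perp_jn[OF sym[OF k(4)] _ v(2,3)] jn[OF yz] jn_eq[OF jn(1)[OF yz] jn(3)[OF yz] k(1)] k(2) z by metis
    then have "g v \<sim> y'" using RD(5)[OF R v(1)] by blast
    moreover have "g v \<sim> g k" using cone_aut_coll[OF g v(1) k(2)] v(3) by blast
    ultimately show ?thesis using perp_line[OF m gky _ _ z'(1)] by blast
  qed
  \<comment> \<open>The other points of \<open>dp c z\<close> are reached from \<open>u\<close> by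
    connectedness: a line of the quadrangle has one point collinear to \<open>k\<close>, covered by
    \<open>A\<close>, so each step knows two points whose images are collinear to
    \<open>z'\<close>.\<close>
  have B: "g v \<sim> z'" if v: "v \<in> dp c z" "\<not> k \<sim> v" for v
  proof (rule dp_connected[OF z u v, where Q = "\<lambda>v. g v \<sim> z'"])
    show "g u \<sim> z'" by (rule z')
    fix v w assume vw: "v \<in> dp c z" "w \<in> dp c z" "\<not> k \<sim> v" "\<not> k \<sim> w" "v \<sim> w" "g v \<sim> z'"
    show "g w \<sim> z'"
    proof (cases "v = w")
      case False
      note l = jn[OF vw(5) False]
      have lc: "x \<in> dp c z" if "x \<in> jn v w" for x using dp_jn[OF vw(1,2,5) False that] .
      define t where "t = pr k (jn v w)"
      have t: "t \<in> jn v w" "k \<sim> t" unfolding t_def using pr[OF l(1,2) vw(3) colP(1)[OF k(3)]] by blast+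
      have tc: "c \<sim> t" "t \<sim> z" using lc[OF t(1)] sym unfolding dp_def by blast+
      have gt: "g t \<sim> z'" using A[OF tc sym[OF t(2)]] .
      have cv: "c \<sim> v" using vw(1) unfolding dp_def by blast
      have tv: "t \<noteq> v" using t vw by blast
      then have ne: "g t \<noteq> g v" using cone_aut_inj[OF g tc(1) cv] by blast
      have L: "g ` jn v w \<in> lines \<Delta>" using cone_aut_line[OF g l(1)] lc unfolding dp_def by blast
      have "z' \<sim> g w" using perp_line[OF L _ _ ne sym[OF gt] sym[OF vw(6)]] t(1) l by blast
      then show ?thesis by (rule sym)
    qed (use vw in simp)
  qed
  have C: "g v \<sim> z'" if v: "c \<sim> v" "v \<sim> z" for v
    using A[OF v] B[of v] v sym unfolding dp_def by blast
  have "x \<sim> z \<longleftrightarrow> g x \<sim> z'" if x: "c \<sim> x" for x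
  proof
    assume "x \<sim> z" then show "g x \<sim> z'" using C x by blast
  next
    \<comment> \<open>On the line \<open>c x\<close> only one point is collinear to
      \<open>z'\<close>, because \<open>c\<close> is not. The image of the foot of \<open>z\<close>
      is such a point, so \<open>x\<close> is that foot.\<close>
    assume gx: "g x \<sim> z'"
    have xc: "x \<noteq> c"
    proof
      assume "x = c"
      then have "g x = c" using cone_aut_fix[OF g] by simp
      then show False using gx cz' by simp
    qed
    note K = jn[OF x xc[symmetric]]
    have zc: "\<not> z \<sim> c" using z sym by blast
    define v where "v = pr z (jn c x)"
    have v: "v \<in> jn c x" "z \<sim> v" unfolding v_def using pr[OF K(1,2) zc zP] by blast+
    have cv: "c \<sim> v" using line_coll[OF K(1,2) v(1)] .
    have gv: "g v \<sim> z'" using C[OF cv sym[OF v(2)]] .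
    have "g v \<in> jn c x" "g x \<in> jn c x" using cone_aut_K[OF g K(1,2)] v(1) K(3) by blast+
    moreover have "\<not> z' \<sim> c" using cz' sym by blast
    ultimately have "g v = g x" using pr_eq[OF K(1,2) _ _ sym[OF gv]] pr_eq[OF K(1,2) _ _ sym[OF gx]] by metis
    then have "v = x" using cone_aut_inj[OF g cv x] by blast
    then show "x \<sim> z" using v(2) sym by blast
  qed
  then have "R z z'" unfolding R_def using zP z z'P cz' by blast
  then show ?thesis using yz' z'(1) unfolding k_def by blast
qed

lemma lift_on:
  assumes "R y y'" "R z z'" "y \<sim> z" "y \<noteq> z" "y' \<sim> z'"
  shows "z' \<in> jn y' (g (pr c (jn y z)))"
proof -
  obtain z'' where z: "R z z''" "y' \<sim> z''" "z'' \<in> jn y' (g (pr c (jn y z)))"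
    using lift_ex[OF assms(1) RD(2)[OF assms(2)] assms(3,4)] by blast
  have "z' = z''" using lift_unique[OF assms(2) z(1) RD(3,4)[OF assms(1)] assms(5) z(2)] .
  then show ?thesis using z by blast
qed

lemma lift_same:
  assumes "R y y'" "R y y''" "y' \<sim> y''" shows "y' = y''"
  using lift_unique[OF assms(1,2) RD(3,4)[OF assms(1)] coll_refl[OF RD(3)[OF assms(1)]] assms(3)] .

text \<open>The point \<open>w\<close> is collinear to the foot of \<open>y z\<close>, so
  \<open>w'\<close> is collinear to \<open>y'\<close> and to the image of the foot, and
  \<open>z'\<close> lies on the line joining these two.\<close>

lemma lift_triangle:
  assumes Ry: "R y y'" and Rz: "R z z'" and Rw: "R w w'" and c3: "y \<sim> z" "z \<sim> w" "y \<sim> w" and c': "y' \<sim> z'" "y' \<sim> w'"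
  shows "z' \<sim> w'"
proof (cases "y = z")
  case True
  then have "y' = z'" using lift_same[OF Ry _ c'(1)] Rz by simp
  then show ?thesis using c' by simp
next
  case yz: False
  note k = foot[OF RD(1,2)[OF Ry] RD(2)[OF Rz] c3(1) yz cP]
  let ?k = "pr c (jn y z)"
  have "w \<sim> ?k" using perp_jn[OF c3(1) yz sym[OF c3(3)] sym[OF c3(2)] k(1)] .
  then have gw: "g ?k \<sim> w'" using RD(5)[OF Rw k(2)] sym by blast
  have gy: "g ?k \<sim> y'" using RD(5)[OF Ry k(2)] k(3) by blast
  have ne: "y' \<noteq> g ?k" using cone_aut_in[OF g k(2)] RD(4)[OF Ry] by blast
  have "w' \<sim> z'" using perp_jn[OF sym[OF gy] ne sym[OF c'(2)] sym[OF gw] lift_on[OF Ry Rz c3(1) yz c'(1)]] .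
  then show ?thesis by (rule sym)
qed

lemma lift_ex':
  assumes R: "R y y'" and z: "\<not> c \<sim> z" and yz: "y \<sim> z"
  shows "\<exists>z'. R z z' \<and> y' \<sim> z'"
  using lift_ex[OF assms] R coll_refl[OF RD(3)[OF R]] by blast

text \<open>Common neighbours of \<open>y\<close> and \<open>z\<close> opposite \<open>c\<close> are
  linked inside \<open>dp y z\<close>, and each link splits the quadrangle into two
  triangles.\<close>

lemma lift_quadrangle:
  assumes Ry: "R y y'" and Rz: "R z z'" and R1: "R w1 w1'" and R2: "R w2 w2'" and n: "\<not> y \<sim> z"
    and w: "y \<sim> w1" "y \<sim> w2" "z \<sim> w1" "z \<sim> w2" and w': "y' \<sim> w1'" "y' \<sim> w2'" "w1' \<sim> z'"
  shows "w2' \<sim> z'"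
proof -
  have d: "w1 \<in> dp y z" "w2 \<in> dp y z" unfolding dp_def using w by blast+
  have "\<forall>w2'. R w2 w2' \<and> y' \<sim> w2' \<longrightarrow> w2' \<sim> z'"
  proof (rule dp_connected[OF n d(1) RD(2)[OF R1] d(2) RD(2)[OF R2], where Q = "\<lambda>w. \<forall>w'. R w w' \<and> y' \<sim> w' \<longrightarrow> w' \<sim> z'"])
    show "\<forall>w'. R w1 w' \<and> y' \<sim> w' \<longrightarrow> w' \<sim> z'"
      using lift_unique[OF R1 _ RD(3,4)[OF Ry] w'(1)] w'(3) by blast
  next
    fix w v assume h: "w \<in> dp y z" "v \<in> dp y z" "\<not> c \<sim> w" "\<not> c \<sim> v" "w \<sim> v"
      "\<forall>w'. R w w' \<and> y' \<sim> w' \<longrightarrow> w' \<sim> z'"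
    show "\<forall>v'. R v v' \<and> y' \<sim> v' \<longrightarrow> v' \<sim> z'"
    proof (intro allI impI, elim conjE)
      fix v' assume v': "R v v'" "y' \<sim> v'"
      have yw: "y \<sim> w" "y \<sim> v" "z \<sim> w" "z \<sim> v" using h unfolding dp_def by blast+
      obtain w' where w': "R w w'" "y' \<sim> w'" using lift_ex'[OF Ry h(3) yw(1)] by blast
      have "w' \<sim> z'" using h(6) w' by blast
      moreover have "w' \<sim> v'" using lift_triangle[OF Ry w'(1) v'(1) yw(1) h(5) yw(2) w'(2) v'(2)] .
      ultimately show "v' \<sim> z'" using lift_triangle[OF w'(1) v'(1) Rz h(5) sym[OF yw(4)] sym[OF yw(3)]] by blast
    qed
  qed
  then show ?thesis using R2 w'(2) by blast
qed

text \<open>Lifts are propagated from a fixed plane, first to the points tied to it, then to the remaining ones.\<close>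

context
  fixes q q' \<pi>0
  assumes Rq: "R q q'" and \<pi>0: "\<pi>0 \<in> planes \<Delta>" "q \<in> \<pi>0"
begin

definition \<beta> where "\<beta> b = (SOME b'. R b b' \<and> q' \<sim> b')"
text \<open>A point opposite \<open>c\<close> that is not tied has the same trace on
  \<open>\<pi>0\<close> as \<open>c\<close>; \<open>untied_plane\<close> exploits this.\<close>

definition tied where "tied y \<longleftrightarrow> (\<exists>b\<in>\<pi>0. \<not> c \<sim> b \<and> y \<sim> b)"
definition N where "N y y' \<longleftrightarrow> R y y' \<and> (\<forall>b\<in>\<pi>0. \<not> c \<sim> b \<and> y \<sim> b \<longrightarrow> y' \<sim> \<beta> b)"
definition N' where "N' y y' \<longleftrightarrow> R y y' \<and> (\<forall>z z'. z \<sim> y \<and> tied z \<and> N z z' \<longrightarrow> z' \<sim> y')"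

lemma \<beta>: assumes "b \<in> \<pi>0" "\<not> c \<sim> b" shows "R b (\<beta> b)" "q' \<sim> \<beta> b"
proof -
  have "\<exists>b'. R b b' \<and> q' \<sim> b'" using lift_ex'[OF Rq assms(2)] plane_coll[OF \<pi>0 assms(1)] by blast
  then have "R b (\<beta> b) \<and> q' \<sim> \<beta> b" unfolding \<beta>_def by (rule someI_ex)
  then show "R b (\<beta> b)" "q' \<sim> \<beta> b" by blast+
qed

lemma \<beta>_coll:
  assumes a: "a \<in> \<pi>0" "\<not> c \<sim> a" and b: "b \<in> \<pi>0" "\<not> c \<sim> b"
  shows "\<beta> a \<sim> \<beta> b"
  using lift_triangle[OF Rq \<beta>(1)[OF a] \<beta>(1)[OF b] plane_coll[OF \<pi>0 a(1)] plane_coll[OF \<pi>0(1) a(1) b(1)] plane_coll[OF \<pi>0 b(1)] \<beta>(2)[OF a] \<beta>(2)[OF b]] .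

lemma N_ex: assumes "tied y" "\<not> c \<sim> y" shows "\<exists>y'. N y y'"
proof -
  obtain b where b: "b \<in> \<pi>0" "\<not> c \<sim> b" "y \<sim> b" using assms unfolding tied_def by blast
  obtain y' where y': "R y y'" "\<beta> b \<sim> y'" using lift_ex'[OF \<beta>(1)[OF b(1,2)] assms(2) sym[OF b(3)]] by blast
  have "y' \<sim> \<beta> a" if a: "a \<in> \<pi>0" "\<not> c \<sim> a" "y \<sim> a" for a
    using lift_triangle[OF \<beta>(1)[OF b(1,2)] y'(1) \<beta>(1)[OF a(1,2)] sym[OF b(3)] a(3) plane_coll[OF \<pi>0(1) b(1) a(1)] y'(2) \<beta>_coll[OF b(1,2) a(1,2)]] .
  then show ?thesis using y'(1) unfolding N_def by blast
qed

text \<open>If \<open>y\<close> is collinear to the chosen neighbour \<open>b\<close> of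
  \<open>z\<close> in \<open>\<pi>0\<close>, the claim is about a triangle. Otherwise
  \<open>y\<close>, \<open>a\<close>, \<open>b\<close>, \<open>z\<close> form a quadrangle with
  \<open>a\<close> and \<open>b\<close> in \<open>\<pi>0\<close>.\<close>

lemma N_adj:
  assumes y: "tied y" "N y y'" and z: "tied z" "N z z'" and yz: "y \<sim> z"
  shows "y' \<sim> z'"
proof -
  have Ry: "R y y'" and Rz: "R z z'" using y z unfolding N_def by blast+
  obtain a where a: "a \<in> \<pi>0" "\<not> c \<sim> a" "y \<sim> a" using y unfolding tied_def by blast
  obtain b where b: "b \<in> \<pi>0" "\<not> c \<sim> b" "z \<sim> b" using z unfolding tied_def by blast
  have ya: "y' \<sim> \<beta> a" and zb: "z' \<sim> \<beta> b" using y z a b unfolding N_def by blast+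
  show ?thesis
  proof (cases "y \<sim> b")
    case True
    then have yb: "y' \<sim> \<beta> b" using y b unfolding N_def by blast
    show ?thesis using lift_triangle[OF \<beta>(1)[OF b(1,2)] Ry Rz sym[OF True] yz sym[OF b(3)] sym[OF yb] sym[OF zb]] .
  next
    case False
    obtain z'' where z'': "R z z''" "y' \<sim> z''" using lift_ex'[OF Ry RD(2)[OF Rz] yz] by blast
    have "z'' \<sim> \<beta> b"
      using lift_quadrangle[OF Ry \<beta>(1)[OF b(1,2)] \<beta>(1)[OF a(1,2)] z''(1) False a(3) yz plane_coll[OF \<pi>0(1) b(1) a(1)] sym[OF b(3)] ya z''(2) \<beta>_coll[OF a(1,2) b(1,2)]] .
    then have "z' = z''" using lift_unique[OF Rz z''(1) RD(3,4)[OF \<beta>(1)[OF b(1,2)]] sym[OF zb] sym] by blast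
    then show ?thesis using z''(2) by simp
  qed
qed

text \<open>Untied points opposite \<open>c\<close> are collinear to the whole line
  \<open>tr \<pi>0 c\<close>. Those collinear to \<open>y\<close> are thus collinear to a triangle
  of the plane spanned by \<open>y\<close> and this line, and lie in it.\<close>

lemma untied_plane:
  assumes y: "y \<in> P" "\<not> c \<sim> y" "\<not> tied y"
  shows "\<exists>\<sigma>\<in>planes \<Delta>. y \<in> \<sigma> \<and> (\<forall>z. z \<sim> y \<and> \<not> c \<sim> z \<and> \<not> tied z \<longrightarrow> z \<in> \<sigma>)"
proof -
  have cn: "c \<notin> \<pi>0" using plane_coll[OF \<pi>0(1) _ \<pi>0(2)] RD(2)[OF Rq] by blast
  have L: "tr \<pi>0 c \<in> lines \<Delta>" using tr_line[OF \<pi>0(1) cP cn] .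
  have p: "z \<sim> x" if z: "z \<in> P" "\<not> c \<sim> z" "\<not> tied z" and x: "x \<in> tr \<pi>0 c" for z x
  proof -
    have "z \<notin> \<pi>0" using z(2,3) coll_refl[OF z(1)] unfolding tied_def by blast
    then have M: "tr \<pi>0 z \<in> lines \<Delta>" using tr_line[OF \<pi>0(1) z(1)] by blast
    have "tr \<pi>0 z \<subseteq> tr \<pi>0 c" using z(3) unfolding tied_def tr_def by blast
    then have "tr \<pi>0 z = tr \<pi>0 c" using plane_sub_line_eq[OF M L] by blast
    then show ?thesis using x unfolding tr_def by blast
  qed
  obtain \<sigma> where \<sigma>: "\<sigma> \<in> planes \<Delta>" "tr \<pi>0 c \<subseteq> \<sigma>" "y \<in> \<sigma>" using plane_ex[OF L y(1) p[OF y]] by blast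
  obtain a b where ab: "a \<in> tr \<pi>0 c" "b \<in> tr \<pi>0 c" "a \<noteq> b" using two_points[OF L] by blast
  have yl: "y \<notin> jn a b" using jn_eq[OF L ab] y(2) unfolding tr_def by blast
  have "z \<in> \<sigma>" if z: "z \<sim> y" "\<not> c \<sim> z" "\<not> tied z" for z
    using plane_max3[OF \<sigma>(1) _ _ \<sigma>(3) ab(3) yl p[OF colP(1)[OF z(1)] z(2,3) ab(1)] p[OF colP(1)[OF z(1)] z(2,3) ab(2)] z(1)] ab \<sigma>(2) by blast
  then show ?thesis using \<sigma> by blast
qed

lemma N'_ex:
  assumes y: "y \<in> P" "\<not> c \<sim> y" "\<not> tied y"
  shows "\<exists>y'. N' y y'"
proof -
  obtain \<sigma> where \<sigma>: "\<sigma> \<in> planes \<Delta>" "y \<in> \<sigma>" "\<And>z. z \<sim> y \<Longrightarrow> \<not> c \<sim> z \<Longrightarrow> \<not> tied z \<Longrightarrow> z \<in> \<sigma>"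
    using untied_plane[OF y] by blast
  obtain w where w: "w \<in> \<sigma>" "y \<noteq> w" using plane_ex_line[OF \<sigma>(1)] by metis
  obtain z1 where z1: "y \<sim> z1" "\<not> c \<sim> z1" "z1 \<notin> \<sigma>" using outside_plane[OF \<sigma>(1,2) w y(2) cP] by blast
  have t1: "tied z1" using \<sigma>(3)[OF sym[OF z1(1)] z1(2)] z1(3) by blast
  obtain z1' where N1: "N z1 z1'" using N_ex[OF t1 z1(2)] by blast
  have R1: "R z1 z1'" using N1 unfolding N_def by blast
  obtain y' where y': "R y y'" "z1' \<sim> y'" using lift_ex'[OF R1 y(2) sym[OF z1(1)]] by blast
  have step: "z' \<sim> y'" if a: "a \<sim> y" "tied a" "N a a'" "a' \<sim> y'" and z: "z \<sim> y" "tied z" "N z z'" and az: "a \<sim> z" for a a' z z'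
  proof -
    have R: "R a a'" "R z z'" using a z unfolding N_def by blast+
    show ?thesis using lift_triangle[OF R(1) R(2) y'(1) az z(1) a(1) N_adj[OF a(2,3) z(2,3) az] a(4)] .
  qed
  have "z2' \<sim> y'" if z2: "z2 \<sim> y" "tied z2" "N z2 z2'" for z2 z2'
  proof (cases "z1 \<sim> z2")
    case True
    then show ?thesis using step[OF sym[OF z1(1)] t1 N1 y'(2) z2] by blast
  next
    case False
    \<comment> \<open>Two non-collinear neighbours of \<open>y\<close> in this quadrangle cannot
      both lie in \<open>\<sigma>\<close>. Hence one of them is tied and serves as an intermediate
      point \<open>z3\<close> between \<open>z1\<close> and \<open>z2\<close>.\<close>
    have d: "y \<in> dp z1 z2" unfolding dp_def using sym[OF z1(1)] z2(1) by blast
    obtain m1 where m1: "m1 \<in> dp z1 z2" "y \<sim> m1" "y \<noteq> m1" using dp_nbr[OF False d] by blast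
    obtain m2 where m2: "m2 \<in> dp z1 z2" "y \<sim> m2" "y \<noteq> m2" "\<not> m1 \<sim> m2"
      using dp_third[OF False d m1(1) sym[OF m1(2)] m1(3)[symmetric] m1(1) sym[OF m1(2)] m1(3)[symmetric]] by blast
    obtain a where a: "a \<in> jn y m1" "a \<noteq> y" "\<not> c \<sim> a" using affine_third[OF y(1,2) m1(2,3) cP] by blast
    obtain b where b: "b \<in> jn y m2" "b \<noteq> y" "\<not> c \<sim> b" using affine_third[OF y(1,2) m2(2,3) cP] by blast
    note j1 = jn[OF m1(2,3)] and j2 = jn[OF m2(2,3)]
    have ad: "a \<in> dp z1 z2" "a \<sim> y" using dp_jn[OF d m1 a(1)] line_coll[OF j1(1) a(1) j1(2)] by blast+
    have bd: "b \<in> dp z1 z2" "b \<sim> y" using dp_jn[OF d m2(1-3) b(1)] line_coll[OF j2(1) b(1) j2(2)] by blast+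
    have "\<not> a \<sim> b"
    proof
      assume ab: "a \<sim> b"
      have "b \<sim> m1" using perp_line[OF j1(1) a(1) j1(2) a(2) sym[OF ab] bd(2) j1(3)] .
      then have "m1 \<sim> m2" using perp_line[OF j2(1) b(1) j2(2) b(2) sym sym[OF m1(2)] j2(3)] by blast
      then show False using m2(4) by blast
    qed
    then have "tied a \<or> tied b" using \<sigma>(3)[OF ad(2) a(3)] \<sigma>(3)[OF bd(2) b(3)] plane_coll[OF \<sigma>(1)] by blast
    then obtain z3 where z3: "tied z3" "z3 \<in> dp z1 z2" "z3 \<sim> y" "\<not> c \<sim> z3" using ad bd a b by blast
    obtain z3' where N3: "N z3 z3'" using N_ex[OF z3(1,4)] by blast
    have zz: "z1 \<sim> z3" "z3 \<sim> z2" using z3(2) sym unfolding dp_def by blast+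
    have "z3' \<sim> y'" using step[OF sym[OF z1(1)] t1 N1 y'(2) z3(3,1) N3 zz(1)] .
    then show ?thesis using step[OF z3(3,1) N3 _ z2 zz(2)] by blast
  qed
  then show ?thesis using y'(1) unfolding N'_def by blast
qed

lemma lift_total_aux: "\<exists>h. h q = q' \<and> (\<forall>y\<in>P. \<not> c \<sim> y \<longrightarrow> R y (h y)) \<and>
  (\<forall>y z. \<not> c \<sim> y \<and> \<not> c \<sim> z \<and> y \<sim> z \<longrightarrow> h y \<sim> h z)"
proof -
  define h where "h y = (if tied y then SOME y'. N y y' else SOME y'. N' y y')" for y
  have hN: "N y (h y)" if y: "tied y" "\<not> c \<sim> y" for y
    using someI_ex[OF N_ex[OF y]] y unfolding h_def by simp
  have hN': "N' y (h y)" if y: "\<not> tied y" "\<not> c \<sim> y" "y \<in> P" for y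
    using someI_ex[OF N'_ex[OF y(3,2,1)]] y unfolding h_def by simp
  have hR: "R y (h y)" if "y \<in> P" "\<not> c \<sim> y" for y
    using hN[of y] hN'[of y] that unfolding N_def N'_def by blast
  have adj: "h y \<sim> h z" if yz: "\<not> c \<sim> y" "\<not> c \<sim> z" "y \<sim> z" for y z
  proof -
    have yP: "y \<in> P" "z \<in> P" using colP yz(3) by blast+
    consider "tied y" "tied z" | "tied y" "\<not> tied z" | "\<not> tied y" "tied z" | "\<not> tied y" "\<not> tied z" by blast
    then show ?thesis
    proof cases
      case 1
      then show ?thesis using N_adj[OF 1(1) hN 1(2) hN] yz by blast
    next
      case 2
      then show ?thesis using hN'[OF 2(2) yz(2) yP(2)] hN[OF 2(1) yz(1)] yz(3) unfolding N'_def by blast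
    next
      case 3
      then have "h z \<sim> h y" using hN'[OF 3(1) yz(1) yP(1)] hN[OF 3(2) yz(2)] sym[OF yz(3)] unfolding N'_def by blast
      then show ?thesis by (rule sym)
    next
      \<comment> \<open>Both untied points lie in one plane; a common neighbour outside it is tied
        and closes a triangle.\<close>
      case 4
      show ?thesis
      proof (cases "y = z")
        case True
        then show ?thesis using coll_refl RD(3)[OF hR[OF yP(1) yz(1)]] by metis
      next
        case False
        obtain \<sigma> where \<sigma>: "\<sigma> \<in> planes \<Delta>" "y \<in> \<sigma>" "\<And>z. z \<sim> y \<Longrightarrow> \<not> c \<sim> z \<Longrightarrow> \<not> tied z \<Longrightarrow> z \<in> \<sigma>"
          using untied_plane[OF yP(1) yz(1) 4(1)] by blast
        have z\<sigma>: "z \<in> \<sigma>" using \<sigma>(3)[OF sym[OF yz(3)] yz(2) 4(2)] .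
        obtain w where w: "y \<sim> w" "z \<sim> w" "\<not> c \<sim> w" "w \<notin> \<sigma>" using outside_plane[OF \<sigma>(1,2) z\<sigma> False yz(1) cP] by blast
        have tw: "tied w" using \<sigma>(3)[OF sym[OF w(1)] w(3)] w(4) by blast
        have wP: "w \<in> P" using colP(2)[OF w(1)] .
        have "h w \<sim> h y" "h w \<sim> h z"
          using hN'[OF 4(1) yz(1) yP(1)] hN'[OF 4(2) yz(2) yP(2)] hN[OF tw w(3)] tw sym[OF w(1)] sym[OF w(2)] unfolding N'_def by blast+
        then show ?thesis
          using lift_triangle[OF hR[OF wP w(3)] hR[OF yP(1) yz(1)] hR[OF yP(2) yz(2)] sym[OF w(1)] yz(3) sym[OF w(2)]] by blast
      qed
    qed
  qed
  have qq: "q \<sim> q" using coll_refl[OF RD(1)[OF Rq]] .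
  have tq: "tied q" unfolding tied_def using \<pi>0(2) RD(2)[OF Rq] qq by blast
  have bq: "\<beta> q = q'" using lift_same[OF Rq \<beta>(1)[OF \<pi>0(2) RD(2)[OF Rq]] \<beta>(2)[OF \<pi>0(2) RD(2)[OF Rq]]] by simp
  have Nq: "N q (h q)" using hN[OF tq RD(2)[OF Rq]] .
  then have "h q \<sim> q'" using bq \<pi>0(2) RD(2)[OF Rq] qq unfolding N_def by metis
  moreover have "R q (h q)" using Nq unfolding N_def by blast
  ultimately have "h q = q'" using lift_same[OF _ Rq] by blast
  then show ?thesis using hR adj by blast
qed

end

lemma lift_total:
  assumes "R q q'"
  shows "\<exists>h. h q = q' \<and> (\<forall>y\<in>P. \<not> c \<sim> y \<longrightarrow> R y (h y)) \<and> (\<forall>y z. \<not> c \<sim> y \<and> \<not> c \<sim> z \<and> y \<sim> z \<longrightarrow> h y \<sim> h z)"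
  using lift_total_aux[OF assms] point_on_plane[OF RD(1)[OF assms]] by blast

text \<open>The set where \<open>k\<close> undoes \<open>h\<close> contains \<open>q\<close> and is
  closed under passing to neighbours opposite \<open>c\<close>, by \<open>trace_unique\<close>. The
  properties of \<open>k\<close> are spelled out because \<open>R\<close> in this locale refers to
  \<open>g\<close>, while \<open>k\<close> lifts the inverse of \<open>g\<close>.\<close>

lemma lift_inverse:
  assumes h: "h q = q'" "\<And>y. y \<in> P \<Longrightarrow> \<not> c \<sim> y \<Longrightarrow> R y (h y)"
      "\<And>y z. \<not> c \<sim> y \<Longrightarrow> \<not> c \<sim> z \<Longrightarrow> y \<sim> z \<Longrightarrow> h y \<sim> h z"
    and gi: "\<And>x. c \<sim> x \<Longrightarrow> c \<sim> gi x" "\<And>x. c \<sim> x \<Longrightarrow> gi (g x) = x"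
    and k: "k q' = q" "\<And>y. y \<in> P \<Longrightarrow> \<not> c \<sim> y \<Longrightarrow> k y \<in> P \<and> \<not> c \<sim> k y \<and> (\<forall>x. c \<sim> x \<longrightarrow> (x \<sim> y \<longleftrightarrow> gi x \<sim> k y))"
      "\<And>y z. \<not> c \<sim> y \<Longrightarrow> \<not> c \<sim> z \<Longrightarrow> y \<sim> z \<Longrightarrow> k y \<sim> k z"
    and q: "q \<in> P" "\<not> c \<sim> q" and y: "y \<in> P" "\<not> c \<sim> y"
  shows "k (h y) = y"
proof (rule opp_connected[OF q y, where Q = "\<lambda>y. k (h y) = y"])
  show "k (h q) = q" using h k by simp
next
  fix y z assume yz: "y \<in> P" "z \<in> P" "\<not> c \<sim> y" "\<not> c \<sim> z" "y \<sim> z" "k (h y) = y"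
  note Rz = h(2)[OF yz(2,4)] and Ry = h(2)[OF yz(1,3)]
  note kz = k(2)[OF RD(3,4)[OF Rz]]
  have "h y \<sim> h z" using h(3) yz by blast
  then have a: "y \<sim> k (h z)" using k(3)[OF RD(4)[OF Ry] RD(4)[OF Rz]] yz(6) by simp
  have "x \<sim> k (h z) \<longleftrightarrow> x \<sim> z" if x: "c \<sim> x" for x
    using RD(5)[OF Rz x] kz gi(2)[OF x] cone_aut_in[OF g x] by metis
  then show "k (h z) = z" using trace_unique[OF cP _ _ yz(2,4,1,3) a yz(5)] kz by blast
qed

end

context thick_polar3
begin

text \<open>For a point off the line, a plane on the line avoiding it supplies the witness
  \<open>w\<close>. Lines are thereby recovered from collinearity, so a bijection preserving
  collinearity both ways is a collineation.\<close>

lemma jn_perp_iff: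
  assumes "x \<sim> y" "x \<noteq> y"
  shows "z \<in> jn x y \<longleftrightarrow> z \<in> P \<and> (\<forall>w. w \<sim> x \<and> w \<sim> y \<longrightarrow> w \<sim> z)"
proof
  note j = jn[OF assms]
  assume "z \<in> jn x y"
  then show "z \<in> P \<and> (\<forall>w. w \<sim> x \<and> w \<sim> y \<longrightarrow> w \<sim> z)" using perp_jn[OF assms] line_sub j by blast
next
  note j = jn[OF assms]
  assume z: "z \<in> P \<and> (\<forall>w. w \<sim> x \<and> w \<sim> y \<longrightarrow> w \<sim> z)"
  show "z \<in> jn x y"
  proof (rule ccontr)
    assume n: "z \<notin> jn x y"
    obtain \<rho> where \<rho>: "\<rho> \<in> planes \<Delta>" "jn x y \<subseteq> \<rho>" "z \<notin> \<rho>" using plane_avoid2[OF j(1) n n] by blast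
    obtain w where w: "w \<in> \<rho>" "\<not> z \<sim> w" using plane_max[OF \<rho>(1)] \<rho>(3) z by blast
    have "w \<sim> x" "w \<sim> y" using plane_coll[OF \<rho>(1) w(1)] \<rho>(2) j by blast+
    then show False using z w(2) sym by blast
  qed
qed

section \<open>Collineations as bijections preserving collinearity\<close>

definition aut where "aut f \<longleftrightarrow> bij_betw f P P \<and> (\<forall>x\<in>P. \<forall>y\<in>P. x \<sim> y \<longleftrightarrow> f x \<sim> f y)"

lemma aut_coll: "aut f \<Longrightarrow> x \<in> P \<Longrightarrow> y \<in> P \<Longrightarrow> x \<sim> y \<longleftrightarrow> f x \<sim> f y"
  and aut_bij: "aut f \<Longrightarrow> bij_betw f P P"
  unfolding aut_def by blast+

lemma aut_inj: "aut f \<Longrightarrow> x \<in> P \<Longrightarrow> y \<in> P \<Longrightarrow> f x = f y \<Longrightarrow> x = y"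
  using aut_bij unfolding bij_betw_def inj_on_def by blast

lemma aut_in: "aut f \<Longrightarrow> x \<in> P \<Longrightarrow> f x \<in> P"
  using bij_betwE[OF aut_bij] by blast

lemma aut_surj: "aut f \<Longrightarrow> y \<in> P \<Longrightarrow> \<exists>x\<in>P. y = f x"
  using aut_bij[of f] unfolding bij_betw_def by blast

lemma aut_jn:
  assumes f: "aut f" and xy: "x \<sim> y" "x \<noteq> y"
  shows "f ` jn x y = jn (f x) (f y)"
proof -
  note xyP = colP[OF xy(1)]
  have fxy: "f x \<sim> f y" "f x \<noteq> f y" using aut_coll[OF f xyP] aut_inj[OF f xyP] xy by blast+
  have *: "f z \<in> jn (f x) (f y) \<longleftrightarrow> z \<in> jn x y" if z: "z \<in> P" for z
  proof -
    have "(\<forall>w. w \<sim> f x \<and> w \<sim> f y \<longrightarrow> w \<sim> f z) \<longleftrightarrow> (\<forall>w. w \<sim> x \<and> w \<sim> y \<longrightarrow> w \<sim> z)"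
    proof (intro iffI allI impI; elim conjE)
      fix w assume a: "\<forall>w. w \<sim> f x \<and> w \<sim> f y \<longrightarrow> w \<sim> f z" "w \<sim> x" "w \<sim> y"
      have wP: "w \<in> P" using colP a by blast
      then show "w \<sim> z" using aut_coll[OF f wP z] aut_coll[OF f wP xyP(1)] aut_coll[OF f wP xyP(2)] a by blast
    next
      fix w assume a: "\<forall>w. w \<sim> x \<and> w \<sim> y \<longrightarrow> w \<sim> z" "w \<sim> f x" "w \<sim> f y"
      obtain w0 where w0: "w0 \<in> P" "w = f w0" using aut_surj[OF f] colP a(2) by blast
      then show "w \<sim> f z" using aut_coll[OF f w0(1) z] aut_coll[OF f w0(1) xyP(1)] aut_coll[OF f w0(1) xyP(2)] a by blast
    qed
    then show ?thesis using jn_perp_iff[OF fxy, of "f z"] jn_perp_iff[OF xy, of z] aut_in[OF f z] z by blast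
  qed
  show ?thesis
  proof (intro subset_antisym subsetI)
    fix w assume "w \<in> f ` jn x y"
    then show "w \<in> jn (f x) (f y)" using * line_sub[OF jn(1)[OF xy]] by blast
  next
    fix w assume w: "w \<in> jn (f x) (f y)"
    then have "w \<in> P" using line_sub[OF jn(1)[OF fxy]] by blast
    then obtain z where "z \<in> P" "w = f z" using aut_surj[OF f] by blast
    then show "w \<in> f ` jn x y" using * w by blast
  qed
qed

lemma aut_collineation:
  assumes f: "aut f" shows "collineation \<Delta> f"
proof -
  have inj: "inj_on f P" using aut_bij[OF f] unfolding bij_betw_def by blast
  have L: "f ` l \<in> lines \<Delta>" if l: "l \<in> lines \<Delta>" for l
  proof -
    obtain x y where xy: "x \<in> l" "y \<in> l" "x \<noteq> y" using two_points[OF l] by blast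
    note c = line_coll[OF l xy(1,2)]
    have "f x \<sim> f y" "f x \<noteq> f y" using aut_coll[OF f colP[OF c]] aut_inj[OF f colP[OF c]] c xy(3) by blast+
    then show ?thesis using aut_jn[OF f c xy(3)] jn_eq[OF l xy] jn(1) by simp
  qed
  have S: "l \<in> image f ` lines \<Delta>" if l: "l \<in> lines \<Delta>" for l
  proof -
    obtain x y where xy: "x \<in> l" "y \<in> l" "x \<noteq> y" using two_points[OF l] by blast
    note c = line_coll[OF l xy(1,2)]
    obtain x0 where x0: "x0 \<in> P" "x = f x0" using aut_surj[OF f] colP(1)[OF c] by blast
    obtain y0 where y0: "y0 \<in> P" "y = f y0" using aut_surj[OF f] colP(2)[OF c] by blast
    have c0: "x0 \<sim> y0" "x0 \<noteq> y0" using aut_coll[OF f x0(1) y0(1)] c x0 y0 xy by auto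
    have "f ` jn x0 y0 = l" using aut_jn[OF f c0] jn_eq[OF l xy] x0 y0 by simp
    then show ?thesis using jn(1)[OF c0] by blast
  qed
  have "image f ` lines \<Delta> = lines \<Delta>" using L S by blast
  moreover have "inj_on (image f) (lines \<Delta>)"
    using inj_on_image_eq_iff[OF inj] line_sub by (intro inj_onI) blast
  ultimately show ?thesis unfolding collineation_def bij_betw_def using aut_bij[OF f] unfolding bij_betw_def by blast
qed

text \<open>The map is \<open>g\<close> on the cone and a lift of \<open>g\<close> off it; a lift of
  the inverse of \<open>g\<close> sending \<open>q'\<close> to \<open>q\<close> inverts it. The last
  two clauses record where the cone map is the identity.\<close>

lemma central_collineation:
  assumes c: "c \<in> P" and q: "q \<in> P" "\<not> c \<sim> q" and q': "q' \<in> P" "\<not> c \<sim> q'"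
  shows "\<exists>f. aut f \<and> f c = c \<and> f q = q' \<and> (\<forall>K\<in>lines \<Delta>. c \<in> K \<longrightarrow> f ` K = K) \<and>
    (\<forall>x. c \<sim> x \<and> c \<noteq> x \<and> pr q (jn c x) = pr q' (jn c x) \<longrightarrow> f x = x) \<and>
    (\<forall>K\<in>lines \<Delta>. \<forall>x\<in>K. \<forall>y\<in>K. c \<in> K \<and> x \<noteq> c \<and> f x = x \<longrightarrow> f y = y)"
proof -
  have nq: "\<not> q \<sim> c" "\<not> q' \<sim> c" using q q' sym by blast+
  define g where "g = cone_map c q q'"
  have ca: "cone_aut c g" unfolding g_def using cone_map_aut[OF q(1) nq(1) q'(1) nq(2) c] .
  interpret A: cone_lift \<Delta> c g by unfold_locales (rule ca)
  define gi where "gi = inv_into (perp \<Delta> c) g"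
  have ci: "cone_aut c gi" unfolding gi_def using cone_aut_inv[OF ca] .
  interpret B: cone_lift \<Delta> c gi by unfold_locales (rule ci)
  have gig: "gi (g x) = x" if "c \<sim> x" for x
    unfolding gi_def using bij_betw_inv_into_left[OF cone_aut_bij[OF ca]] that unfolding perp_def by blast
  have ggi: "g (gi x) = x" if "c \<sim> x" for x
    unfolding gi_def using bij_betw_inv_into_right[OF cone_aut_bij[OF ca]] that unfolding perp_def by blast
  have gc: "c \<sim> g x" "c \<sim> gi x" if "c \<sim> x" for x using cone_aut_in ca ci that by blast+
  have Rq: "A.R q q'" 
    using q q' cone_map_perp[OF q(1) nq(1) q'(1) nq(2), folded g_def] A.R_def by blast
  have "\<And>x. c \<sim> x \<Longrightarrow> x \<sim> q' \<longleftrightarrow> gi x \<sim> q" using A.RD(5)[OF Rq] gc ggi by metis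
  then have Rq': "B.R q' q" unfolding B.R_def using q q' by blast
  obtain h where h: "h q = q'" "\<And>y. y \<in> P \<Longrightarrow> \<not> c \<sim> y \<Longrightarrow> A.R y (h y)"
    "\<And>y z. \<not> c \<sim> y \<Longrightarrow> \<not> c \<sim> z \<Longrightarrow> y \<sim> z \<Longrightarrow> h y \<sim> h z" using A.lift_total[OF Rq] by blast
  obtain k where k: "k q' = q" "\<And>y. y \<in> P \<Longrightarrow> \<not> c \<sim> y \<Longrightarrow> B.R y (k y)"
    "\<And>y z. \<not> c \<sim> y \<Longrightarrow> \<not> c \<sim> z \<Longrightarrow> y \<sim> z \<Longrightarrow> k y \<sim> k z" using B.lift_total[OF Rq'] by blast
  have ho: "h y \<in> P \<and> \<not> c \<sim> h y \<and> (\<forall>x. c \<sim> x \<longrightarrow> (x \<sim> y \<longleftrightarrow> g x \<sim> h y))" if "y \<in> P" "\<not> c \<sim> y" for y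
    using h(2)[OF that] unfolding A.R_def by blast
  have ko: "k y \<in> P \<and> \<not> c \<sim> k y \<and> (\<forall>x. c \<sim> x \<longrightarrow> (x \<sim> y \<longleftrightarrow> gi x \<sim> k y))" if "y \<in> P" "\<not> c \<sim> y" for y
    using k(2)[OF that] unfolding B.R_def by blast
  have kh: "k (h y) = y" if "y \<in> P" "\<not> c \<sim> y" for y
    using A.lift_inverse[OF h gc(2) gig k(1) ko k(3) q that] by blast
  have hk: "h (k y) = y" if "y \<in> P" "\<not> c \<sim> y" for y
    using B.lift_inverse[OF k gc(1) ggi h(1) ho h(3) q' that] by blast
  define f where "f x = (if c \<sim> x then g x else h x)" for x
  define fi where "fi x = (if c \<sim> x then gi x else k x)" for x
  have fP: "f x \<in> P \<and> fi x \<in> P \<and> fi (f x) = x \<and> f (fi x) = x" if x: "x \<in> P" for x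
  proof (cases "c \<sim> x")
    case True
    then have "c \<sim> g x" "c \<sim> gi x" using gc by blast+
    then show ?thesis using True gig ggi colP(2) unfolding f_def fi_def by simp
  next
    case False
    then show ?thesis using ho[OF x False] ko[OF x False] kh[OF x False] hk[OF x False] unfolding f_def fi_def by simp
  qed
  have bij: "bij_betw f P P" using fP by (intro bij_betw_byWitness[where f' = fi]) auto
  have gen: "x \<sim> y \<longleftrightarrow> f x \<sim> f y" if xy: "x \<in> P" "y \<in> P" for x y
  proof -
    consider "c \<sim> x" "c \<sim> y" | "c \<sim> x" "\<not> c \<sim> y" | "\<not> c \<sim> x" "c \<sim> y" | "\<not> c \<sim> x" "\<not> c \<sim> y" by blast
    then show ?thesis
    proof cases
      case 1 then show ?thesis using cone_aut_coll[OF ca] unfolding f_def by simp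
    next
      case 2 then show ?thesis using ho[OF xy(2)] unfolding f_def by simp
    next
      case 3
      have "y \<sim> x \<longleftrightarrow> f y \<sim> f x" using 3 ho[OF xy(1)] unfolding f_def by simp
      then show ?thesis using sym by blast
    next
      case 4
      then have "x \<sim> y \<Longrightarrow> h x \<sim> h y" using h(3) by blast
      moreover have "h x \<sim> h y \<Longrightarrow> k (h x) \<sim> k (h y)" using k(3) ho 4 xy by blast
      ultimately show ?thesis using kh 4 xy unfolding f_def by auto
    qed
  qed
  have aut: "aut f" unfolding aut_def using bij gen by blast
  have cc: "c \<sim> c" using coll_refl[OF c] .
  have fc: "f c = c" unfolding f_def using cc cone_aut_fix[OF ca] by simp
  have fq: "f q = q'" unfolding f_def using q h(1) by simp
  have fg: "f x = g x" if "c \<sim> x" for x unfolding f_def using that by simp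
  have K: "f ` K = K" if K: "K \<in> lines \<Delta>" "c \<in> K" for K
  proof -
    have "f ` K = g ` K" using fg line_coll[OF K] by (intro image_cong) auto
    then show ?thesis using cone_aut_K[OF ca K] by simp
  qed
  have fix1: "f x = x" if "c \<sim> x" "c \<noteq> x" "pr q (jn c x) = pr q' (jn c x)" for x
    using cone_map_fix[OF q(1) nq(1) that] fg that unfolding g_def by simp
  have fix2: "f y = y" if K: "K \<in> lines \<Delta>" "c \<in> K" "x \<in> K" "x \<noteq> c" "f x = x" "y \<in> K" for K x y
    using cone_map_fix_line[OF q(1) nq(1) q'(1) nq(2) K(1-4) _ K(6)] K(5) fg line_coll[OF K(1,2)] K(3,6) unfolding g_def by metis
  show ?thesis by (rule exI[of _ f]) (use aut fc fq K fix1 fix2 in blast)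
qed

text \<open>If a line through \<open>d\<close> were moved, the collineation would induce a homology in a plane through \<open>d\<close> and thus
  fix a point opposite \<open>c\<close>; but then it fixes the whole cone, so \<open>q\<close> and \<open>q'\<close> have the same trace.\<close>

lemma axial_collineation:
  assumes L: "c \<sim> d" "c \<noteq> d" and q: "d \<sim> q" "\<not> c \<sim> q" and q': "q' \<in> jn d q" "q' \<noteq> d"
  shows "\<exists>f. aut f \<and> f q = q' \<and> (\<forall>x. c \<sim> x \<and> d \<sim> x \<longrightarrow> f x = x) \<and>
    (\<forall>K\<in>lines \<Delta>. c \<in> K \<or> d \<in> K \<longrightarrow> f ` K = K)"
proof (cases "q' = q")
  case True
  have "aut id" unfolding aut_def by simp
  then show ?thesis using True by (intro exI[of _ id]) simp
next
  case qq: False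
  have cP: "c \<in> P" "d \<in> P" using colP[OF L(1)] .
  have qP: "q \<in> P" using colP[OF q(1)] by blast
  have dq: "d \<noteq> q" using L q by blast
  note Y = jn[OF q(1) dq]
  have cq': "\<not> c \<sim> q'" using perp_line[OF Y(1,2) q'(1) q'(2)[symmetric] L(1) _ Y(3)] q(2) by blast
  have dq': "d \<sim> q'" "q \<sim> q'" using line_coll[OF Y(1)] Y q' by blast+
  have q'P: "q' \<in> P" using colP dq' by blast
  obtain f where f: "aut f" "f c = c" "f q = q'" and f': "\<forall>K\<in>lines \<Delta>. c \<in> K \<longrightarrow> f ` K = K"
    "\<forall>x. c \<sim> x \<and> c \<noteq> x \<and> pr q (jn c x) = pr q' (jn c x) \<longrightarrow> f x = x"
    "\<forall>K\<in>lines \<Delta>. \<forall>x\<in>K. \<forall>y\<in>K. c \<in> K \<and> x \<noteq> c \<and> f x = x \<longrightarrow> f y = y"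
    using central_collineation[OF cP(1) qP q(2) q'P cq'] by (elim exE conjE)
  have fK: "f ` K = K" if "K \<in> lines \<Delta>" "c \<in> K" for K using f'(1) that by blast
  have fix1: "f x = x" if "c \<sim> x" "c \<noteq> x" "pr q (jn c x) = pr q' (jn c x)" for x using f'(2) that by blast
  have fix2: "f y = y" if "K \<in> lines \<Delta>" "c \<in> K" "x \<in> K" "y \<in> K" "x \<noteq> c" "f x = x" for K x y using f'(3) that by blast
  \<comment> \<open>The foot of \<open>q\<close> on the line \<open>c x\<close> is collinear to
    \<open>d\<close> and \<open>q\<close>, hence to \<open>q'\<close>, so \<open>q\<close> and
    \<open>q'\<close> have the same foot.\<close>
  have fixL: "f x = x" if x: "c \<sim> x" "d \<sim> x" for x
  proof (cases "x = c")
    case False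
    note K = jn[OF x(1) False[symmetric]]
    have nq: "\<not> q \<sim> c" "\<not> q' \<sim> c" using q cq' sym by blast+
    define k where "k = pr q (jn c x)"
    have k: "k \<in> jn c x" "q \<sim> k" unfolding k_def using pr[OF K(1,2) nq(1) qP] by blast+
    have "d \<sim> k" using perp_jn[OF x(1) False[symmetric] sym[OF L(1)] x(2) k(1)] .
    then have "k \<sim> q'" using perp_line[OF Y(1,2,3) dq sym sym[OF k(2)] q'(1)] by blast
    then have "pr q' (jn c x) = k" using pr_eq[OF K(1,2) nq(2) k(1)] sym by blast
    then show ?thesis using fix1[OF x(1) False[symmetric]] k_def by simp
  qed (simp add: f)
  have nofix: "f y \<noteq> y" if y: "y \<in> P" "\<not> c \<sim> y" for y
  proof
    assume fy: "f y = y"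
    have all: "f x = x" if x: "c \<sim> x" for x
    proof (cases "x = c")
      case False
      note K = jn[OF x False[symmetric]]
      have ny: "\<not> y \<sim> c" using y sym by blast
      define k where "k = pr y (jn c x)"
      have k: "k \<in> jn c x" "y \<sim> k" unfolding k_def using pr[OF K(1,2) ny y(1)] by blast+
      have kP: "k \<in> P" using colP k(2) by blast
      have "f k \<in> jn c x" using fK[OF K(1,2)] k(1) by blast
      moreover have "y \<sim> f k" using aut_coll[OF f(1) y(1) kP] fy k(2) by simp
      ultimately have "f k = k" using pr_eq[OF K(1,2) ny] k_def by metis
      then show ?thesis using fix2[OF K(1,2) k(1) K(3)] k(2) ny by metis
    qed (simp add: f)
    have "x \<sim> q \<longleftrightarrow> x \<sim> q'" if x: "c \<sim> x" for x
      using aut_coll[OF f(1) _ qP, of x] all[OF x] f(3) colP(2)[OF x] by simp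
    then have "q = q'" using trace_unique[OF cP(1) qP q(2) q'P cq' qP q(2) coll_refl[OF qP] dq'(2)] by blast
    then show False using qq by simp
  qed
  have fd: "f d = d" using fixL[OF L(1) coll_refl[OF cP(2)]] .
  have stab: "f ` jn d y = jn d y" if y: "d \<sim> y" "\<not> c \<sim> y" for y
  proof -
    \<comment> \<open>Lines through \<open>d\<close> not contained in the perp of \<open>c\<close>
      are represented by points of \<open>dp d d'\<close> not collinear to \<open>c\<close>, so
      stability spreads from the line \<open>d q\<close> by connectedness.\<close>
    obtain d' where d': "d' \<in> P" "\<not> d \<sim> d'" using opp_ex[OF cP(2)] by blast
    have ft: "pr d' (jn d x) \<in> dp d d'" "\<not> c \<sim> pr d' (jn d x)" "jn d (pr d' (jn d x)) = jn d x" if x: "d \<sim> x" "\<not> c \<sim> x" for x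
    proof -
      have dx: "d \<noteq> x" using x L by blast
      note j = jn[OF x(1) dx]
      have nd: "\<not> d' \<sim> d" using d' sym by blast
      have p: "pr d' (jn d x) \<in> jn d x" "d' \<sim> pr d' (jn d x)" using pr[OF j(1,2) nd d'(1)] by blast+
      have pd: "pr d' (jn d x) \<noteq> d" using p nd by metis
      show "pr d' (jn d x) \<in> dp d d'" unfolding dp_def using p line_coll[OF j(1,2)] by blast
      show "\<not> c \<sim> pr d' (jn d x)" using perp_line[OF j(1,2) p(1) pd[symmetric] L(1) _ j(3)] x(2) by blast
      show "jn d (pr d' (jn d x)) = jn d x" using jn_eq[OF j(1,2) p(1) pd[symmetric]] .
    qed
    have "f ` jn d (pr d' (jn d y)) = jn d (pr d' (jn d y))"
    proof (rule dp_connected[OF d'(2) ft(1)[OF q] ft(2)[OF q] ft(1)[OF y] ft(2)[OF y], where Q = "\<lambda>y. f ` jn d y = jn d y"])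
      have "f ` jn d q = jn d q'" using aut_jn[OF f(1) q(1) dq] fd f(3) by simp
      also have "\<dots> = jn d q" using jn_eq[OF Y(1,2) q'(1)] q'(2) by blast
      finally show "f ` jn d (pr d' (jn d q)) = jn d (pr d' (jn d q))" using ft(3)[OF q] by simp
    next
      fix x w assume h: "x \<in> dp d d'" "w \<in> dp d d'" "\<not> c \<sim> x" "\<not> c \<sim> w" "x \<sim> w" "f ` jn d x = jn d x"
      have dxw: "d \<sim> x" "d \<sim> w" using h(1,2) unfolding dp_def by blast+
      have ne: "d \<noteq> x" "d \<noteq> w" using h(3,4) L by blast+
      note jx = jn[OF dxw(1) ne(1)] and jw = jn[OF dxw(2) ne(2)]
      show "f ` jn d w = jn d w"
      proof (cases "f w \<in> jn d w")
        case True
        have wP: "w \<in> P" using colP dxw by blast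
        have "f w \<noteq> d" using aut_inj[OF f(1) wP cP(2)] fd ne(2) by metis
        then show ?thesis using aut_jn[OF f(1) dxw(2) ne(2)] fd jn_eq[OF jw(1,2) True] by simp
      next
        case False
        have wP: "w \<in> P" using colP dxw by blast
        have wx: "w \<notin> jn d x" using False h(6) jn_eq[OF jx(1,2) _ ne(2)] by blast
        obtain \<pi> where \<pi>: "\<pi> \<in> planes \<Delta>" "d \<in> \<pi>" "x \<in> \<pi>" "w \<in> \<pi>"
          using plane_ex3[OF dxw(1) h(5) sym[OF dxw(2)] ne(1)] by blast
        have cn: "c \<notin> \<pi>" using plane_coll[OF \<pi>(1) _ \<pi>(3)] h(3) by blast
        \<comment> \<open>A pointwise fixed line of \<open>\<pi>\<close>. Together with the stable
          line \<open>d x\<close> it forces the image of \<open>w\<close> into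
          \<open>\<pi>\<close>.\<close>
        define M where "M = tr \<pi> c"
        have M: "M \<in> lines \<Delta>" "M \<subseteq> \<pi>" "d \<in> M" unfolding M_def
          using tr_line[OF \<pi>(1) cP(1) cn] tr_sub \<pi>(2) L(1) unfolding tr_def by blast+
        have Mf: "f y = y" "c \<sim> y" if "y \<in> M" for y
          using fixL[of y] that plane_coll[OF \<pi>(1,2)] unfolding M_def tr_def by blast+
        obtain a where a: "a \<in> M" "a \<noteq> d" using third[OF M(1)] by blast
        have ax: "a \<notin> jn d x" using perp_line[OF jx(1,2) _ a(2)[symmetric] L(1) _ jx(3)] Mf(2)[OF a(1)] h(3) by blast
        have fwx: "f w \<in> \<pi>"
        proof -
          have fx: "f x \<in> jn d x" using h(6) jx by blast
          have fxP: "f x \<in> \<pi>" using fx plane_jn[OF \<pi>(1-3) ne(1)] by blast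
          have xP: "x \<in> P" using colP dxw by blast
          have fxd: "d \<noteq> f x" using aut_inj[OF f(1) xP cP(2)] fd ne(1) by metis
          have jfx: "jn d (f x) = jn d x" using jn_eq[OF jx(1,2) fx fxd] .
          have aP: "a \<in> \<pi>" using a M by blast
          have apP: "a \<in> P" using plane_P[OF \<pi>(1) aP] .
          have "f w \<sim> d" using aut_coll[OF f(1) wP cP(2)] fd sym[OF dxw(2)] by simp
          moreover have "f w \<sim> f x" using aut_coll[OF f(1) wP xP] sym[OF h(5)] by simp
          moreover have "f w \<sim> a" using aut_coll[OF f(1) wP apP] Mf(1)[OF a(1)] plane_coll[OF \<pi>(1,4) aP] by simp
          ultimately show ?thesis using plane_max3[OF \<pi>(1,2) fxP aP fxd] ax jfx by simp
        qed
        have ww: "w \<noteq> f w" using False jw(3) by metis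
        \<comment> \<open>The line from \<open>w\<close> to its image contains a fixed point of
          \<open>M\<close>, so it is stable and meets the stable line \<open>d x\<close> in a fixed
          point \<open>a0\<close>. This is not \<open>d\<close>, because the line \<open>d w\<close>
          is moved, and so it is not collinear to \<open>c\<close>.\<close>
        define m where "m = jn w (f w)"
        have m: "m \<in> lines \<Delta>" "w \<in> m" "f w \<in> m" "m \<subseteq> \<pi>" unfolding m_def
          using jn[OF plane_coll[OF \<pi>(1,4) fwx] ww] plane_jn[OF \<pi>(1,4) fwx ww] by blast+
        obtain b where b: "b \<in> m" "b \<in> M" using plane_meet[OF \<pi>(1) m(1) M(1) m(4) M(2)] by blast
        obtain a0 where a0: "a0 \<in> m" "a0 \<in> jn d x"
          using plane_meet[OF \<pi>(1) m(1) jx(1) m(4)] plane_jn[OF \<pi>(1-3) ne(1)] by blast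
        have bw: "w \<noteq> b" using Mf(2)[OF b(2)] h(4) by blast
        have bP: "b \<in> P" using plane_P[OF \<pi>(1)] b M by blast
        have bfw: "f w \<noteq> b" using aut_inj[OF f(1) wP bP] Mf(1)[OF b(2)] bw by metis
        have "jn w b = m" using jn_eq[OF m(1,2) b(1) bw] .
        moreover have "jn (f w) b = m" using jn_eq[OF m(1,3) b(1) bfw] .
        ultimately have fm: "f ` m = m" using aut_jn[OF f(1) line_coll[OF m(1,2) b(1)] bw] Mf(1)[OF b(2)] by simp
        have "f a0 \<in> m" "f a0 \<in> jn d x" using fm h(6) a0 by blast+
        moreover have "m \<noteq> jn d x" using m(2) wx by blast
        ultimately have fa: "f a0 = a0" using line_meet_eq[OF m(1) jx(1) _ _ _ a0] by blast
        have a0P: "a0 \<in> P" using line_sub m(1) a0 by blast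
        have "a0 \<noteq> d"
        proof
          assume "a0 = d"
          then have "m = jn d w" using jn_eq[OF m(1) _ m(2) ne(2)] a0 by blast
          then show False using m(3) False by blast
        qed
        then have "\<not> c \<sim> a0" using perp_line[OF jx(1,2) a0(2) _ L(1) _ jx(3)] h(3) by blast
        then show ?thesis using nofix[OF a0P] fa by blast
      qed
    qed
    then show ?thesis using ft(3)[OF y] by simp
  qed
  have "f ` K = K" if K: "K \<in> lines \<Delta>" "d \<in> K" for K
  proof (cases "\<forall>y\<in>K. c \<sim> y")
    case True
    then have "f y = y" if "y \<in> K" for y using fixL line_coll[OF K that] that by blast
    then show ?thesis by simp
  next
    case False
    then obtain y where y: "y \<in> K" "\<not> c \<sim> y" by blast
    have "jn d y = K" using jn_eq[OF K y(1)] y(2) L by blast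
    then show ?thesis using stab[OF line_coll[OF K y(1)] y(2)] by simp
  qed
  then show ?thesis using f fK fixL by blast
qed

end

section \<open>Apartments and the Moufang property\<close>

lemma frame_indices_3: "card (frame_indices 3) = 6" "finite (frame_indices n)"
  unfolding frame_indices_def by simp_all

lemma frame_indices_uminus: "i \<in> frame_indices n \<Longrightarrow> - i \<in> frame_indices n"
  unfolding frame_indices_def by auto

lemma polar_frame_coll:
  "polar_frame \<Gamma> n f \<Longrightarrow> i \<in> frame_indices n \<Longrightarrow> j \<in> frame_indices n \<Longrightarrow> coll \<Gamma> (f i) (f j) \<longleftrightarrow> i + j \<noteq> 0"
  and polar_frame_point: "polar_frame \<Gamma> n f \<Longrightarrow> i \<in> frame_indices n \<Longrightarrow> f i \<in> points \<Gamma>"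
  unfolding polar_frame_def by blast+

lemma polar_frame_inj:
  assumes f: "polar_frame \<Gamma> n f"
  shows "inj_on f (frame_indices n)"
proof (rule inj_onI)
  fix i j assume ij: "i \<in> frame_indices n" "j \<in> frame_indices n" "f i = f j"
  note m = frame_indices_uminus[OF ij(1)]
  have "\<not> coll \<Gamma> (f (- i)) (f i)" using polar_frame_coll[OF f m ij(1)] by simp
  then have "\<not> coll \<Gamma> (f (- i)) (f j)" using ij by simp
  then show "i = j" using polar_frame_coll[OF f m ij(2)] by simp
qed

lemma geo_span_single:
  assumes "x \<in> points \<Gamma>" shows "geo_span \<Gamma> {x} = {x}"
proof -
  have "geo_subspace \<Gamma> {x}" unfolding geo_subspace_def using assms by blast
  then show ?thesis using geo_span_least[of \<Gamma> "{x}" "{x}"] geo_span_superset[of "{x}" \<Gamma>] by blast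
qed

lemma geo_span_empty: "geo_span \<Gamma> {} = {}"
proof -
  have "geo_subspace \<Gamma> {}" unfolding geo_subspace_def by blast
  then show ?thesis using geo_span_least[of \<Gamma> "{}" "{}"] by blast
qed

lemma singular_single: "x \<in> points \<Gamma> \<Longrightarrow> singular_subspace \<Gamma> {x}"
  unfolding singular_subspace_def geo_subspace_def using coll_refl[of x \<Gamma>] by auto

text \<open>An apartment depends only on the set of its frame points; in this form the action of a
  collineation on apartments is an image of that set (\<open>aut_apt\<close>).\<close>

definition apartment_on where "apartment_on \<Gamma> S = {U. singular_subspace \<Gamma> U \<and> (\<exists>B\<subseteq>S. U = geo_span \<Gamma> B)}"

lemma apartment_apt: "apartment \<Gamma> n f = apartment_on \<Gamma> (f ` frame_indices n)"
  unfolding apartment_def apartment_on_def ..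

lemma apartment_on_singleI: "x \<in> S \<Longrightarrow> x \<in> points \<Gamma> \<Longrightarrow> {x} \<in> apartment_on \<Gamma> S"
  unfolding apartment_on_def using singular_single geo_span_single by (metis (mono_tags, lifting) empty_subsetI insert_subset mem_Collect_eq)

text \<open>Allows frame points to be read off from an apartment as its one-point members.\<close>

lemma apartment_on_singleD:
  assumes "{x} \<in> apartment_on \<Gamma> S" shows "x \<in> S"
proof -
  obtain B where B: "B \<subseteq> S" "{x} = geo_span \<Gamma> B" using assms unfolding apartment_on_def by blast
  then have "B \<subseteq> {x}" using geo_span_superset[of B \<Gamma>] by simp
  moreover have "B \<noteq> {}" using B(2) geo_span_empty[of \<Gamma>] by (metis insert_not_empty)
  ultimately show ?thesis using B(1) by blast
qed

context thick_polar3
begin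

lemma geo_subspace_jn: "geo_subspace \<Delta> S \<longleftrightarrow> S \<subseteq> P \<and> (\<forall>x\<in>S. \<forall>y\<in>S. x \<sim> y \<and> x \<noteq> y \<longrightarrow> jn x y \<subseteq> S)"
proof
  assume S: "geo_subspace \<Delta> S"
  have "jn x y \<subseteq> S" if xy: "x \<in> S" "y \<in> S" "x \<sim> y" "x \<noteq> y" for x y
    using S jn[OF xy(3,4)] xy unfolding geo_subspace_def by blast
  then show "S \<subseteq> P \<and> (\<forall>x\<in>S. \<forall>y\<in>S. x \<sim> y \<and> x \<noteq> y \<longrightarrow> jn x y \<subseteq> S)"
    using S unfolding geo_subspace_def by blast
next
  assume S: "S \<subseteq> P \<and> (\<forall>x\<in>S. \<forall>y\<in>S. x \<sim> y \<and> x \<noteq> y \<longrightarrow> jn x y \<subseteq> S)"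
  have "l \<subseteq> S" if l: "l \<in> lines \<Delta>" "x \<in> l \<inter> S" "y \<in> l \<inter> S" "x \<noteq> y" for l x y
  proof -
    have xy: "x \<in> l" "y \<in> l" "x \<in> S" "y \<in> S" using l by blast+
    have "jn x y = l" using jn_eq[OF l(1) xy(1,2) l(4)] .
    then show ?thesis using S line_coll[OF l(1) xy(1,2)] xy(3,4) l(4) by blast
  qed
  then show "geo_subspace \<Delta> S" unfolding geo_subspace_def using S by blast
qed

lemma aut_subspace:
  assumes f: "aut f" and S: "geo_subspace \<Delta> S" shows "geo_subspace \<Delta> (f ` S)"
proof -
  have SP: "S \<subseteq> P" using S unfolding geo_subspace_def by blast
  have "jn (f x) (f y) \<subseteq> f ` S" if h: "x \<in> S" "y \<in> S" "f x \<sim> f y" "f x \<noteq> f y" for x y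
  proof -
    have xy: "x \<in> P" "y \<in> P" using h SP by blast+
    have c: "x \<sim> y" "x \<noteq> y" using aut_coll[OF f xy] h by auto
    have "jn x y \<subseteq> S" using S h c unfolding geo_subspace_jn by blast
    then show ?thesis using aut_jn[OF f c] by blast
  qed
  then show ?thesis unfolding geo_subspace_jn using SP aut_in[OF f] by blast
qed

lemma aut_preimage_subspace:
  assumes f: "aut f" and S: "geo_subspace \<Delta> S" shows "geo_subspace \<Delta> {x \<in> P. f x \<in> S}"
proof -
  have "z \<in> P \<and> f z \<in> S" if h: "x \<in> P" "y \<in> P" "f x \<in> S" "f y \<in> S" "x \<sim> y" "x \<noteq> y" "z \<in> jn x y" for x y z
  proof -
    have c: "f x \<sim> f y" "f x \<noteq> f y" using aut_coll[OF f h(1,2)] aut_inj[OF f h(1,2)] h by auto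
    then have "jn (f x) (f y) \<subseteq> S" using S h unfolding geo_subspace_jn by blast
    then show ?thesis using aut_jn[OF f h(5,6)] h(7) line_sub[OF jn(1)[OF h(5,6)]] by blast
  qed
  then show ?thesis unfolding geo_subspace_jn by blast
qed

lemma span_subspace: "B \<subseteq> P \<Longrightarrow> geo_subspace \<Delta> (geo_span \<Delta> B)"
  using geo_span_subspace line_sub by blast

lemma span_P: "B \<subseteq> P \<Longrightarrow> geo_span \<Delta> B \<subseteq> P"
  using span_subspace unfolding geo_subspace_def by blast

lemma aut_span:
  assumes f: "aut f" and B: "B \<subseteq> P" shows "f ` geo_span \<Delta> B = geo_span \<Delta> (f ` B)"
proof
  have fB: "f ` B \<subseteq> P" using B aut_in[OF f] by blast
  have "geo_span \<Delta> B \<subseteq> {x \<in> P. f x \<in> geo_span \<Delta> (f ` B)}"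
    using geo_span_least[OF aut_preimage_subspace[OF f span_subspace[OF fB]]] B geo_span_superset[of "f ` B" \<Delta>] by blast
  then show "f ` geo_span \<Delta> B \<subseteq> geo_span \<Delta> (f ` B)" by blast
  show "geo_span \<Delta> (f ` B) \<subseteq> f ` geo_span \<Delta> B"
    using geo_span_least[OF aut_subspace[OF f span_subspace[OF B]]] geo_span_superset[of B \<Delta>] by blast
qed

lemma aut_apt:
  assumes f: "aut f" and S: "S \<subseteq> P" shows "image f ` apartment_on \<Delta> S = apartment_on \<Delta> (f ` S)"
proof
  show "image f ` apartment_on \<Delta> S \<subseteq> apartment_on \<Delta> (f ` S)"
  proof (rule image_subsetI)
    fix U assume "U \<in> apartment_on \<Delta> S"
    then obtain B where B: "singular_subspace \<Delta> U" "B \<subseteq> S" "U = geo_span \<Delta> B" unfolding apartment_on_def by blast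
    have UP: "U \<subseteq> P" using B(1) unfolding singular_subspace_def geo_subspace_def by blast
    have "x \<sim> y" if "x \<in> f ` U" "y \<in> f ` U" for x y
      using that aut_coll[OF f] UP B(1) unfolding singular_subspace_def by blast
    then have "singular_subspace \<Delta> (f ` U)"
      using aut_subspace[OF f] B(1) unfolding singular_subspace_def by blast
    moreover have "f ` U = geo_span \<Delta> (f ` B)" using aut_span[OF f] B S by blast
    ultimately show "f ` U \<in> apartment_on \<Delta> (f ` S)" unfolding apartment_on_def using image_mono[OF B(2), of f] by blast
  qed
  show "apartment_on \<Delta> (f ` S) \<subseteq> image f ` apartment_on \<Delta> S"
  proof
    fix U' assume "U' \<in> apartment_on \<Delta> (f ` S)"
    then obtain B' where B': "singular_subspace \<Delta> U'" "B' \<subseteq> f ` S" "U' = geo_span \<Delta> B'" unfolding apartment_on_def by blast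
    then obtain B where B: "B \<subseteq> S" "B' = f ` B" by (meson subset_imageE)
    have BP: "B \<subseteq> P" using B S by blast
    have U: "U' = f ` geo_span \<Delta> B" using aut_span[OF f BP] B B' by simp
    have "x \<sim> y" if xy: "x \<in> geo_span \<Delta> B" "y \<in> geo_span \<Delta> B" for x y
    proof -
      have "f x \<sim> f y" using B'(1) U xy unfolding singular_subspace_def by blast
      then show ?thesis using aut_coll[OF f] span_P[OF BP] xy by blast
    qed
    then have "geo_span \<Delta> B \<in> apartment_on \<Delta> S" unfolding apartment_on_def singular_subspace_def using span_subspace[OF BP] B(1) by blast
    then show "U' \<in> image f ` apartment_on \<Delta> S" using U by blast
  qed
qed

text \<open>Apart from \<open>c\<close>, the points of \<open>S\<close> lie on lines through
  \<open>c\<close> that are contained in \<open>S\<close>.\<close>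

lemma stable_subspace:
  assumes S: "singular_subspace \<Delta> S" "c \<in> S" and f: "f c = c" "\<And>K. K \<in> lines \<Delta> \<Longrightarrow> c \<in> K \<Longrightarrow> f ` K = K"
  shows "f ` S = S"
proof -
  have j: "jn c x \<in> lines \<Delta>" "c \<in> jn c x" "x \<in> jn c x" "jn c x \<subseteq> S" if x: "x \<in> S" "x \<noteq> c" for x
  proof -
    have cx: "c \<sim> x" "c \<noteq> x" using S x unfolding singular_subspace_def by blast+
    show "jn c x \<in> lines \<Delta>" "c \<in> jn c x" "x \<in> jn c x" using jn[OF cx] by blast+
    show "jn c x \<subseteq> S" using S x cx unfolding singular_subspace_def geo_subspace_jn by blast
  qed
  have "f x \<in> S" if x: "x \<in> S" for x
    using f(1) f(2)[OF j(1,2)[OF x]] j(3,4)[OF x] S(2) by (cases "x = c") auto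
  moreover have "x \<in> f ` S" if x: "x \<in> S" for x
  proof (cases "x = c")
    case True then show ?thesis using S(2) f(1) by (metis image_eqI)
  next
    case False
    then show ?thesis using f(2)[OF j(1,2)[OF x False]] j(3,4)[OF x False] by blast
  qed
  ultimately show ?thesis by blast
qed

text \<open>A singular subspace containing a member of the interior contains a fixed point all of
  whose lines are stabilized; one contained in a member is fixed pointwise.\<close>

lemma root_elationI:
  assumes f: "aut f" and fxd: "\<And>U x. U \<in> \<alpha>i \<Longrightarrow> x \<in> U \<Longrightarrow> f x = x"
    and c: "\<And>U. U \<in> \<alpha>i \<Longrightarrow> \<exists>c\<in>U. \<forall>K\<in>lines \<Delta>. c \<in> K \<longrightarrow> f ` K = K"
  shows "root_elation_for \<Delta> \<alpha>i f"
  unfolding root_elation_for_def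
proof (intro conjI allI impI ballI)
  show "collineation \<Delta> f" using aut_collineation[OF f] .
  show "f x = x" if "U \<in> \<alpha>i" "x \<in> U" for U x using fxd[OF that] .
  fix S assume S: "singular_subspace \<Delta> S \<and> (\<exists>U\<in>\<alpha>i. U \<subseteq> S \<or> S \<subseteq> U)"
  then obtain U where U: "U \<in> \<alpha>i" "U \<subseteq> S \<or> S \<subseteq> U" by blast
  show "f ` S = S"
  proof (cases "U \<subseteq> S")
    case True
    obtain c where "c \<in> U" "\<forall>K\<in>lines \<Delta>. c \<in> K \<longrightarrow> f ` K = K" using c[OF U(1)] by blast
    then show ?thesis using stable_subspace[of S c f] S True fxd[OF U(1)] by blast
  next
    case False
    then have "\<And>x. x \<in> S \<Longrightarrow> f x = x" using U fxd by blast
    then show ?thesis by simp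
  qed
qed

section \<open>The Moufang property for roots of the first kind\<close>

lemma frame_completion_first:
  assumes h: "polar_frame \<Delta> 3 h" and S: "S \<subseteq> h ` frame_indices 3" "card S = 5" "c \<in> S" "\<And>x. x \<in> S \<Longrightarrow> c \<sim> x"
  shows "\<exists>a\<in>P. h ` frame_indices 3 = insert a S \<and> \<not> c \<sim> a \<and> (\<forall>x\<in>S. x \<noteq> c \<longrightarrow> a \<sim> x)"
proof -
  obtain m where m: "m \<in> frame_indices 3" "c = h m" using S by blast
  note m' = frame_indices_uminus[OF m(1)]
  define a where "a = h (- m)"
  have ca: "\<not> c \<sim> a" unfolding a_def m(2) using polar_frame_coll[OF h m(1) m'] by simp
  have "finite S" using S(2) by (simp add: card_ge_0_finite)
  then have "card (insert a S) = 6" using S ca by (simp add: card_insert_if) blast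
  moreover have "card (h ` frame_indices 3) = 6" using card_image[OF polar_frame_inj[OF h]] frame_indices_3 by simp
  moreover have "insert a S \<subseteq> h ` frame_indices 3" using S(1) m' a_def by blast
  ultimately have "h ` frame_indices 3 = insert a S" using card_subset_eq frame_indices_3(2) by (metis finite_imageI)
  moreover have "a \<sim> x" if x: "x \<in> S" "x \<noteq> c" for x
  proof -
    obtain j where j: "j \<in> frame_indices 3" "x = h j" using S(1) x by blast
    then show ?thesis unfolding a_def using polar_frame_coll[OF h m' j(1)] x(2) m(2) by auto
  qed
  ultimately show ?thesis using ca polar_frame_point[OF h m'] a_def by blast
qed

text \<open>All frame points except \<open>f i\<close> are one-point members of the root, so the two
  frames differ only in the point opposite \<open>c = f (- i)\<close>. The central collineation
  moving one missing point to the other fixes the common points: each is the foot of both missing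
  points on its line to \<open>c\<close>.\<close>

lemma moufang_first:
  assumes f: "polar_frame \<Delta> 3 f" and i: "i \<in> frame_indices 3"
    and \<alpha>: "\<alpha> = root_first (apartment \<Delta> 3 f) f i" "\<alpha>i = interior_first (apartment \<Delta> 3 f) f i"
    and A: "A \<in> apartments \<Delta> 3" "\<alpha> \<subseteq> A" and B: "B \<in> apartments \<Delta> 3" "\<alpha> \<subseteq> B"
  shows "\<exists>g. root_elation_for \<Delta> \<alpha>i g \<and> image g ` A = B"
proof -
  define S where "S = f ` (frame_indices 3 - {i})"
  define c where "c = f (- i)"
  note mi = frame_indices_uminus[OF i]
  have i0: "- i \<noteq> i" using i unfolding frame_indices_def by auto
  have SP: "S \<subseteq> P" using polar_frame_point[OF f] unfolding S_def by blast
  have cS: "c \<in> S" unfolding S_def c_def using mi i0 by blast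
  have "card S = card (frame_indices 3 - {i})" unfolding S_def
    using polar_frame_inj[OF f] by (intro card_image) (auto intro: inj_on_subset)
  then have S5: "card S = 5" using i frame_indices_3 by (simp add: card_Diff_singleton)
  have cx: "c \<sim> x" if "x \<in> S" for x
    using that polar_frame_coll[OF f mi] unfolding S_def c_def by fastforce
  have fiS: "f i \<notin> S" using polar_frame_inj[OF f] i unfolding S_def inj_on_def by blast
  have sub: "S \<subseteq> h ` frame_indices 3" if "\<alpha> \<subseteq> apartment \<Delta> 3 h" for h
  proof
    fix x assume x: "x \<in> S"
    then have "{x} \<in> apartment \<Delta> 3 f" unfolding apartment_apt using apartment_on_singleI[of x] SP unfolding S_def by blast
    moreover have "f i \<notin> {x}" using x fiS by blast
    ultimately have "{x} \<in> \<alpha>" unfolding \<alpha> root_first_def by blast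
    then show "x \<in> h ` frame_indices 3" 
      using apartment_on_singleD[of x \<Delta> "h ` frame_indices 3"] subsetD[OF that[unfolded apartment_apt]] by blast
  qed
  obtain h1 where h1: "polar_frame \<Delta> 3 h1" "A = apartment \<Delta> 3 h1" using A unfolding apartments_def by blast
  obtain h2 where h2: "polar_frame \<Delta> 3 h2" "B = apartment \<Delta> 3 h2" using B unfolding apartments_def by blast
  obtain a where a: "a \<in> P" "h1 ` frame_indices 3 = insert a S" "\<not> c \<sim> a" "\<And>x. x \<in> S \<Longrightarrow> x \<noteq> c \<Longrightarrow> a \<sim> x"
    using frame_completion_first[OF h1(1) sub S5 cS cx] A(2) h1(2) by blast
  obtain b where b: "b \<in> P" "h2 ` frame_indices 3 = insert b S" "\<not> c \<sim> b" "\<And>x. x \<in> S \<Longrightarrow> x \<noteq> c \<Longrightarrow> b \<sim> x"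
    using frame_completion_first[OF h2(1) sub S5 cS cx] B(2) h2(2) by blast
  have cP: "c \<in> P" using cS SP by blast
  obtain g where g: "aut g" "g c = c" "g a = b" and g': "\<forall>K\<in>lines \<Delta>. c \<in> K \<longrightarrow> g ` K = K"
    "\<forall>x. c \<sim> x \<and> c \<noteq> x \<and> pr a (jn c x) = pr b (jn c x) \<longrightarrow> g x = x"
    "\<forall>K\<in>lines \<Delta>. \<forall>x\<in>K. \<forall>y\<in>K. c \<in> K \<and> x \<noteq> c \<and> g x = x \<longrightarrow> g y = y"
    using central_collineation[OF cP a(1,3) b(1,3)] by (elim exE conjE)
  have gS: "g x = x" if x: "x \<in> S" for x
  proof (cases "x = c")
    case False
    note K = jn[OF cx[OF x] False[symmetric]]
    have "\<not> a \<sim> c" "\<not> b \<sim> c" using a b sym by blast+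
    then have "pr a (jn c x) = x" "pr b (jn c x) = x"
      using pr_eq[OF K(1,2) _ K(3)] a(4)[OF x False] b(4)[OF x False] by blast+
    then show ?thesis using g'(2) cx[OF x] False by simp
  qed (simp add: g)
  then have gSS: "g ` S = S" by simp
  have AB: "image g ` A = B" unfolding h1(2) h2(2) apartment_apt a(2) b(2)
    using aut_apt[OF g(1), of "insert a S"] a(1) SP g(3) gSS by simp
  \<comment> \<open>Interior members are spanned by fixed frame points, so it suffices that the
    fixed points of the cone form a subspace. On a line \<open>x y\<close> missing \<open>c\<close>,
    a point \<open>z\<close> is fixed as the meeting point of the stable lines \<open>x y\<close>
    and \<open>c z\<close>.\<close>
  define X where "X = {x. c \<sim> x \<and> g x = x}"
  have XP: "X \<subseteq> P" unfolding X_def using colP by blast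
  have "jn x y \<subseteq> X" if h: "x \<in> X" "y \<in> X" "x \<sim> y" "x \<noteq> y" for x y
  proof
    fix z assume z: "z \<in> jn x y"
    note l = jn[OF h(3,4)]
    have xy: "c \<sim> x" "c \<sim> y" "g x = x" "g y = y" using h unfolding X_def by blast+
    have cz: "c \<sim> z" using perp_jn[OF h(3,4) xy(1,2) z] .
    have "g z = z"
    proof (cases "c \<in> jn x y")
      case True
      then show ?thesis using g'(3) l xy z h(4) by metis
    next
      case False
      have "g ` jn x y = jn x y" using aut_jn[OF g(1) h(3,4)] xy by simp
      then have gz: "g z \<in> jn x y" using z by blast
      have zc: "c \<noteq> z" using False z by blast
      note m = jn[OF cz zc]
      have "g z \<in> jn c z" using g'(1) m by blast
      moreover have "jn x y \<noteq> jn c z" using False m by blast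
      ultimately show ?thesis using line_meet_eq[OF l(1) m(1) _ gz _ z m(3)] by blast
    qed
    then show "z \<in> X" unfolding X_def using cz by blast
  qed
  then have X: "geo_subspace \<Delta> X" unfolding geo_subspace_jn using XP by blast
  have "root_elation_for \<Delta> \<alpha>i g"
  proof (rule root_elationI[OF g(1)])
    fix U assume U: "U \<in> \<alpha>i"
    then have cU: "c \<in> U" and "U \<in> apartment_on \<Delta> (f ` frame_indices 3)"
      unfolding \<alpha> interior_first_def c_def apartment_apt by blast+
    then obtain E where E: "singular_subspace \<Delta> U" "E \<subseteq> f ` frame_indices 3" "U = geo_span \<Delta> E" unfolding apartment_on_def by blast
    have EU: "E \<subseteq> U" using geo_span_superset[of E \<Delta>] E(3) by blast
    have "\<not> c \<sim> f i" unfolding c_def using polar_frame_coll[OF f mi i] by simp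
    then have "f i \<notin> E" using EU E(1) cU unfolding singular_subspace_def by blast
    then have "E \<subseteq> S" using E(2) unfolding S_def by blast
    then have "E \<subseteq> X" using gS cx unfolding X_def by blast
    then have "U \<subseteq> X" using geo_span_least[OF X] E(3) by simp
    then show "g x = x" if "x \<in> U" for x using that unfolding X_def by blast
    show "\<exists>c\<in>U. \<forall>K\<in>lines \<Delta>. c \<in> K \<longrightarrow> g ` K = K" using cU g'(1) by blast
  qed
  then show ?thesis using AB by blast
qed

section \<open>The Moufang property for roots of the second kind\<close>

lemma span_jn:
  assumes "x \<sim> y" "x \<noteq> y" shows "geo_span \<Delta> {x, y} = jn x y" "singular_subspace \<Delta> (jn x y)"
proof -
  note j = jn[OF assms]
  have s: "geo_subspace \<Delta> (jn x y)" unfolding geo_subspace_jn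
    using jn_eq[OF j(1)] line_sub[OF j(1)] by blast
  then show "singular_subspace \<Delta> (jn x y)" unfolding singular_subspace_def using line_coll[OF j(1)] by blast
  have "{x, y} \<subseteq> P" using colP assms by blast
  then have "geo_subspace \<Delta> (geo_span \<Delta> {x, y})" by (rule span_subspace)
  then have "jn x y \<subseteq> geo_span \<Delta> {x, y}" unfolding geo_subspace_jn using geo_span_superset[of "{x, y}" \<Delta>] assms by blast
  then show "geo_span \<Delta> {x, y} = jn x y" using geo_span_least[OF s, of "{x, y}"] j by blast
qed

text \<open>The missing points are the opposites of \<open>c\<close> and \<open>d\<close> in the
  frame; a count up to six shows that nothing else is missing.\<close>

lemma frame_completion_second:
  assumes h: "polar_frame \<Delta> 3 h" and S: "S \<subseteq> h ` frame_indices 3" "card S = 4" "c \<in> S" "d \<in> S" "c \<noteq> d"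
    "\<And>x. x \<in> S \<Longrightarrow> c \<sim> x" "\<And>x. x \<in> S \<Longrightarrow> d \<sim> x"
  shows "\<exists>a\<in>P. \<exists>b\<in>P. h ` frame_indices 3 = insert a (insert b S) \<and> \<not> c \<sim> a \<and> \<not> d \<sim> b \<and> a \<sim> b"
proof -
  obtain m where m: "m \<in> frame_indices 3" "c = h m" using S by blast
  obtain n where n: "n \<in> frame_indices 3" "d = h n" using S by blast
  note m' = frame_indices_uminus[OF m(1)] and n' = frame_indices_uminus[OF n(1)]
  define a where "a = h (- m)"
  define b where "b = h (- n)"
  have ca: "\<not> c \<sim> a" unfolding a_def m(2) using polar_frame_coll[OF h m(1) m'] by simp
  have db: "\<not> d \<sim> b" unfolding b_def n(2) using polar_frame_coll[OF h n(1) n'] by simp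
  have mn: "m \<noteq> n" "m + n \<noteq> 0" using S(5) S(6)[OF S(4)] m n polar_frame_coll[OF h m(1) n(1)] by auto
  have ab: "a \<sim> b" unfolding a_def b_def using polar_frame_coll[OF h m' n'] mn by simp
  have nab: "a \<noteq> b" using inj_onD[OF polar_frame_inj[OF h] _ m' n'] mn(1) unfolding a_def b_def by auto
  have nS: "a \<notin> S" "b \<notin> S" using S(6,7) ca db by blast+
  have "finite S" using S(2) by (simp add: card_ge_0_finite)
  then have "card (insert a (insert b S)) = 6" using S(2) nS nab by simp
  moreover have "card (h ` frame_indices 3) = 6" using card_image[OF polar_frame_inj[OF h]] frame_indices_3 by simp
  moreover have "insert a (insert b S) \<subseteq> h ` frame_indices 3" using S(1) m' n' a_def b_def by blast
  ultimately have "h ` frame_indices 3 = insert a (insert b S)" using card_subset_eq frame_indices_3(2) by (metis finite_imageI)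
  then show ?thesis using ca db ab polar_frame_point[OF h m'] polar_frame_point[OF h n'] unfolding a_def b_def by blast
qed

text \<open>Besides the four common frame points the root contains the lines on \<open>f i\<close>,
  \<open>f (- j)\<close> and on \<open>f j\<close>, \<open>f (- i)\<close>, which confine the two
  missing points. The axial collineation for \<open>c\<close> and \<open>d\<close> moves
  \<open>a\<close> to \<open>a'\<close>, and \<open>b\<close> has to follow: its image stays on a
  stable line and is collinear to \<open>a'\<close>.\<close>

lemma moufang_second:
  assumes f: "polar_frame \<Delta> 3 f" and i: "i \<in> frame_indices 3" and j: "j \<in> frame_indices 3"
    and ij: "f i \<noteq> f j" "f i \<sim> f j"
    and \<alpha>: "\<alpha> = root_second (apartment \<Delta> 3 f) f i j" "\<alpha>i = interior_second (apartment \<Delta> 3 f) f i j"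
    and A: "A \<in> apartments \<Delta> 3" "\<alpha> \<subseteq> A" and B: "B \<in> apartments \<Delta> 3" "\<alpha> \<subseteq> B"
  shows "\<exists>g. root_elation_for \<Delta> \<alpha>i g \<and> image g ` A = B"
proof -
  define S where "S = f ` (frame_indices 3 - {i, j})"
  define c where "c = f (- i)"
  define d where "d = f (- j)"
  note mi = frame_indices_uminus[OF i] and mj = frame_indices_uminus[OF j]
  have nij: "i \<noteq> j" "i + j \<noteq> 0" using ij polar_frame_coll[OF f i j] by auto
  have i0: "- i \<noteq> i" "- j \<noteq> j" "- i \<noteq> j" "- j \<noteq> i" using i j nij unfolding frame_indices_def by auto
  have inj: "inj_on f (frame_indices 3)" using polar_frame_inj[OF f] .
  have SP: "S \<subseteq> P" using polar_frame_point[OF f] unfolding S_def by blast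
  have cS: "c \<in> S" "d \<in> S" unfolding S_def c_def d_def using mi mj i0 by blast+
  have cd: "c \<noteq> d" using inj_onD[OF inj _ mi mj] nij unfolding c_def d_def by auto
  have "card S = card (frame_indices 3 - {i, j})" unfolding S_def
    using inj by (intro card_image) (auto intro: inj_on_subset)
  also have "\<dots> = 4" using i j nij frame_indices_3 by (simp add: card_Diff_subset)
  finally have S4: "card S = 4" .
  have cx: "c \<sim> x" if "x \<in> S" for x
    using that polar_frame_coll[OF f mi] unfolding S_def c_def by fastforce
  have dx: "d \<sim> x" if "x \<in> S" for x
    using that polar_frame_coll[OF f mj] unfolding S_def d_def by fastforce
  have nS: "f i \<notin> S" "f j \<notin> S" using inj i j unfolding S_def inj_on_def by blast+
  have ci: "\<not> c \<sim> f i" "\<not> d \<sim> f j" unfolding c_def d_def using polar_frame_coll[OF f mi i] polar_frame_coll[OF f mj j] by simp_all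
  have cj: "f j \<sim> c" "f i \<sim> d" unfolding c_def d_def using polar_frame_coll[OF f j mi] polar_frame_coll[OF f i mj] nij by simp_all
  have ne: "f j \<noteq> c" "f i \<noteq> d" using nS cS by blast+
  have sub: "S \<subseteq> h ` frame_indices 3" if "\<alpha> \<subseteq> apartment \<Delta> 3 h" for h
  proof
    fix x assume x: "x \<in> S"
    then have "{x} \<in> apartment \<Delta> 3 f" unfolding apartment_apt using apartment_on_singleI[of x] SP unfolding S_def by blast
    moreover have "f i \<notin> {x}" "f j \<notin> {x}" using x nS by blast+
    ultimately have "{x} \<in> \<alpha>" unfolding \<alpha> root_second_def by blast
    then show "x \<in> h ` frame_indices 3" 
      using apartment_on_singleD[of x \<Delta> "h ` frame_indices 3"] subsetD[OF that[unfolded apartment_apt]] by blast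
  qed
  \<comment> \<open>A maximal member containing \<open>f i\<close>, \<open>f j\<close> and this line
    would contain the non-collinear points \<open>f v\<close> and \<open>f (- v)\<close>.\<close>
  have inroot: "jn (f u) (f (- v)) \<in> \<alpha>" if uv: "u = i \<and> v = j \<or> u = j \<and> v = i" for u v
  proof -
    have u: "u \<in> frame_indices 3" "v \<in> frame_indices 3" "- v \<in> frame_indices 3" "f u \<sim> f (- v)" "f u \<noteq> f (- v)" "\<not> f (- v) \<sim> f v"
      using uv i j mi mj cj ne ci unfolding c_def d_def by blast+
    note sj = span_jn[OF u(4,5)] and jj = jn[OF u(4,5)]
    have "jn (f u) (f (- v)) \<in> apartment \<Delta> 3 f" unfolding apartment_def using sj u(1,3)
      by (auto intro!: exI[of _ "{f u, f (- v)}"])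
    moreover have False if M: "M \<in> maximal_members (apartment \<Delta> 3 f)" "f i \<in> M" "f j \<in> M" "jn (f u) (f (- v)) \<subseteq> M" for M
    proof -
      have "singular_subspace \<Delta> M" using M(1) unfolding maximal_members_def apartment_def by blast
      then have "f (- v) \<sim> f v" using M(2-4) jj(3) uv unfolding singular_subspace_def by blast
      then show False using u(6) by blast
    qed
    ultimately show ?thesis unfolding \<alpha> root_second_def by blast
  qed
  \<comment> \<open>The line is spanned by points of the other frame, not only by
    \<open>f (- v)\<close>. A further generator is not \<open>b\<close>, which is not collinear to
    \<open>f (- v)\<close>, and not in \<open>S\<close>, since its opposite would be collinear to
    it. So it is \<open>a\<close>.\<close>
  have on: "a \<in> jn (f u) (f (- v))"
    if uv: "u = i \<and> v = j \<or> u = j \<and> v = i" and T: "jn (f u) (f (- v)) \<in> apartment_on \<Delta> (insert a (insert b S))" and b: "\<not> f (- v) \<sim> b" for u v a b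
  proof -
    have u: "u \<in> frame_indices 3" "- v \<in> frame_indices 3" "f u \<sim> f (- v)" "f u \<noteq> f (- v)"
      using uv i j mi mj cj ne unfolding c_def d_def by blast+
    note jj = jn[OF u(3,4)]
    obtain E where E: "E \<subseteq> insert a (insert b S)" "jn (f u) (f (- v)) = geo_span \<Delta> E" using T unfolding apartment_on_def by blast
    have EU: "E \<subseteq> jn (f u) (f (- v))" using geo_span_superset[of E \<Delta>] E(2) by blast
    have "\<not> E \<subseteq> {f (- v)}"
    proof
      assume "E \<subseteq> {f (- v)}"
      moreover have "geo_subspace \<Delta> {f (- v)}"
        using singular_single[OF polar_frame_point[OF f u(2)]] unfolding singular_subspace_def by blast
      ultimately have "jn (f u) (f (- v)) \<subseteq> {f (- v)}" using geo_span_least E(2) by simp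
      then show False using jj(2) u(4) by blast
    qed
    then obtain x where x: "x \<in> E" "x \<noteq> f (- v)" by blast
    have xl: "x \<in> jn (f u) (f (- v))" using x EU by blast
    have "x \<noteq> b" using line_coll[OF jj(1,3) xl] b by blast
    moreover have "x \<notin> S"
    proof
      assume "x \<in> S"
      then obtain n where n: "n \<in> frame_indices 3" "n \<noteq> i" "n \<noteq> j" "x = f n" unfolding S_def by blast
      note n' = frame_indices_uminus[OF n(1)]
      have "n \<noteq> - v" "n \<noteq> u" using n x(2) uv by auto
      then have "f (- n) \<sim> f u" "f (- n) \<sim> f (- v)"
        using polar_frame_coll[OF f n' u(1)] polar_frame_coll[OF f n' u(2)] by auto
      then have "f (- n) \<sim> f n" using perp_jn[OF u(3,4) _ _ xl] n(4) by blast
      then show False using polar_frame_coll[OF f n' n(1)] by simp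
    qed
    ultimately have "x = a" using x E(1) by blast
    then show ?thesis using xl by simp
  qed
  have comp: "\<exists>a b. a \<in> P \<and> b \<in> P \<and> h ` frame_indices 3 = insert a (insert b S) \<and> \<not> c \<sim> a \<and> \<not> d \<sim> b \<and> a \<sim> b \<and>
    a \<in> jn (f i) d \<and> b \<in> jn (f j) c" if h: "polar_frame \<Delta> 3 h" "\<alpha> \<subseteq> apartment \<Delta> 3 h" for h
  proof -
    obtain a b where ab: "a \<in> P" "b \<in> P" "h ` frame_indices 3 = insert a (insert b S)" "\<not> c \<sim> a" "\<not> d \<sim> b" "a \<sim> b"
      using frame_completion_second[OF h(1) sub[OF h(2)] S4 cS cd cx dx] by blast
    have T: "jn (f i) d \<in> apartment_on \<Delta> (insert a (insert b S))" "jn (f j) c \<in> apartment_on \<Delta> (insert b (insert a S))"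
      using inroot[of i j] inroot[of j i] h(2) unfolding apartment_apt ab(3) c_def d_def by (auto simp: insert_commute)
    have "a \<in> jn (f i) d" using on[of i j a b] T(1) ab(5) unfolding d_def by blast
    moreover have "b \<in> jn (f j) c" using on[of j i b a] T(2) ab(4) unfolding c_def by blast
    ultimately show ?thesis using ab by blast
  qed
  obtain h1 where h1: "polar_frame \<Delta> 3 h1" "A = apartment \<Delta> 3 h1" using A unfolding apartments_def by blast
  obtain h2 where h2: "polar_frame \<Delta> 3 h2" "B = apartment \<Delta> 3 h2" using B unfolding apartments_def by blast
  obtain a b where ab: "a \<in> P" "b \<in> P" "h1 ` frame_indices 3 = insert a (insert b S)" "\<not> c \<sim> a" "\<not> d \<sim> b" "a \<sim> b"
    "a \<in> jn (f i) d" "b \<in> jn (f j) c"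
    using comp[OF h1(1)] A(2) h1(2) by blast
  obtain a' b' where ab': "a' \<in> P" "b' \<in> P" "h2 ` frame_indices 3 = insert a' (insert b' S)" "\<not> c \<sim> a'" "\<not> d \<sim> b'" "a' \<sim> b'"
    "a' \<in> jn (f i) d" "b' \<in> jn (f j) c"
    using comp[OF h2(1)] B(2) h2(2) by blast
  note Y = jn[OF cj(2) ne(2)] and Z = jn[OF cj(1) ne(1)]
  have da: "d \<sim> a" using line_coll[OF Y(1,3) ab(7)] .
  have ad: "d \<noteq> a" "a' \<noteq> d" using ab(4) ab'(4) cx[OF cS(2)] by blast+
  have Ya: "jn d a = jn (f i) d" using jn_eq[OF Y(1,3) ab(7) ad(1)] .
  obtain g where g: "aut g" "g a = a'" and g': "\<forall>x. c \<sim> x \<and> d \<sim> x \<longrightarrow> g x = x"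
    "\<forall>K\<in>lines \<Delta>. c \<in> K \<or> d \<in> K \<longrightarrow> g ` K = K"
    using axial_collineation[OF cx[OF cS(2)] cd da ab(4) _ ad(2)] ab'(7) Ya by auto
  have gS: "g x = x" if "x \<in> S" for x using g'(1) cx[OF that] dx[OF that] by blast
  then have gSS: "g ` S = S" by simp
  have gb: "g b = b'"
  proof -
    have "g b \<in> jn (f j) c" using g'(2) Z ab(8) by blast
    moreover have "a' \<sim> g b" using aut_coll[OF g(1) ab(1,2)] ab(6) g(2) by simp
    moreover have "\<not> a' \<sim> c" using ab'(4) sym by blast
    ultimately show ?thesis using pr_eq[OF Z(1,3)] ab'(6,8) by metis
  qed
  have AB: "image g ` A = B" unfolding h1(2) h2(2) apartment_apt ab(3) ab'(3)
    using aut_apt[OF g(1), of "insert a (insert b S)"] ab(1,2) SP g(2) gb gSS by simp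
  define X where "X = dp c d"
  have X: "geo_subspace \<Delta> X" unfolding geo_subspace_jn X_def using dp_jn colP unfolding dp_def by blast
  have "root_elation_for \<Delta> \<alpha>i g"
  proof (rule root_elationI[OF g(1)])
    fix U assume U: "U \<in> \<alpha>i"
    then have cU: "c \<in> U \<or> d \<in> U" and nU: "f i \<notin> U" "f j \<notin> U" and "U \<in> apartment_on \<Delta> (f ` frame_indices 3)"
      unfolding \<alpha> interior_second_def c_def d_def apartment_apt by blast+
    then obtain E where E: "E \<subseteq> f ` frame_indices 3" "U = geo_span \<Delta> E" unfolding apartment_on_def by blast
    have "E \<subseteq> U" using geo_span_superset[of E \<Delta>] E(2) by blast
    then have "E \<subseteq> S" using E(1) nU unfolding S_def by blast
    then have "E \<subseteq> X" using cx dx unfolding X_def dp_def by blast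
    then have "U \<subseteq> X" using geo_span_least[OF X] E(2) by simp
    then show "g x = x" if "x \<in> U" for x using that g'(1) unfolding X_def dp_def by blast
    show "\<exists>c\<in>U. \<forall>K\<in>lines \<Delta>. c \<in> K \<longrightarrow> g ` K = K" using cU g'(2) by blast
  qed
  then show ?thesis using AB by blast
qed

theorem moufang: "moufang \<Delta> 3"
  unfolding moufang_def
proof (intro allI impI ballI)
  fix \<alpha> \<alpha>i A B
  assume r: "polar_root \<Delta> 3 \<alpha> \<alpha>i" and A: "A \<in> apartments \<Delta> 3" and B: "B \<in> apartments \<Delta> 3" and AB: "\<alpha> \<subseteq> A \<and> \<alpha> \<subseteq> B"
  obtain f where f: "polar_frame \<Delta> 3 f" and c: "(\<exists>i\<in>frame_indices 3.
         \<alpha> = root_first (apartment \<Delta> 3 f) f i \<and> \<alpha>i = interior_first (apartment \<Delta> 3 f) f i) \<or>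
      (\<exists>i\<in>frame_indices 3. \<exists>j\<in>frame_indices 3. f i \<noteq> f j \<and> coll \<Delta> (f i) (f j) \<and>
         \<alpha> = root_second (apartment \<Delta> 3 f) f i j \<and> \<alpha>i = interior_second (apartment \<Delta> 3 f) f i j)"
    using r unfolding polar_root_def by (elim exE conjE)
  from c show "\<exists>g. root_elation_for \<Delta> \<alpha>i g \<and> image g ` A = B"
  proof (elim disjE bexE conjE)
    fix i assume "i \<in> frame_indices 3" "\<alpha> = root_first (apartment \<Delta> 3 f) f i" "\<alpha>i = interior_first (apartment \<Delta> 3 f) f i"
    then show ?thesis using moufang_first[OF f _ _ _ A _ B] AB by blast
  next
    fix i j assume "i \<in> frame_indices 3" "j \<in> frame_indices 3" "f i \<noteq> f j" "f i \<sim> f j"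
      "\<alpha> = root_second (apartment \<Delta> 3 f) f i j" "\<alpha>i = interior_second (apartment \<Delta> 3 f) f i j"
    then show ?thesis using moufang_second[OF f _ _ _ _ _ _ A _ B] AB by blast
  qed
qed

end

section \<open>Rigidity in generalized quadrangles\<close>

locale thick_gq =
  fixes \<Gamma> :: "'b geometry"
  assumes gline_sub: "l \<in> lines \<Gamma> \<Longrightarrow> l \<subseteq> points \<Gamma>"
    and gline_unique: "l \<in> lines \<Gamma> \<Longrightarrow> m \<in> lines \<Gamma> \<Longrightarrow> x \<in> l \<Longrightarrow> y \<in> l \<Longrightarrow> x \<in> m \<Longrightarrow> y \<in> m \<Longrightarrow> x \<noteq> y \<Longrightarrow> l = m"
    and gproj: "x \<in> points \<Gamma> \<Longrightarrow> l \<in> lines \<Gamma> \<Longrightarrow> x \<notin> l \<Longrightarrow> \<exists>!y. y \<in> l \<and> coll \<Gamma> x y"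
    and gthird: "l \<in> lines \<Gamma> \<Longrightarrow> \<exists>z\<in>l. z \<noteq> a \<and> z \<noteq> b"
    and gthick: "x \<in> points \<Gamma> \<Longrightarrow> \<exists>m\<in>lines \<Gamma>. x \<in> m \<and> m \<noteq> k \<and> m \<noteq> k'"
begin

abbreviation gcol (infix "\<sim>" 50) where "x \<sim> y \<equiv> coll \<Gamma> x y"

lemma gsym: "x \<sim> y \<Longrightarrow> y \<sim> x"
  by (rule coll_sym)

lemma gline_coll: "l \<in> lines \<Gamma> \<Longrightarrow> x \<in> l \<Longrightarrow> y \<in> l \<Longrightarrow> x \<sim> y"
  using gline_sub unfolding coll_def by blast

lemma gline_ex: "x \<sim> y \<Longrightarrow> x \<noteq> y \<Longrightarrow> \<exists>l\<in>lines \<Gamma>. x \<in> l \<and> y \<in> l"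
  unfolding coll_def by blast

lemma gP: "x \<sim> y \<Longrightarrow> x \<in> points \<Gamma>" "x \<sim> y \<Longrightarrow> y \<in> points \<Gamma>"
  by (auto dest: coll_points)

lemma gproj_unique:
  assumes "l \<in> lines \<Gamma>" "x \<notin> l" "y \<in> l" "z \<in> l" "x \<sim> y" "x \<sim> z" shows "y = z"
  using gproj[OF gP(1)[OF assms(5)] assms(1,2)] assms(3-6) by blast

lemma gproj_ex:
  assumes "x \<in> points \<Gamma>" "l \<in> lines \<Gamma>" shows "\<exists>y\<in>l. x \<sim> y"
  using gproj[OF assms] coll_refl[OF assms(1)] by (cases "x \<in> l") blast+

lemma gmeet: "l \<in> lines \<Gamma> \<Longrightarrow> m \<in> lines \<Gamma> \<Longrightarrow> l \<noteq> m \<Longrightarrow> x \<in> l \<Longrightarrow> x \<in> m \<Longrightarrow> y \<in> l \<Longrightarrow> y \<in> m \<Longrightarrow> x = y"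
  using gline_unique by blast

text \<open>Inclusion instead of equality, because the maps \<open>h\<close> below are only known to
  preserve points and collinearity.\<close>

definition stable where "stable h l \<longleftrightarrow> (\<forall>x\<in>l. h x \<in> l)"

context
  fixes h
  assumes hP: "\<And>x. x \<in> points \<Gamma> \<Longrightarrow> h x \<in> points \<Gamma>" and hc: "\<And>x y. x \<sim> y \<Longrightarrow> h x \<sim> h y"
begin

lemma fix_proj:
  assumes "l \<in> lines \<Gamma>" "stable h l" "h z = z" "z \<notin> l" "y \<in> l" "z \<sim> y"
  shows "h y = y"
proof -
  have "z \<sim> h y" using hc[OF assms(6)] assms(3) by simp
  moreover have "h y \<in> l" using assms unfolding stable_def by blast
  ultimately show ?thesis using gproj_unique[OF assms(1,4) _ assms(5) _ assms(6)] by blast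
qed

lemma stable_two:
  assumes "l \<in> lines \<Gamma>" "x \<in> l" "y \<in> l" "x \<noteq> y" "h x = x" "h y = y"
  shows "stable h l"
  unfolding stable_def
proof (rule ballI, rule ccontr)
  fix z assume z: "z \<in> l" "h z \<notin> l"
  have "h z \<sim> x" using hc[OF gline_coll[OF assms(1) z(1) assms(2)]] assms(5) by simp
  moreover have "h z \<sim> y" using hc[OF gline_coll[OF assms(1) z(1) assms(3)]] assms(6) by simp
  ultimately show False using gproj_unique[OF assms(1) z(2) assms(2,3)] assms(4) by blast
qed

lemma fix_meet:
  assumes "l \<in> lines \<Gamma>" "m \<in> lines \<Gamma>" "l \<noteq> m" "stable h l" "stable h m" "x \<in> l" "x \<in> m"
  shows "h x = x"
  using gmeet[OF assms(1-3) _ _ assms(6,7), of "h x"] assms unfolding stable_def by blast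

text \<open>The line \<open>l\<close> through \<open>z\<close> meets some line through
  \<open>x\<close> in the projection of \<open>z\<close>. That projection is fixed, so
  \<open>l\<close> has two fixed points.\<close>

lemma stable_transfer:
  assumes x: "h x = x" "\<And>l. l \<in> lines \<Gamma> \<Longrightarrow> x \<in> l \<Longrightarrow> stable h l" "x \<in> points \<Gamma>" and z: "h z = z" "\<not> x \<sim> z"
    and l: "l \<in> lines \<Gamma>" "z \<in> l"
  shows "stable h l"
proof -
  have xl: "x \<notin> l" using gline_coll[OF l(1) _ l(2)] z(2) by blast
  obtain y where y: "y \<in> l" "x \<sim> y" using gproj_ex[OF x(3) l(1)] by blast
  obtain m where m: "m \<in> lines \<Gamma>" "x \<in> m" "y \<in> m" using gline_ex[OF y(2)] xl y(1) by blast
  have zm: "z \<notin> m" using gline_coll[OF m(1,2)] z(2) by blast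
  have "h y = y" using fix_proj[OF m(1) x(2)[OF m(1,2)] z(1) zm m(3) gline_coll[OF l(1,2) y(1)]] .
  then show ?thesis using stable_two[OF l(1) y(1) l(2)] z(1) zm m(3) by blast
qed

text \<open>Fixed points spread by projection onto stable lines: from \<open>Q\<close> to the point
  \<open>a'\<close> of \<open>A\<close>, from \<open>N\<close> to the points of the line
  \<open>M\<close> on \<open>Q\<close> and \<open>a'\<close>, and from \<open>M\<close> to the
  points of every further line through \<open>a\<close>.\<close>

lemma rigid_aux:
  assumes N: "N \<in> lines \<Gamma>" "a \<in> N" "b \<in> N" "a \<noteq> b" "\<And>x. x \<in> N \<Longrightarrow> h x = x"
    and a: "\<And>l. l \<in> lines \<Gamma> \<Longrightarrow> a \<in> l \<Longrightarrow> stable h l"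
    and Q: "h Q = Q" "Q \<sim> b" "\<not> Q \<sim> a"
    and A: "A \<in> lines \<Gamma>" "a \<in> A" "A \<noteq> N"
  shows "\<exists>a'\<in>A. h a' = a' \<and> a' \<sim> a \<and> \<not> a' \<sim> b \<and> (\<forall>R\<in>lines \<Gamma>. a \<in> R \<and> R \<noteq> N \<and> R \<noteq> A \<longrightarrow> (\<forall>x\<in>R. h x = x))"
proof -
  have QP: "Q \<in> points \<Gamma>" using gP Q(2) by blast
  have QA: "Q \<notin> A" using gline_coll[OF A(1) _ A(2)] Q(3) by blast
  have QN: "Q \<notin> N" using gline_coll[OF N(1) _ N(2)] Q(3) by blast
  obtain a' where a': "a' \<in> A" "Q \<sim> a'" using gproj_ex[OF QP A(1)] by blast
  have aa: "a' \<noteq> a" using a'(2) Q(3) by blast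
  have ca: "a' \<sim> a" using gline_coll[OF A(1) a'(1) A(2)] .
  have a'N: "a' \<notin> N" using gmeet[OF A(1) N(1) A(3) a'(1) _ A(2) N(2)] aa by blast
  have nb: "\<not> a' \<sim> b" using gproj_unique[OF N(1) a'N N(2,3) ca] N(4) by blast
  have fa: "h a' = a'" using fix_proj[OF A(1) a[OF A(1,2)] Q(1) QA a'] .
  have Qa: "Q \<noteq> a'" using a'(1) QA by blast
  obtain M where M: "M \<in> lines \<Gamma>" "Q \<in> M" "a' \<in> M" using gline_ex[OF a'(2) Qa] by blast
  have sM: "stable h M" using stable_two[OF M Qa Q(1) fa] .
  have aM: "a \<notin> M" using gline_coll[OF M(1,2)] Q(3) by blast
  have MN: "n \<notin> N" if n: "n \<in> M" for n
  proof
    assume nN: "n \<in> N"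
    have "n = b" using gproj_unique[OF N(1) QN nN N(3) gline_coll[OF M(1,2) n] Q(2)] .
    then show False using gline_coll[OF M(1,3) n] nb by blast
  qed
  have fM: "h y = y" if y: "y \<in> M" for y
  proof -
    have yP: "y \<in> points \<Gamma>" using gline_sub M(1) y by blast
    obtain n where n: "n \<in> N" "y \<sim> n" using gproj_ex[OF yP N(1)] by blast
    have "n \<notin> M" using MN n(1) by blast
    then show ?thesis using fix_proj[OF M(1) sM N(5)[OF n(1)] _ y gsym[OF n(2)]] by blast
  qed
  have "h x = x" if R: "R \<in> lines \<Gamma>" "a \<in> R" "R \<noteq> N" "R \<noteq> A" and x: "x \<in> R" for R x
  proof -
    have RM: "y \<notin> R" if y: "y \<in> M" for y
    proof
      assume yR: "y \<in> R"
      have "y = a'" using gproj_unique[OF M(1) aM y M(3) gline_coll[OF R(1,2) yR] gsym[OF ca]] .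
      then show False using gmeet[OF R(1) A(1) R(4) yR _ R(2) A(2)] a'(1) aa by blast
    qed
    have xP: "x \<in> points \<Gamma>" using gline_sub R(1) x by blast
    obtain y where y: "y \<in> M" "x \<sim> y" using gproj_ex[OF xP M(1)] by blast
    show ?thesis using fix_proj[OF R(1) a[OF R(1,2)] fM[OF y(1)] RM[OF y(1)] x gsym[OF y(2)]] .
  qed
  then show ?thesis using a'(1) fa ca nb by blast
qed

text \<open>The line \<open>A\<close> of \<open>rigid_aux\<close> is auxiliary; thickness lets it
  differ from the line joining \<open>x\<close> to \<open>a\<close>.\<close>

lemma rigid_perp:
  assumes N: "N \<in> lines \<Gamma>" "a \<in> N" "b \<in> N" "a \<noteq> b" "\<And>x. x \<in> N \<Longrightarrow> h x = x"
    and a: "\<And>l. l \<in> lines \<Gamma> \<Longrightarrow> a \<in> l \<Longrightarrow> stable h l"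
    and Q: "h Q = Q" "Q \<sim> b" "\<not> Q \<sim> a"
    and x: "x \<sim> a"
  shows "h x = x"
proof (cases "x \<in> N")
  case False
  have aP: "a \<in> points \<Gamma>" using gP x by blast
  have "x \<noteq> a" using False N(2) by blast
  then obtain R where R: "R \<in> lines \<Gamma>" "x \<in> R" "a \<in> R" using gline_ex[OF x] by blast
  obtain A where A: "A \<in> lines \<Gamma>" "a \<in> A" "A \<noteq> N" "A \<noteq> R" using gthick[OF aP, of N R] by blast
  have RN: "R \<noteq> N" using R(2) False by blast
  obtain a' where "\<forall>R\<in>lines \<Gamma>. a \<in> R \<and> R \<noteq> N \<and> R \<noteq> A \<longrightarrow> (\<forall>x\<in>R. h x = x)"
    using rigid_aux[OF N a Q A(1-3)] by blast
  then show ?thesis using R RN A(4) by blast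
qed (use N(5) in simp)

text \<open>The point \<open>a'\<close> from \<open>rigid_aux\<close> plays for \<open>b\<close> the
  role that \<open>Q\<close> plays for \<open>a\<close>, so all neighbours of \<open>a\<close> and
  \<open>b\<close> are fixed. A line missing \<open>N\<close> has two fixed points, the projections
  of \<open>a\<close> and \<open>b\<close>, and a point off \<open>N\<close> lies on two such
  lines.\<close>

lemma rigid:
  assumes N: "N \<in> lines \<Gamma>" "a \<in> N" "b \<in> N" "a \<noteq> b" "\<And>x. x \<in> N \<Longrightarrow> h x = x"
    and a: "\<And>l. l \<in> lines \<Gamma> \<Longrightarrow> a \<in> l \<Longrightarrow> stable h l" and b: "\<And>l. l \<in> lines \<Gamma> \<Longrightarrow> b \<in> l \<Longrightarrow> stable h l"
    and Q: "h Q = Q" "Q \<sim> b" "\<not> Q \<sim> a"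
    and x: "x \<in> points \<Gamma>"
  shows "h x = x"
proof (cases "x \<in> N")
  case False
  have aP: "a \<in> points \<Gamma>" "b \<in> points \<Gamma>" using gline_sub N by blast+
  obtain A where A: "A \<in> lines \<Gamma>" "a \<in> A" "A \<noteq> N" using gthick[OF aP(1), of N N] by blast
  obtain a' where a': "h a' = a'" "a' \<sim> a" "\<not> a' \<sim> b"
    using rigid_aux[OF N a Q A] by blast
  have fa: "h y = y" if "y \<sim> a" for y using rigid_perp[OF N a Q that] .
  have fb: "h y = y" if "y \<sim> b" for y using rigid_perp[OF N(1,3,2) N(4)[symmetric] N(5) b a' that] .
  have st: "stable h Y" if Y: "Y \<in> lines \<Gamma>" "Y \<inter> N = {}" for Y
  proof -
    obtain y1 where y1: "y1 \<in> Y" "a \<sim> y1" using gproj_ex[OF aP(1) Y(1)] by blast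
    obtain y2 where y2: "y2 \<in> Y" "b \<sim> y2" using gproj_ex[OF aP(2) Y(1)] by blast
    have "y1 \<notin> N" using y1 Y by blast
    then have "y1 \<noteq> y2" using gproj_unique[OF N(1) _ N(2,3) gsym[OF y1(2)]] gsym[OF y2(2)] N(4) by blast
    then show ?thesis using stable_two[OF Y(1) y1(1) y2(1)] fa[OF gsym[OF y1(2)]] fb[OF gsym[OF y2(2)]] by blast
  qed
  obtain n where n: "n \<in> N" "x \<sim> n" using gproj_ex[OF x N(1)] by blast
  have "x \<noteq> n" using n False by blast
  then obtain K where K: "K \<in> lines \<Gamma>" "x \<in> K" "n \<in> K" using gline_ex[OF n(2)] by blast
  have dis: "m \<inter> N = {}" if m: "m \<in> lines \<Gamma>" "x \<in> m" "m \<noteq> K" for m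
  proof (rule ccontr)
    assume "m \<inter> N \<noteq> {}"
    then obtain n' where n': "n' \<in> m" "n' \<in> N" by blast
    have "n' = n" using gproj_unique[OF N(1) False n'(2) n(1) gline_coll[OF m(1,2) n'(1)] n(2)] .
    then show False using gline_unique[OF m(1) K(1) m(2) _ K(2,3) \<open>x \<noteq> n\<close>] n'(1) m(3) by blast
  qed
  obtain m1 where m1: "m1 \<in> lines \<Gamma>" "x \<in> m1" "m1 \<noteq> K" using gthick[OF x, of K K] by blast
  obtain m2 where m2: "m2 \<in> lines \<Gamma>" "x \<in> m2" "m2 \<noteq> K" "m2 \<noteq> m1" using gthick[OF x, of K m1] by blast
  show ?thesis using fix_meet[OF m1(1) m2(1) m2(4)[symmetric] st[OF m1(1) dis[OF m1]] st[OF m2(1) dis[OF m2(1-3)]] m1(2) m2(2)] .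
qed (use N(5) in simp)

text \<open>Stability of all lines through a point passes to fixed points not collinear to it: from
  \<open>a\<close> to \<open>Q\<close>, to a point \<open>e\<close> of \<open>N2\<close>, and to the
  projection \<open>b\<close> of \<open>Q\<close> on \<open>N1\<close>. This reduces the claim to
  \<open>rigid\<close>.\<close>

lemma rigid_first:
  assumes N: "N1 \<in> lines \<Gamma>" "N2 \<in> lines \<Gamma>" "a \<in> N1" "a \<in> N2" "N1 \<noteq> N2"
    "\<And>x. x \<in> N1 \<Longrightarrow> h x = x" "\<And>x. x \<in> N2 \<Longrightarrow> h x = x"
    and a: "\<And>l. l \<in> lines \<Gamma> \<Longrightarrow> a \<in> l \<Longrightarrow> stable h l"
    and Q: "h Q = Q" "Q \<in> points \<Gamma>" "\<not> Q \<sim> a"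
    and x: "x \<in> points \<Gamma>"
  shows "h x = x"
proof -
  have aP: "a \<in> points \<Gamma>" using gline_sub N(1,3) by blast
  have aQ: "\<not> a \<sim> Q" using Q(3) gsym by blast
  have sQ: "\<And>l. l \<in> lines \<Gamma> \<Longrightarrow> Q \<in> l \<Longrightarrow> stable h l" using stable_transfer[OF N(6)[OF N(3)] a aP Q(1) aQ] .
  obtain b where b: "b \<in> N1" "Q \<sim> b" using gproj_ex[OF Q(2) N(1)] by blast
  obtain b2 where b2: "b2 \<in> N2" "Q \<sim> b2" using gproj_ex[OF Q(2) N(2)] by blast
  obtain e where e: "e \<in> N2" "e \<noteq> a" "e \<noteq> b2" using gthird[OF N(2)] by blast
  have QN2: "Q \<notin> N2" using gline_coll[OF N(2) _ N(4)] Q(3) by blast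
  have Qe: "\<not> Q \<sim> e" using gproj_unique[OF N(2) QN2 e(1) b2(1) _ b2(2)] e(3) by blast
  have eP: "e \<in> points \<Gamma>" using gline_sub N(2) e(1) by blast
  have se: "\<And>l. l \<in> lines \<Gamma> \<Longrightarrow> e \<in> l \<Longrightarrow> stable h l" using stable_transfer[OF Q(1) sQ Q(2) N(7)[OF e(1)] Qe] .
  have ba: "b \<noteq> a" using b(2) Q(3) by blast
  have bN2: "b \<notin> N2" using gmeet[OF N(1,2,5) b(1) _ N(3,4)] ba by blast
  have eb: "\<not> e \<sim> b" using gproj_unique[OF N(2) bN2 e(1) N(4) gsym gline_coll[OF N(1) b(1) N(3)]] e(2) by blast
  have sb: "\<And>l. l \<in> lines \<Gamma> \<Longrightarrow> b \<in> l \<Longrightarrow> stable h l" using stable_transfer[OF N(7)[OF e(1)] se eP N(6)[OF b(1)] eb] .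
  show ?thesis using rigid[OF N(1,3) b(1) ba[symmetric] N(6) a sb Q(1) b(2) Q(3) x] .
qed

end

text \<open>Turns equality of two maps into a fixed point question for a single map. The inverse of
  \<open>\<theta>\<close> preserves collinearity because a collineation permutes the lines.\<close>

lemma compare:
  assumes \<theta>: "collineation \<Gamma> \<theta>" and \<psi>: "\<And>x. x \<in> points \<Gamma> \<Longrightarrow> \<psi> x \<in> points \<Gamma>" "\<And>x y. x \<sim> y \<Longrightarrow> \<psi> x \<sim> \<psi> y"
  defines "h \<equiv> inv_into (points \<Gamma>) \<theta> \<circ> \<psi>"
  shows "\<And>x. x \<in> points \<Gamma> \<Longrightarrow> h x \<in> points \<Gamma>" "\<And>x y. x \<sim> y \<Longrightarrow> h x \<sim> h y"
    "\<And>x. x \<in> points \<Gamma> \<Longrightarrow> \<theta> x = \<psi> x \<longleftrightarrow> h x = x"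
    "\<And>l. l \<in> lines \<Gamma> \<Longrightarrow> \<theta> ` l = l \<Longrightarrow> \<psi> ` l \<subseteq> l \<Longrightarrow> stable h l"
proof -
  have inj: "inj_on \<theta> (points \<Gamma>)" and sur: "\<theta> ` points \<Gamma> = points \<Gamma>" and L: "image \<theta> ` lines \<Gamma> = lines \<Gamma>"
    using \<theta> unfolding collineation_def bij_betw_def by blast+
  have 1: "\<theta> (inv_into (points \<Gamma>) \<theta> y) = y" "inv_into (points \<Gamma>) \<theta> y \<in> points \<Gamma>" if "y \<in> points \<Gamma>" for y
    using f_inv_into_f[of y \<theta> "points \<Gamma>"] inv_into_into[of y \<theta> "points \<Gamma>"] that sur by auto
  have 2: "inv_into (points \<Gamma>) \<theta> (\<theta> x) = x" if "x \<in> points \<Gamma>" for x using inv_into_f_f[OF inj that] .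
  have 3: "x \<sim> y" if xy: "x \<in> points \<Gamma>" "y \<in> points \<Gamma>" "\<theta> x \<sim> \<theta> y" for x y
  proof (cases "x = y")
    case True then show ?thesis using coll_refl xy by metis
  next
    case False
    then have "\<theta> x \<noteq> \<theta> y" using inj xy unfolding inj_on_def by blast
    then obtain l where l: "l \<in> lines \<Gamma>" "\<theta> x \<in> l" "\<theta> y \<in> l" using gline_ex[OF xy(3)] by blast
    then obtain m where m: "m \<in> lines \<Gamma>" "l = \<theta> ` m" using L by blast
    have "x \<in> m" "y \<in> m" using inj_on_image_mem_iff[OF inj _ gline_sub[OF m(1)]] xy l m by blast+
    then show ?thesis using gline_coll[OF m(1)] by blast
  qed
  show hP: "h x \<in> points \<Gamma>" if "x \<in> points \<Gamma>" for x using 1(2)[OF \<psi>(1)[OF that]] unfolding h_def by simp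
  have th: "\<theta> (h x) = \<psi> x" if "x \<in> points \<Gamma>" for x using 1(1)[OF \<psi>(1)[OF that]] unfolding h_def by simp
  show "h x \<sim> h y" if "x \<sim> y" for x y using 3[OF hP hP] th \<psi>(2)[OF that] gP[OF that] by simp
  show "\<theta> x = \<psi> x \<longleftrightarrow> h x = x" if "x \<in> points \<Gamma>" for x
    using th[OF that] 2[OF that] unfolding h_def by auto
  show "stable h l" if l: "l \<in> lines \<Gamma>" "\<theta> ` l = l" "\<psi> ` l \<subseteq> l" for l
    unfolding stable_def
  proof
    fix x assume x: "x \<in> l"
    then have "\<psi> x \<in> \<theta> ` l" using l by blast
    then obtain y where y: "y \<in> l" "\<psi> x = \<theta> y" by blast
    then show "h x \<in> l" using 2[of y] gline_sub[OF l(1)] unfolding h_def by auto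
  qed
qed

section \<open>What a root elation of a quadrangle fixes\<close>

lemma gline_singular:
  assumes l: "l \<in> lines \<Gamma>" shows "singular_subspace \<Gamma> l"
proof -
  have "m \<subseteq> l" if m: "m \<in> lines \<Gamma>" "x \<in> m \<inter> l" "y \<in> m \<inter> l" "x \<noteq> y" for m x y
  proof -
    have "m = l" using gline_unique[OF m(1) l _ _ _ _ m(4)] m(2,3) by blast
    then show ?thesis by simp
  qed
  then have "geo_subspace \<Gamma> l" unfolding geo_subspace_def using gline_sub[OF l] by blast
  then show ?thesis unfolding singular_subspace_def using gline_coll[OF l] by blast
qed

lemma gline_span:
  assumes l: "l \<in> lines \<Gamma>" "x \<in> l" "y \<in> l" "x \<noteq> y" shows "geo_span \<Gamma> {x, y} = l"
proof -
  have s: "geo_subspace \<Gamma> l" using gline_singular[OF l(1)] unfolding singular_subspace_def by blast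
  have "{x, y} \<subseteq> points \<Gamma>" using gline_sub l by blast
  then have "geo_subspace \<Gamma> (geo_span \<Gamma> {x, y})" using geo_span_subspace gline_sub by blast
  moreover have "x \<in> l \<inter> geo_span \<Gamma> {x, y}" "y \<in> l \<inter> geo_span \<Gamma> {x, y}"
    using geo_span_superset[of "{x, y}" \<Gamma>] l by blast+
  ultimately have "l \<subseteq> geo_span \<Gamma> {x, y}" using l(1,4) unfolding geo_subspace_def by blast
  then show ?thesis using geo_span_least[OF s, of "{x, y}"] l by blast
qed

lemma apartment_line:
  assumes "i \<in> frame_indices 2" "j \<in> frame_indices 2" "f i \<noteq> f j" "l \<in> lines \<Gamma>" "f i \<in> l" "f j \<in> l"
  shows "l \<in> apartment \<Gamma> 2 f"
  unfolding apartment_def using gline_singular[OF assms(4)] gline_span[OF assms(4-6,3)] assms(1,2)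
  by (auto intro!: exI[of _ "{f i, f j}"])

lemma apartment_point:
  assumes "polar_frame \<Gamma> 2 f" "i \<in> frame_indices 2" shows "{f i} \<in> apartment \<Gamma> 2 f"
  unfolding apartment_apt using apartment_on_singleI[of "f i"] polar_frame_point[OF assms] assms(2) by blast

lemma root_elation_stable:
  assumes "root_elation_for \<Gamma> \<alpha>i \<theta>" "{a} \<in> \<alpha>i" "l \<in> lines \<Gamma>" "a \<in> l"
  shows "\<theta> ` l = l"
  using assms gline_singular[OF assms(3)] unfolding root_elation_for_def by blast

text \<open>The witnesses are \<open>a = f (- i)\<close>, \<open>Q = f i\<close> and the other
  opposite pair of the frame. The lines from \<open>a\<close> to that pair are members of the
  interior, hence fixed pointwise.\<close>

lemma root_first_data:
  assumes f: "polar_frame \<Gamma> 2 f" and i: "i \<in> frame_indices 2"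
    and \<theta>: "root_elation_for \<Gamma> (interior_first (apartment \<Gamma> 2 f) f i) \<theta>"
  shows "\<exists>a M1 M2 Q. a \<sim> M1 \<and> a \<sim> M2 \<and> Q \<sim> M1 \<and> Q \<sim> M2 \<and> \<not> Q \<sim> a \<and> \<not> M1 \<sim> M2 \<and>
    (\<forall>l\<in>lines \<Gamma>. a \<in> l \<longrightarrow> \<theta> ` l = l) \<and> (\<forall>l\<in>lines \<Gamma>. a \<in> l \<and> (M1 \<in> l \<or> M2 \<in> l) \<longrightarrow> (\<forall>x\<in>l. \<theta> x = x))"
proof -
  obtain j where j: "j \<in> frame_indices 2" "j \<noteq> i" "j \<noteq> - i"
  proof (cases "i = 1 \<or> i = - 1")
    case True
    then show ?thesis using that[of 2] by (auto simp: frame_indices_def)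
  next
    case False
    then show ?thesis using that[of 1] i by (auto simp: frame_indices_def)
  qed
  note m = frame_indices_uminus[OF i] frame_indices_uminus[OF j(1)]
  note c = polar_frame_coll[OF f]
  have C: "f (- i) \<sim> f j" "f (- i) \<sim> f (- j)" "f i \<sim> f j" "f i \<sim> f (- j)" "\<not> f i \<sim> f (- i)" "\<not> f j \<sim> f (- j)"
    using c[OF m(1) j(1)] c[OF m] c[OF i j(1)] c[OF i m(2)] c[OF i m(1)] c[OF j(1) m(2)] j by auto
  have ne: "f (- i) \<noteq> f j" "f (- i) \<noteq> f (- j)" using C(3,4,5) by metis+
  let ?I = "interior_first (apartment \<Gamma> 2 f) f i"
  have a: "{f (- i)} \<in> ?I" unfolding interior_first_def using apartment_point[OF f m(1)] by blast
  have st: "\<theta> ` l = l" if "l \<in> lines \<Gamma>" "f (- i) \<in> l" for l using root_elation_stable[OF \<theta> a that] .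
  have fx: "\<theta> x = x" if l: "l \<in> lines \<Gamma>" "f (- i) \<in> l" "f j \<in> l \<or> f (- j) \<in> l" "x \<in> l" for l x
  proof -
    have "l \<in> apartment \<Gamma> 2 f" using apartment_line[of "- i" j f l] apartment_line[of "- i" "- j" f l] m j ne l by blast
    then have "l \<in> ?I" unfolding interior_first_def using l by blast
    then show ?thesis using \<theta> l(4) unfolding root_elation_for_def by blast
  qed
  show ?thesis
    by (rule exI[of _ "f (- i)"], rule exI[of _ "f j"], rule exI[of _ "f (- j)"], rule exI[of _ "f i"])
      (use C st fx in blast)
qed

text \<open>The witnesses are \<open>a = f (- i)\<close>, \<open>b = f (- j)\<close> and
  \<open>Q = f i\<close>. Their line \<open>N\<close> contains neither \<open>f i\<close> nor
  \<open>f j\<close>, so it is itself a member of the interior.\<close>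

lemma root_second_data:
  assumes f: "polar_frame \<Gamma> 2 f" and i: "i \<in> frame_indices 2" and j: "j \<in> frame_indices 2"
    and ij: "f i \<noteq> f j" "f i \<sim> f j"
    and \<theta>: "root_elation_for \<Gamma> (interior_second (apartment \<Gamma> 2 f) f i j) \<theta>"
  shows "\<exists>a b N Q. N \<in> lines \<Gamma> \<and> a \<in> N \<and> b \<in> N \<and> a \<noteq> b \<and> Q \<sim> b \<and> \<not> Q \<sim> a \<and>
    (\<forall>l\<in>lines \<Gamma>. a \<in> l \<or> b \<in> l \<longrightarrow> \<theta> ` l = l) \<and> (\<forall>x\<in>N. \<theta> x = x)"
proof -
  note m = frame_indices_uminus[OF i] frame_indices_uminus[OF j]
  note c = polar_frame_coll[OF f]
  have nij: "i \<noteq> j" "i + j \<noteq> 0" using ij c[OF i j] by auto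
  have C: "f (- i) \<sim> f (- j)" "\<not> f i \<sim> f (- i)" "\<not> f j \<sim> f (- j)" "f i \<sim> f (- j)" "f j \<sim> f (- i)"
    using c[OF m] c[OF i m(1)] c[OF j m(2)] c[OF i m(2)] c[OF j m(1)] nij by auto
  have ne: "f (- i) \<noteq> f (- j)" using C(2,4) by metis
  let ?I = "interior_second (apartment \<Gamma> 2 f) f i j"
  obtain N where N: "N \<in> lines \<Gamma>" "f (- i) \<in> N" "f (- j) \<in> N" using gline_ex[OF C(1) ne] by blast
  have ii: "f i \<noteq> f (- i)" "f j \<noteq> f (- j)" "f i \<noteq> f (- j)" "f j \<noteq> f (- i)"
    using C coll_refl[OF polar_frame_point[OF f i]] coll_refl[OF polar_frame_point[OF f j]] ij(2) gsym by metis+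
  have "{f (- i)} \<in> ?I" "{f (- j)} \<in> ?I" unfolding interior_second_def
    using apartment_point[OF f m(1)] apartment_point[OF f m(2)] ii by blast+
  then have st: "\<theta> ` l = l" if "l \<in> lines \<Gamma>" "f (- i) \<in> l \<or> f (- j) \<in> l" for l
    using root_elation_stable[OF \<theta>] that by blast
  have "N \<in> ?I" unfolding interior_second_def
    using apartment_line[OF m ne N] N(2,3) gline_coll[OF N(1) _ N(2)] gline_coll[OF N(1) _ N(3)] C(2,3) by blast
  then have "\<forall>x\<in>N. \<theta> x = x" using \<theta> unfolding root_elation_for_def by blast
  then show ?thesis using N ne C(2,4) st by blast
qed

end

section \<open>Projectivities between point residues\<close>

context thick_polar3
begin

section \<open>The point residue as a generalized quadrangle\<close>

abbreviation Res where "Res p \<equiv> point_residue \<Delta> p"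
definition star where "star p \<pi> = {K \<in> lines \<Delta>. p \<in> K \<and> K \<subseteq> \<pi>}"

lemma res_points: "K \<in> points (Res p) \<longleftrightarrow> K \<in> lines \<Delta> \<and> p \<in> K"
  unfolding point_residue_def by simp

lemma res_lines: "l \<in> lines (Res p) \<longleftrightarrow> (\<exists>\<pi>\<in>planes \<Delta>. p \<in> \<pi> \<and> l = star p \<pi>)"
  unfolding point_residue_def star_def by auto

lemma star_iff: "K \<in> star p \<pi> \<longleftrightarrow> K \<in> lines \<Delta> \<and> p \<in> K \<and> K \<subseteq> \<pi>"
  unfolding star_def by blast

lemma star_jn:
  assumes "\<pi> \<in> planes \<Delta>" "p \<in> \<pi>" "p \<sim> x" "p \<noteq> x" shows "jn p x \<in> star p \<pi> \<longleftrightarrow> x \<in> \<pi>"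
  using jn[OF assms(3,4)] plane_jn[OF assms(1,2) _ assms(4)] unfolding star_iff by blast

lemma res_coll:
  assumes x: "p \<sim> x" "p \<noteq> x" and y: "p \<sim> y" "p \<noteq> y"
  shows "coll (Res p) (jn p x) (jn p y) \<longleftrightarrow> x \<sim> y"
proof
  note jx = jn[OF x] and jy = jn[OF y]
  assume "coll (Res p) (jn p x) (jn p y)"
  then consider "jn p x = jn p y" | l where "l \<in> lines (Res p)" "jn p x \<in> l" "jn p y \<in> l" unfolding coll_def by blast
  then show "x \<sim> y"
  proof cases
    case 1
    then show ?thesis using line_coll[OF jx(1,3)] jy(3) by simp
  next
    case 2
    then obtain \<pi> where "\<pi> \<in> planes \<Delta>" "p \<in> \<pi>" "l = star p \<pi>" unfolding res_lines by blast
    then show ?thesis using 2 star_jn x y plane_coll by blast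
  qed
next
  note jx = jn[OF x] and jy = jn[OF y]
  assume xy: "x \<sim> y"
  obtain \<pi> where \<pi>: "\<pi> \<in> planes \<Delta>" "p \<in> \<pi>" "x \<in> \<pi>" "y \<in> \<pi>" using plane_ex3[OF x(1) xy sym[OF y(1)] x(2)] by blast
  have "star p \<pi> \<in> lines (Res p)" unfolding res_lines using \<pi> by blast
  moreover have "jn p x \<in> star p \<pi>" "jn p y \<in> star p \<pi>" using star_jn[OF \<pi>(1,2)] x y \<pi>(3,4) by blast+
  ultimately show "coll (Res p) (jn p x) (jn p y)" unfolding coll_def res_points using jx jy by blast
qed

text \<open>A point \<open>b\<close> opposite \<open>p\<close> turns the residue into the quadrangle
  \<open>dp p b\<close>: each line through \<open>p\<close> is represented by its point collinear to
  \<open>b\<close>, and \<open>res_coll\<close> transfers collinearity.\<close>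

lemma res_rep:
  assumes "K \<in> points (Res p)" "\<not> p \<sim> b" "b \<in> P"
  shows "pr b K \<in> dp p b" "pr b K \<in> K" "jn p (pr b K) = K" "p \<sim> pr b K" "p \<noteq> pr b K"
proof -
  have K: "K \<in> lines \<Delta>" "p \<in> K" using assms(1) unfolding res_points by blast+
  have nb: "\<not> b \<sim> p" using assms(2) sym by blast
  have p: "pr b K \<in> K" "b \<sim> pr b K" using pr[OF K nb assms(3)] .
  then show "pr b K \<in> K" by blast
  show c: "p \<sim> pr b K" using line_coll[OF K p(1)] .
  show ne: "p \<noteq> pr b K" using p nb by metis
  show "jn p (pr b K) = K" using jn_eq[OF K p(1) ne] .
  show "pr b K \<in> dp p b" unfolding dp_def using c p by blast
qed

lemma residue_gq:
  assumes p: "p \<in> P" shows "thick_gq (Res p)"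
proof
  obtain b where b: "b \<in> P" "\<not> p \<sim> b" using opp_ex[OF p] by blast
  note rep = res_rep[OF _ b(2,1)]
  show "l \<subseteq> points (Res p)" if "l \<in> lines (Res p)" for l
    using that unfolding res_lines by (auto simp: res_points star_iff)
  have plane_unique: "\<pi> = \<rho>" if h: "\<pi> \<in> planes \<Delta>" "\<rho> \<in> planes \<Delta>" "K \<in> star p \<pi>" "M \<in> star p \<pi>" "K \<in> star p \<rho>" "M \<in> star p \<rho>" "K \<noteq> M" for \<pi> \<rho> K M
  proof -
    have KM: "K \<in> lines \<Delta>" "M \<in> lines \<Delta>" "p \<in> K" "p \<in> M" "K \<subseteq> \<pi>" "M \<subseteq> \<pi>" "K \<subseteq> \<rho>" "M \<subseteq> \<rho>" using h(3-6) unfolding star_iff by blast+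
    obtain y where y: "y \<in> M" "y \<noteq> p" using third[OF KM(2)] by blast
    have "y \<notin> K" using line_meet_eq[OF KM(1,2) h(7) _ y(1) KM(3,4)] y(2) by blast
    then show ?thesis using plane_eq[OF h(1,2) KM(1,5,7)] y(1) KM by blast
  qed
  show "l = m" if h: "l \<in> lines (Res p)" "m \<in> lines (Res p)" "K \<in> l" "M \<in> l" "K \<in> m" "M \<in> m" "K \<noteq> M" for l m K M
  proof -
    obtain \<pi> \<rho> where "\<pi> \<in> planes \<Delta>" "\<rho> \<in> planes \<Delta>" "l = star p \<pi>" "m = star p \<rho>" using h(1,2) unfolding res_lines by blast
    then show ?thesis using plane_unique[of \<pi> \<rho> K M] h by blast
  qed
  show "\<exists>!M. M \<in> l \<and> coll (Res p) K M" if K: "K \<in> points (Res p)" "l \<in> lines (Res p)" "K \<notin> l" for K l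
  proof -
    obtain \<pi> where \<pi>: "\<pi> \<in> planes \<Delta>" "p \<in> \<pi>" "l = star p \<pi>" using K(2) unfolding res_lines by blast
    define k where "k = pr b K"
    have k: "k \<in> K" "jn p k = K" "p \<sim> k" "p \<noteq> k" unfolding k_def using rep[OF K(1)] by blast+
    have k\<pi>: "k \<notin> \<pi>" using star_jn[OF \<pi>(1,2) k(3,4)] K(3) k(2) \<pi>(3) by simp
    have kP: "k \<in> P" using colP k(3) by blast
    have T: "tr \<pi> k \<in> lines \<Delta>" using tr_line[OF \<pi>(1) kP k\<pi>] .
    have pT: "p \<in> tr \<pi> k" unfolding tr_def using \<pi>(2) sym[OF k(3)] by blast
    \<comment> \<open>A line \<open>p y\<close> of \<open>\<pi>\<close> is collinear to
      \<open>K\<close> in the residue exactly when \<open>y\<close> is in the trace of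
      \<open>k\<close>. This trace is a line through \<open>p\<close>, hence the only
      solution.\<close>
    have iff: "M \<in> l \<and> coll (Res p) K M \<longleftrightarrow> M = tr \<pi> k" for M
    proof
      assume M: "M \<in> l \<and> coll (Res p) K M"
      then have M': "M \<in> lines \<Delta>" "p \<in> M" "M \<subseteq> \<pi>" unfolding \<pi>(3) star_iff by blast+
      obtain y where y: "y \<in> M" "y \<noteq> p" using third[OF M'(1)] by blast
      have py: "p \<sim> y" using line_coll[OF M'(1,2) y(1)] .
      have "jn p y = M" using jn_eq[OF M'(1,2) y(1)] y(2) by blast
      then have "k \<sim> y" using res_coll[OF k(3,4) py y(2)[symmetric]] M k(2) by simp
      then have "y \<in> tr \<pi> k" unfolding tr_def using y(1) M'(3) by blast
      then show "M = tr \<pi> k" using line_unique[OF M'(1) T M'(2) y(1) pT] y(2) by blast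
    next
      assume M: "M = tr \<pi> k"
      obtain y where y: "y \<in> tr \<pi> k" "y \<noteq> p" using third[OF T] by blast
      have py: "p \<sim> y" using line_coll[OF T pT y(1)] .
      have j: "jn p y = M" using jn_eq[OF T pT y(1)] y(2) M by blast
      have "k \<sim> y" using y(1) unfolding tr_def by blast
      then have "coll (Res p) K M" using res_coll[OF k(3,4) py y(2)[symmetric]] k(2) j by simp
      then show "M \<in> l \<and> coll (Res p) K M" unfolding \<pi>(3) star_iff using M T pT tr_sub by blast
    qed
    then show ?thesis by blast
  qed
  show "\<exists>M\<in>l. M \<noteq> a \<and> M \<noteq> a'" if l: "l \<in> lines (Res p)" for l a a'
  proof -
    obtain \<pi> where \<pi>: "\<pi> \<in> planes \<Delta>" "p \<in> \<pi>" "l = star p \<pi>" using l unfolding res_lines by blast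
    have pb: "\<not> b \<sim> p" using b sym by blast
    then have "b \<notin> \<pi>" using plane_coll[OF \<pi>(1) _ \<pi>(2)] by blast
    then have n: "tr \<pi> b \<in> lines \<Delta>" using tr_line[OF \<pi>(1) b(1)] by blast
    have pn: "p \<notin> tr \<pi> b" unfolding tr_def using pb by blast
    obtain x where x: "x \<in> tr \<pi> b" "x \<noteq> pr b a" "x \<noteq> pr b a'" using third[OF n] by blast
    have x': "x \<in> \<pi>" "b \<sim> x" using x(1) unfolding tr_def by blast+
    have px: "p \<sim> x" "p \<noteq> x" using plane_coll[OF \<pi>(1,2) x'(1)] pn x(1) by blast+
    note j = jn[OF px]
    have "pr b (jn p x) = x" using pr_eq[OF j(1,2) pb j(3) x'(2)] .
    then have "jn p x \<noteq> a" "jn p x \<noteq> a'" using x(2,3) by metis+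
    moreover have "jn p x \<in> l" using star_jn[OF \<pi>(1,2) px] x'(1) \<pi>(3) by simp
    ultimately show ?thesis by blast
  qed
  show "\<exists>m\<in>lines (Res p). K \<in> m \<and> m \<noteq> a \<and> m \<noteq> a'" if K: "K \<in> points (Res p)" for K a a'
  proof -
    have K': "K \<in> lines \<Delta>" "p \<in> K" using K unfolding res_points by blast+
    \<comment> \<open>A line of the residue on \<open>K\<close> comes from one plane only, so
      avoiding two lines amounts to avoiding two planes. If there is no such plane,
      \<open>SOME\<close> returns an arbitrary set.\<close>
    define F where "F a = (SOME \<pi>. \<pi> \<in> planes \<Delta> \<and> K \<subseteq> \<pi> \<and> star p \<pi> = a)" for a
    obtain \<pi> where \<pi>: "\<pi> \<in> planes \<Delta>" "K \<subseteq> \<pi>" "\<pi> \<noteq> F a" "\<pi> \<noteq> F a'" using plane_thick[OF K'(1), of "F a" "F a'"] by blast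
    have "star p \<pi> \<noteq> c" if c: "\<pi> \<noteq> F c" for c
    proof
      assume e: "star p \<pi> = c"
      then have F: "F c \<in> planes \<Delta> \<and> K \<subseteq> F c \<and> star p (F c) = c" 
        using someI[of "\<lambda>\<pi>. \<pi> \<in> planes \<Delta> \<and> K \<subseteq> \<pi> \<and> star p \<pi> = c" \<pi>] \<pi>(1,2) unfolding F_def by blast
      obtain x where x: "x \<in> \<pi>" "x \<notin> K" using plane_off[OF \<pi>(1) K'(1)] by blast
      have p\<pi>: "p \<in> \<pi>" "p \<noteq> x" using \<pi>(2) K'(2) x(2) by blast+
      have px: "p \<sim> x" using plane_coll[OF \<pi>(1) p\<pi>(1) x(1)] .
      have M: "jn p x \<in> star p \<pi>" using star_jn[OF \<pi>(1) p\<pi>(1) px p\<pi>(2)] x(1) by blast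
      have Ks: "K \<in> star p \<pi>" unfolding star_iff using K' \<pi>(2) by blast
      have "K \<noteq> jn p x" using jn(3)[OF px p\<pi>(2)] x(2) by blast
      then show False using plane_unique[OF \<pi>(1) conjunct1[OF F] Ks M] Ks M F e c by blast
    qed
    then have "star p \<pi> \<noteq> a" "star p \<pi> \<noteq> a'" using \<pi>(3,4) by blast+
    moreover have "star p \<pi> \<in> lines (Res p)" "K \<in> star p \<pi>" unfolding res_lines star_iff using \<pi> K' by blast+
    ultimately show ?thesis by blast
  qed
qed

text \<open>Expressed through a common neighbour of \<open>u\<close> and \<open>v\<close>, a
  projection merely exchanges the apex of a line.\<close>

lemma residue_proj_jn:
  assumes "\<not> u \<sim> v" "x \<in> dp u v" shows "residue_proj \<Delta> u v (jn u x) = jn v x"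
proof -
  have x: "u \<sim> x" "v \<sim> x" "u \<noteq> x" using assms sym unfolding dp_def by blast+
  note j = jn[OF x(1,3)]
  have nv: "\<not> v \<sim> u" using assms(1) sym by blast
  have "(THE y. y \<in> jn u x \<and> coll \<Delta> v y) = x" using pr_eq[OF j(1,2) nv j(3) x(2)] unfolding pr_def .
  then show ?thesis unfolding residue_proj_def jn_def[of v x] using j by (simp add: res_points)
qed

lemma residue_proj_hom:
  assumes uv: "\<not> u \<sim> v" "v \<in> P"
  shows "K \<in> points (Res u) \<Longrightarrow> residue_proj \<Delta> u v K \<in> points (Res v)"
    "coll (Res u) K M \<Longrightarrow> coll (Res v) (residue_proj \<Delta> u v K) (residue_proj \<Delta> u v M)"
proof -
  have *: "\<exists>x\<in>dp u v. K = jn u x \<and> residue_proj \<Delta> u v K = jn v x \<and> u \<sim> x \<and> u \<noteq> x \<and> v \<sim> x \<and> v \<noteq> x"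
    if K: "K \<in> points (Res u)" for K
  proof -
    note r = res_rep[OF K uv]
    have "residue_proj \<Delta> u v (jn u (pr v K)) = jn v (pr v K)" using residue_proj_jn[OF uv(1) r(1)] .
    moreover have "v \<sim> pr v K" using r(1) unfolding dp_def by blast
    moreover have "v \<noteq> pr v K" using r(4) uv(1) by metis
    ultimately show ?thesis using r by metis
  qed
  show "residue_proj \<Delta> u v K \<in> points (Res v)" if "K \<in> points (Res u)"
    using *[OF that] jn unfolding res_points by metis
  assume c: "coll (Res u) K M"
  obtain x where x: "K = jn u x" "residue_proj \<Delta> u v K = jn v x" "u \<sim> x" "u \<noteq> x" "v \<sim> x" "v \<noteq> x"
    using *[of K] coll_points[OF c] by blast
  obtain y where y: "M = jn u y" "residue_proj \<Delta> u v M = jn v y" "u \<sim> y" "u \<noteq> y" "v \<sim> y" "v \<noteq> y"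
    using *[of M] coll_points[OF c] by blast
  show "coll (Res v) (residue_proj \<Delta> u v K) (residue_proj \<Delta> u v M)"
    using c res_coll[OF x(3,4) y(3,4)] res_coll[OF x(5,6) y(5,6)] x(1,2) y(1,2) by simp
qed

section \<open>Projectivities of length four\<close>

definition proj4 where "proj4 p p1 p2 p3 = residue_proj \<Delta> p3 p \<circ> residue_proj \<Delta> p2 p3 \<circ> residue_proj \<Delta> p1 p2 \<circ> residue_proj \<Delta> p p1"

text \<open>Before each projection the current line is rewritten through a representative collinear
  to the next apex; the equations between joins are these rewritings.\<close>

lemma proj4_chain:
  assumes "\<not> p \<sim> p1" "\<not> p1 \<sim> p2" "\<not> p2 \<sim> p3" "\<not> p3 \<sim> p"
    and "x1 \<in> dp p p1" "x2 \<in> dp p1 p2" "jn p1 x1 = jn p1 x2" "x3 \<in> dp p2 p3" "jn p2 x2 = jn p2 x3"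
      "x4 \<in> dp p3 p" "jn p3 x3 = jn p3 x4"
  shows "proj4 p p1 p2 p3 (jn p x1) = jn p x4"
  unfolding proj4_def using residue_proj_jn[OF assms(1,5)] residue_proj_jn[OF assms(2,6)]
    residue_proj_jn[OF assms(3,8)] residue_proj_jn[OF assms(4,10)] assms(7,9,11) by simp

lemma proj4_hom:
  assumes "\<not> p \<sim> p1" "\<not> p1 \<sim> p2" "\<not> p2 \<sim> p3" "\<not> p3 \<sim> p" "p \<in> P" "p1 \<in> P" "p2 \<in> P" "p3 \<in> P"
  shows "K \<in> points (Res p) \<Longrightarrow> proj4 p p1 p2 p3 K \<in> points (Res p)"
    "coll (Res p) K M \<Longrightarrow> coll (Res p) (proj4 p p1 p2 p3 K) (proj4 p p1 p2 p3 M)"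
  unfolding proj4_def using residue_proj_hom[OF assms(1,6)] residue_proj_hom[OF assms(2,7)]
    residue_proj_hom[OF assms(3,8)] residue_proj_hom[OF assms(4,5)] by simp_all

lemma proj4_fix:
  assumes "\<not> p \<sim> p1" "\<not> p1 \<sim> p2" "\<not> p2 \<sim> p3" "\<not> p3 \<sim> p" "p \<sim> x" "p1 \<sim> x" "p2 \<sim> x" "p3 \<sim> x"
  shows "proj4 p p1 p2 p3 (jn p x) = jn p x"
  using proj4_chain[OF assms(1-4), of x x x x] assms(5-8) unfolding dp_def by blast

text \<open>The representative for \<open>p1\<close> lies in \<open>\<pi>\<close>. As
  \<open>p2\<close> is in \<open>\<pi>\<close> too, the representative for \<open>p3\<close> is on a
  line of \<open>\<pi>\<close> through \<open>p2\<close>, so the result stays in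
  \<open>\<pi>\<close>.\<close>

lemma proj4_stable:
  assumes o: "\<not> p \<sim> p1" "\<not> p1 \<sim> p2" "\<not> p2 \<sim> p3" "\<not> p3 \<sim> p" "p1 \<in> P" "p3 \<in> P"
    and \<pi>: "\<pi> \<in> planes \<Delta>" "p \<in> \<pi>" "p2 \<in> \<pi>"
  shows "proj4 p p1 p2 p3 ` star p \<pi> \<subseteq> star p \<pi>"
proof (rule image_subsetI)
  fix K assume K: "K \<in> star p \<pi>"
  then have Kp: "K \<in> points (Res p)" unfolding res_points star_iff by blast
  note r = res_rep[OF Kp o(1,5)]
  define k where "k = pr p1 K"
  have k: "p1 \<sim> k" "k \<in> \<pi>" "p2 \<noteq> k" "p \<sim> k" using r K o(2) unfolding k_def dp_def star_iff by blast+
  have kd: "k \<in> dp p p1" "k \<in> dp p1 p2" unfolding dp_def using k plane_coll[OF \<pi>(1,3)] by blast+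
  have p2k: "p2 \<sim> k" using plane_coll[OF \<pi>(1,3) k(2)] .
  note j = jn[OF p2k k(3)]
  have n: "\<not> p3 \<sim> p2" "\<not> p \<sim> p3" using o sym by blast+
  define k3 where "k3 = pr p3 (jn p2 k)"
  have k3: "k3 \<in> jn p2 k" "p3 \<sim> k3" unfolding k3_def using pr[OF j(1,2) n(1) o(6)] .
  have k3\<pi>: "k3 \<in> \<pi>" using k3 plane_jn[OF \<pi>(1,3) k(2,3)] by blast
  have k3n: "p2 \<noteq> k3" "p \<noteq> k3" using k3(2) n(1) o(4) by metis+
  have c3: "p2 \<sim> k3" "p \<sim> k3" using plane_coll[OF \<pi>(1)] \<pi>(2,3) k3\<pi> by blast+
  have "proj4 p p1 p2 p3 (jn p k) = jn p k3"
    using proj4_chain[OF o(1-4) kd refl, of k3 k3] jn_eq[OF j(1,2) k3(1) k3n(1)] k3(2) c3 unfolding dp_def by blast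
  then have "proj4 p p1 p2 p3 K = jn p k3" using r(3) unfolding k_def by simp
  then show "proj4 p p1 p2 p3 K \<in> star p \<pi>" using star_jn[OF \<pi>(1,2) c3(2) k3n(2)] k3\<pi> by simp
qed

text \<open>The apexes are \<open>b\<close>, a third point \<open>p2\<close> of the line
  \<open>p x2\<close>, and \<open>b'\<close>. Points \<open>m1\<close> and \<open>m2\<close> are
  collinear to \<open>t\<close>, \<open>t'\<close> and \<open>x2\<close> and hence to everything
  constructed from them, in particular to \<open>b'\<close>.\<close>

lemma first_kind_points:
  assumes p: "p \<in> P" and b: "b \<in> P" "\<not> p \<sim> b"
    and x: "x2 \<in> dp p b" "m1 \<in> dp p b" "m2 \<in> dp p b" "t \<in> dp p b" "t' \<in> dp p b"
    and xm: "x2 \<sim> m1" "x2 \<sim> m2" "t \<sim> m1" "t \<sim> m2" "t' \<sim> m1" "t' \<sim> m2" "\<not> x2 \<sim> t" "\<not> x2 \<sim> t'"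
  shows "\<exists>p2 b'. p2 \<in> P \<and> b' \<in> P \<and> p2 \<in> jn p x2 \<and> \<not> b \<sim> p2 \<and> \<not> p2 \<sim> b' \<and> \<not> b' \<sim> p \<and>
    b' \<sim> x2 \<and> b' \<sim> m1 \<and> b' \<sim> m2 \<and> proj4 p b p2 b' (jn p t) = jn p t'"
proof -
  have px: "p \<sim> x2" "p \<sim> m1" "p \<sim> m2" "p \<sim> t" "p \<sim> t'" and bx: "b \<sim> x2" "b \<sim> m1" "b \<sim> m2" "b \<sim> t" "b \<sim> t'"
    using x unfolding dp_def by blast+
  have nbp: "\<not> b \<sim> p" using b sym by blast
  have px2: "p \<noteq> x2" using bx(1) nbp by metis
  note a = jn[OF px(1) px2]
  obtain p2 where p2: "p2 \<in> jn p x2" "p2 \<noteq> p" "p2 \<noteq> x2" using third[OF a(1)] by blast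
  have p2P: "p2 \<in> P" using line_sub a(1) p2(1) by blast
  have p2c: "p2 \<sim> p" "p2 \<sim> x2" using line_coll[OF a(1) p2(1)] a(2,3) by blast+
  have bp2: "\<not> b \<sim> p2" using perp_line[OF a(1) p2(1) a(3) p2(3) _ bx(1) a(2)] nbp by blast
  have p2b: "\<not> p2 \<sim> b" using bp2 sym by blast
  have p2n: "\<not> p2 \<sim> s" if "p \<sim> s" "\<not> x2 \<sim> s" for s
    using perp_line[OF a(1,2) p2(1) p2(2)[symmetric] sym[OF that(1)] sym a(3)] that(2) sym by blast
  have p2t: "\<not> p2 \<sim> t" "\<not> p2 \<sim> t'" using p2n px(4,5) xm(7,8) by blast+
  have bt: "b \<noteq> t" using px(4) b(2) by metis
  note jbt = jn[OF bx(4) bt]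
  \<comment> \<open>The image of \<open>p t\<close> is followed as \<open>b t = b t2\<close>,
    \<open>p2 t2 = p2 t3\<close>, \<open>b' t3 = b' t'\<close>. The points \<open>t2\<close> and
    \<open>t3\<close> are the changes of representative this needs, and \<open>b'\<close> is the
    point of \<open>t3 t'\<close> collinear to \<open>x2\<close>.\<close>
  define t2 where "t2 = pr p2 (jn b t)"
  have t2: "t2 \<in> jn b t" "p2 \<sim> t2" unfolding t2_def using pr[OF jbt(1,2) p2b p2P] .
  have t2n: "t2 \<noteq> t" "t2 \<noteq> b" "p2 \<noteq> t2" 
    using t2(2) p2t(1) p2b line_coll[OF jbt(1,2) t2(1)] bp2 by metis+
  have bt2: "b \<sim> t2" using line_coll[OF jbt(1,2) t2(1)] .
  note j2 = jn[OF t2(2) t2n(3)]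
  have t'P: "t' \<in> P" using colP px(5) by blast
  have t'p2: "\<not> t' \<sim> p2" using p2t(2) sym by blast
  define t3 where "t3 = pr t' (jn p2 t2)"
  have t3: "t3 \<in> jn p2 t2" "t' \<sim> t3" unfolding t3_def using pr[OF j2(1,2) t'p2 t'P] .
  have p2t3: "p2 \<sim> t3" using line_coll[OF j2(1,2) t3(1)] .
  have t3n: "t3 \<noteq> p2" "t3 \<noteq> t'" using t3(2) t'p2 p2t3 p2t(2) by metis+
  note j3 = jn[OF sym[OF t3(2)] t3n(2)]
  have x2P: "x2 \<in> P" using colP px(1) by blast
  define b' where "b' = pr x2 (jn t3 t')"
  have b': "b' \<in> jn t3 t'" "x2 \<sim> b'" unfolding b'_def using pr[OF j3(1,3) xm(8) x2P] .
  have b'P: "b' \<in> P" using line_sub j3(1) b'(1) by blast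
  have b't: "b' \<sim> t'" "b' \<sim> t3" using line_coll[OF j3(1) b'(1)] j3 by blast+
  have b'n: "b' \<noteq> t'" using b'(2) xm(8) by metis
  have mm: "b' \<sim> m" if m: "p \<sim> m" "x2 \<sim> m" "b \<sim> m" "t \<sim> m" "t' \<sim> m" for m
  proof -
    have "m \<sim> p2" using perp_line[OF a px2 sym[OF m(1)] sym[OF m(2)] p2(1)] .
    moreover have "m \<sim> t2" using perp_line[OF jbt bt sym[OF m(3)] sym[OF m(4)] t2(1)] .
    ultimately have "m \<sim> t3" using perp_line[OF j2 t2n(3) _ _ t3(1)] by blast
    then show ?thesis using perp_line[OF j3 t3n(2) _ sym[OF m(5)] b'(1)] sym by blast
  qed
  have pb': "\<not> b' \<sim> p"
  proof
    assume "b' \<sim> p"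
    then have "p \<sim> t3" using perp_line[OF j3(1) b'(1) j3(3) b'n sym px(5) j3(2)] by blast
    then have "p \<sim> t2" using perp_line[OF j2(1) t3(1) j2(2) t3n(1) _ sym[OF p2c(1)] j2(3)] by blast
    then have "p \<sim> b" using perp_line[OF jbt(1) t2(1) jbt(3) t2n(1) _ px(4) jbt(2)] by blast
    then show False using b(2) by blast
  qed
  have x2t3: "\<not> x2 \<sim> t3"
  proof
    assume "x2 \<sim> t3"
    then have "x2 \<sim> t2" using perp_line[OF j2(1) t3(1) j2(2) t3n(1) _ sym[OF p2c(2)] j2(3)] by blast
    then have "x2 \<sim> t" using perp_line[OF jbt(1) t2(1) jbt(2) t2n(2) _ sym[OF bx(1)] jbt(3)] by blast
    then show False using xm(7) by blast
  qed
  have b't3: "b' \<noteq> t3" using b'(2) x2t3 by metis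
  have p2b': "\<not> p2 \<sim> b'" using perp_line[OF j3(1) b'(1) j3(2) b't3 _ p2t3 j3(3)] p2t(2) by blast
  have e1: "jn b t = jn b t2" using jn_eq[OF jbt(1,2) t2(1) t2n(2)[symmetric]] by simp
  have e2: "jn p2 t2 = jn p2 t3" using jn_eq[OF j2(1,2) t3(1) t3n(1)[symmetric]] by simp
  have e3: "jn b' t3 = jn b' t'" using jn_eq[OF j3(1) b'(1) j3(2) b't3] jn_eq[OF j3(1) b'(1) j3(3) b'n] by simp
  have "proj4 p b p2 b' (jn p t) = jn p t'"
    using proj4_chain[OF b(2) bp2 p2b' pb' x(4) _ e1 _ e2 _ e3] bt2 t2(2) p2t3 b't px(5) unfolding dp_def by blast
  then show ?thesis using p2P b'P p2(1) bp2 p2b' pb' sym[OF b'(2)] mm px bx xm by blast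
qed

text \<open>Now \<open>p2\<close> is taken on \<open>p x3\<close>, so the image of
  \<open>p t\<close> at \<open>p2\<close> stays in \<open>\<tau>\<close> and meets the target
  \<open>Q'\<close> in a point \<open>t'\<close>. Projecting \<open>t'\<close> to the line
  \<open>b x2\<close> gives the last apex.\<close>

lemma second_kind_points:
  assumes p: "p \<in> P" and b: "b \<in> P" "\<not> p \<sim> b"
    and x: "x2 \<in> dp p b" "x3 \<in> dp p b" "t \<in> dp p b"
    and xt: "x2 \<sim> x3" "t \<sim> x3" "\<not> x2 \<sim> t"
    and Q': "Q' \<in> lines \<Delta>" "p \<in> Q'" "x3 \<notin> Q'" and \<tau>: "\<tau> \<in> planes \<Delta>" "p \<in> \<tau>" "x3 \<in> \<tau>" "t \<in> \<tau>" "Q' \<subseteq> \<tau>"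
  shows "\<exists>p2 b'. p2 \<in> P \<and> b' \<in> P \<and> p2 \<in> jn p x3 \<and> \<not> b \<sim> p2 \<and> \<not> p2 \<sim> b' \<and> \<not> b' \<sim> p \<and>
    b' \<in> jn b x2 \<and> b' \<noteq> x2 \<and> proj4 p b p2 b' (jn p t) = Q'"
proof -
  have px: "p \<sim> x2" "p \<sim> x3" "p \<sim> t" and bx: "b \<sim> x2" "b \<sim> x3" "b \<sim> t"
    using x unfolding dp_def by blast+
  have nbp: "\<not> b \<sim> p" using b sym by blast
  have px3: "p \<noteq> x3" using bx(2) nbp by metis
  note a = jn[OF px(2) px3]
  obtain p2 where p2: "p2 \<in> jn p x3" "p2 \<noteq> p" "p2 \<noteq> x3" using third[OF a(1)] by blast
  have p2P: "p2 \<in> P" using line_sub a(1) p2(1) by blast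
  have bp2: "\<not> b \<sim> p2" using perp_line[OF a(1) p2(1) a(3) p2(3) _ bx(2) a(2)] nbp by blast
  have p2\<tau>: "p2 \<in> \<tau>" using p2(1) plane_jn[OF \<tau>(1-3) px3] by blast
  have p2t: "p2 \<noteq> t" using bp2 bx(3) by metis
  have p2tc: "p2 \<sim> t" using plane_coll[OF \<tau>(1) p2\<tau> \<tau>(4)] .
  note j = jn[OF p2tc p2t]
  have j\<tau>: "jn p2 t \<subseteq> \<tau>" using plane_jn[OF \<tau>(1) p2\<tau> \<tau>(4) p2t] by blast
  obtain t' where t': "t' \<in> jn p2 t" "t' \<in> Q'" using plane_meet[OF \<tau>(1) j(1) Q'(1) j\<tau> \<tau>(5)] by blast
  have x2p2: "x2 \<sim> p2" using perp_line[OF a px3 sym[OF px(1)] xt(1) p2(1)] .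
  have "p2 \<notin> Q'" using line_unique[OF a(1) Q'(1) a(2) p2(1) Q'(2) _ p2(2)[symmetric]] a(3) Q'(3) by blast
  then have t'p2: "t' \<noteq> p2" using t'(2) by blast
  have x2t': "\<not> x2 \<sim> t'" using perp_line[OF j(1) t'(1) j(2) t'p2 _ x2p2 j(3)] xt(3) by blast
  have t'p: "t' \<noteq> p" using x2t' sym[OF px(1)] by metis
  have t'P: "t' \<in> P" using line_sub j(1) t'(1) by blast
  have bx2: "b \<noteq> x2" using px(1) b(2) by metis
  note jb = jn[OF bx(1) bx2]
  have nt: "\<not> t' \<sim> x2" using x2t' sym by blast
  define b' where "b' = pr t' (jn b x2)"
  have b': "b' \<in> jn b x2" "t' \<sim> b'" unfolding b'_def using pr[OF jb(1,3) nt t'P] .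
  have b'n: "b' \<noteq> x2" using b'(2) nt by metis
  have b'P: "b' \<in> P" using line_sub jb(1) b'(1) by blast
  have pb': "\<not> b' \<sim> p" using perp_line[OF jb(1) b'(1) jb(3) b'n sym px(1) jb(2)] b(2) by blast
  have p2b': "\<not> p2 \<sim> b'" using perp_line[OF jb(1) b'(1) jb(3) b'n _ sym[OF x2p2] jb(2)] bp2 sym by blast
  have e2: "jn p2 t = jn p2 t'" using jn_eq[OF j(1,2) t'(1) t'p2[symmetric]] by simp
  have e4: "jn p t' = Q'" using jn_eq[OF Q'(1,2) t'(2) t'p[symmetric]] .
  have "p2 \<sim> t'" using line_coll[OF j(1,2) t'(1)] .
  moreover have "p \<sim> t'" using line_coll[OF Q'(1,2) t'(2)] .
  ultimately have d: "t \<in> dp b p2" "t' \<in> dp p2 b'" "t' \<in> dp b' p"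
    using bx(3) p2tc sym[OF b'(2)] unfolding dp_def by blast+
  have "proj4 p b p2 b' (jn p t) = jn p t'"
    using proj4_chain[OF b(2) bp2 p2b' pb' x(3) d(1) refl d(2) e2 d(3) refl] .
  then show ?thesis using p2P b'P p2(1) bp2 p2b' pb' b'(1) b'n e4 by blast
qed

text \<open>The points \<open>b\<close>, \<open>b'\<close>, \<open>k2\<close> and \<open>k4\<close>
  all lie in the plane \<open>\<alpha>\<close> on \<open>b\<close>, \<open>x\<close>,
  \<open>k\<close>. Its points collinear to \<open>p\<close> form the line \<open>x k\<close>, so
  \<open>k4\<close> lies on that line and hence in \<open>\<pi>\<close>.\<close>

lemma second_kind_stable:
  assumes o: "\<not> p \<sim> b" "\<not> b \<sim> p2" "\<not> p2 \<sim> b'" "\<not> b' \<sim> p" "p \<in> P" "b \<in> P" "p2 \<in> P" "b' \<in> P"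
    and x: "p \<sim> x" "b \<sim> x" "p2 \<sim> x" and b': "b' \<in> jn b x" "b' \<noteq> x" and \<pi>: "\<pi> \<in> planes \<Delta>" "p \<in> \<pi>" "x \<in> \<pi>"
  shows "proj4 p b p2 b' ` star p \<pi> \<subseteq> star p \<pi>"
proof (rule image_subsetI)
  fix K assume K: "K \<in> star p \<pi>"
  then have Kp: "K \<in> points (Res p)" unfolding res_points star_iff by blast
  note r = res_rep[OF Kp o(1,6)]
  define k where "k = pr b K"
  have k: "b \<sim> k" "k \<in> \<pi>" "p \<sim> k" "K = jn p k" "p \<noteq> k" using r K unfolding k_def dp_def star_iff by blast+
  have bx: "b \<noteq> x" using x(1) o(1) by metis
  note jb = jn[OF x(2) bx]
  have b'x: "b' \<sim> x" using line_coll[OF jb(1) b'(1) jb(3)] .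
  have xk: "x \<sim> k" using plane_coll[OF \<pi>(1,3) k(2)] .
  show "proj4 p b p2 b' K \<in> star p \<pi>"
  proof (cases "k = x")
    case True
    then show ?thesis using proj4_fix[OF o(1-4) x b'x] k(4) K by simp
  next
    case False
    have bk: "b \<noteq> k" using k(3) o(1) by metis
    note jk = jn[OF k(1) bk]
    have p2b: "\<not> p2 \<sim> b" and pb': "\<not> p \<sim> b'" using o sym by blast+
    define k2 where "k2 = pr p2 (jn b k)"
    have k2: "k2 \<in> jn b k" "p2 \<sim> k2" unfolding k2_def using pr[OF jk(1,2) p2b o(7)] .
    have bk2: "b \<sim> k2" using line_coll[OF jk(1,2) k2(1)] .
    have k2n: "b \<noteq> k2" using k2(2) p2b by metis
    have xk2: "x \<sim> k2" using perp_line[OF jk bk sym[OF x(2)] xk k2(1)] .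
    have b'k2: "b' \<sim> k2" using perp_line[OF jb bx sym[OF bk2] sym[OF xk2] b'(1)] sym by blast
    have b'k2n: "b' \<noteq> k2" using k2(2) o(3) by metis
    note j' = jn[OF b'k2 b'k2n]
    define k4 where "k4 = pr p (jn b' k2)"
    have k4: "k4 \<in> jn b' k2" "p \<sim> k4" unfolding k4_def using pr[OF j'(1,2) pb' o(5)] .
    have b'k4: "b' \<sim> k4" using line_coll[OF j'(1,2) k4(1)] .
    have k4n: "b' \<noteq> k4" "p \<noteq> k4" using k4(2) pb' b'k4 o(4) by metis+
    obtain \<alpha> where \<alpha>: "\<alpha> \<in> planes \<Delta>" "b \<in> \<alpha>" "x \<in> \<alpha>" "k \<in> \<alpha>" using plane_ex3[OF x(2) xk sym[OF k(1)] bx] by blast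
    have b'\<alpha>: "b' \<in> \<alpha>" using b'(1) plane_jn[OF \<alpha>(1-3) bx] by blast
    have k2\<alpha>: "k2 \<in> \<alpha>" using k2(1) plane_jn[OF \<alpha>(1,2,4) bk] by blast
    have k4\<alpha>: "k4 \<in> \<alpha>" using k4(1) plane_jn[OF \<alpha>(1) b'\<alpha> k2\<alpha> b'k2n] by blast
    have "p \<notin> \<alpha>" using plane_coll[OF \<alpha>(1) _ \<alpha>(2)] o(1) by blast
    then have T: "tr \<alpha> p \<in> lines \<Delta>" using tr_line[OF \<alpha>(1) o(5)] by blast
    have "x \<in> tr \<alpha> p" "k \<in> tr \<alpha> p" "k4 \<in> tr \<alpha> p" unfolding tr_def using \<alpha> k4\<alpha> x(1) k(3) k4(2) by blast+
    then have "k4 \<in> jn x k" using jn_eq[OF T] False by metis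
    then have k4\<pi>: "k4 \<in> \<pi>" using plane_jn[OF \<pi>(1,3) k(2)] False by blast
    have e1: "jn b k = jn b k2" using jn_eq[OF jk(1,2) k2(1) k2n] by simp
    have e3: "jn b' k2 = jn b' k4" using jn_eq[OF j'(1,2) k4(1) k4n(1)] by simp
    have "proj4 p b p2 b' (jn p k) = jn p k4"
      using proj4_chain[OF o(1-4) _ _ e1 _ refl _ e3] k(1,3) bk2 k2(2) b'k2 k4(2) b'k4 unfolding dp_def by blast
    then show ?thesis using k(4) star_jn[OF \<pi>(1,2) k4(2) k4n(2)] k4\<pi> by simp
  qed
qed

text \<open>With \<open>p2\<close> on the line \<open>a\<close>, the projectivity stabilizes the
  residue lines through \<open>a\<close>, fixes \<open>N1\<close> and \<open>N2\<close> pointwise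
  and takes the right value at \<open>Q\<close>; \<open>rigid_first\<close> yields equality.\<close>

lemma residue_first_kind:
  assumes p: "p \<in> P" and \<theta>: "collineation (Res p) \<theta>"
    and c: "coll (Res p) a M1" "coll (Res p) a M2" "coll (Res p) Q M1" "coll (Res p) Q M2" "\<not> coll (Res p) Q a" "\<not> coll (Res p) M1 M2"
    and st: "\<And>l. l \<in> lines (Res p) \<Longrightarrow> a \<in> l \<Longrightarrow> \<theta> ` l = l"
    and fx: "\<And>l K. l \<in> lines (Res p) \<Longrightarrow> a \<in> l \<Longrightarrow> M1 \<in> l \<or> M2 \<in> l \<Longrightarrow> K \<in> l \<Longrightarrow> \<theta> K = K"
  shows "\<exists>p1\<in>P. \<exists>p2\<in>P. \<exists>p3\<in>P. \<not> p \<sim> p1 \<and> \<not> p1 \<sim> p2 \<and> \<not> p2 \<sim> p3 \<and> \<not> p3 \<sim> p \<and>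
    (\<forall>K\<in>points (Res p). \<theta> K = proj4 p p1 p2 p3 K)"
proof -
  interpret G: thick_gq "Res p" using residue_gq[OF p] .
  obtain b where b: "b \<in> P" "\<not> p \<sim> b" using opp_ex[OF p] by blast
  have \<theta>P: "\<theta> K \<in> points (Res p)" if "K \<in> points (Res p)" for K
    using \<theta> that unfolding collineation_def bij_betw_def by blast
  have \<theta>c: "coll (Res p) (\<theta> K) (\<theta> M)" if KM: "coll (Res p) K M" for K M
  proof (cases "K = M")
    case True
    then show ?thesis using coll_refl[OF \<theta>P] coll_points[OF KM] by metis
  next
    case False
    then obtain l where l: "l \<in> lines (Res p)" "K \<in> l" "M \<in> l" using G.gline_ex[OF KM] by blast
    then have "\<theta> ` l \<in> lines (Res p)" using \<theta> unfolding collineation_def bij_betw_def by blast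
    then show ?thesis using G.gline_coll l by blast
  qed
  have pts: "a \<in> points (Res p)" "M1 \<in> points (Res p)" "M2 \<in> points (Res p)" "Q \<in> points (Res p)"
    using c(1,2,3) by (auto dest: coll_points)
  define x2 m1 m2 t t' where "x2 = pr b a" and "m1 = pr b M1" and "m2 = pr b M2" and "t = pr b Q" and "t' = pr b (\<theta> Q)"
  note ra = res_rep[OF pts(1) b(2,1), folded x2_def] and r1 = res_rep[OF pts(2) b(2,1), folded m1_def]
    and r2 = res_rep[OF pts(3) b(2,1), folded m2_def] and rQ = res_rep[OF pts(4) b(2,1), folded t_def]
    and rQ' = res_rep[OF \<theta>P[OF pts(4)] b(2,1), folded t'_def]
  have ne: "a \<noteq> M1" "a \<noteq> M2" using c(3-5) by metis+
  obtain N1 where N1: "N1 \<in> lines (Res p)" "a \<in> N1" "M1 \<in> N1" using G.gline_ex[OF c(1) ne(1)] by blast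
  obtain N2 where N2: "N2 \<in> lines (Res p)" "a \<in> N2" "M2 \<in> N2" using G.gline_ex[OF c(2) ne(2)] by blast
  have f: "\<theta> a = a" "\<theta> M1 = M1" "\<theta> M2 = M2" using fx N1 N2 by blast+
  have N12: "N1 \<noteq> N2" using G.gline_coll[OF N1(1,3)] N2(3) c(6) by blast
  have cQ': "coll (Res p) (\<theta> Q) M1" "coll (Res p) (\<theta> Q) M2" using \<theta>c[OF c(3)] \<theta>c[OF c(4)] f by simp_all
  have id: "\<And>K. K \<in> points (Res p) \<Longrightarrow> id K \<in> points (Res p)" "\<And>K M. coll (Res p) K M \<Longrightarrow> coll (Res p) (id K) (id M)" by simp_all
  \<comment> \<open>\<open>compare\<close> with the identity shows that the inverse of
    \<open>\<theta>\<close> preserves collinearity.\<close>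
  have nQ': "\<not> coll (Res p) (\<theta> Q) a"
  proof
    assume "coll (Res p) (\<theta> Q) a"
    then have "coll (Res p) (inv_into (points (Res p)) \<theta> (\<theta> Q)) (inv_into (points (Res p)) \<theta> a)"
      using G.compare(2)[where \<psi> = id, OF \<theta> id] by simp
    moreover have "inv_into (points (Res p)) \<theta> (\<theta> Q) = Q" "inv_into (points (Res p)) \<theta> a = a"
      using inv_into_f_f[of \<theta> "points (Res p)"] \<theta> pts f(1) unfolding collineation_def bij_betw_def by metis+
    ultimately show False using c(5) by simp
  qed
  have xm: "x2 \<sim> m1" "x2 \<sim> m2" "t \<sim> m1" "t \<sim> m2" "t' \<sim> m1" "t' \<sim> m2" "\<not> x2 \<sim> t" "\<not> x2 \<sim> t'"
    using res_coll[OF ra(4,5) r1(4,5)] res_coll[OF ra(4,5) r2(4,5)] res_coll[OF rQ(4,5) r1(4,5)] res_coll[OF rQ(4,5) r2(4,5)]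
      res_coll[OF rQ'(4,5) r1(4,5)] res_coll[OF rQ'(4,5) r2(4,5)] res_coll[OF rQ(4,5) ra(4,5)] res_coll[OF rQ'(4,5) ra(4,5)]
      c cQ' nQ' ra(3) r1(3) r2(3) rQ(3) rQ'(3) sym by metis+
  obtain p2 b' where B: "p2 \<in> P" "b' \<in> P" "p2 \<in> jn p x2" "\<not> b \<sim> p2" "\<not> p2 \<sim> b'" "\<not> b' \<sim> p"
    "b' \<sim> x2" "b' \<sim> m1" "b' \<sim> m2" "proj4 p b p2 b' (jn p t) = jn p t'"
    using first_kind_points[OF p b ra(1) r1(1) r2(1) rQ(1) rQ'(1) xm] by blast
  note o = b(2) B(4,5,6)
  note hom = proj4_hom[OF o p b(1) B(1,2)]
  \<comment> \<open>The representatives collinear to \<open>b\<close> of the members of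
    \<open>N\<close> form the line \<open>x2 m\<close>, contained in the perp of \<open>b'\<close>;
    \<open>p2\<close> lies in the same plane. All apexes are therefore collinear to the
    representative.\<close>
  have pN: "proj4 p b p2 b' K = K"
    if N: "N \<in> lines (Res p)" "a \<in> N" "M \<in> N" "K \<in> N" and M: "p \<sim> m" "p \<noteq> m" "jn p m = M" "b \<sim> m" "a \<noteq> M" "b' \<sim> m" for N M K m
  proof -
    obtain \<pi> where \<pi>: "\<pi> \<in> planes \<Delta>" "p \<in> \<pi>" "N = star p \<pi>" using N(1) unfolding res_lines by blast
    have i: "x2 \<in> \<pi>" "m \<in> \<pi>" using star_jn[OF \<pi>(1,2) ra(4,5)] star_jn[OF \<pi>(1,2) M(1,2)] N(2,3) ra(3) M(3) \<pi>(3) by simp_all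
    have Kp: "K \<in> points (Res p)" using N(4) \<pi>(3) star_iff res_points by simp
    note rK = res_rep[OF Kp b(2,1)]
    have k\<pi>: "pr b K \<in> \<pi>" using rK(2) N(4)[unfolded \<pi>(3) star_iff] by blast
    have bk: "b \<sim> pr b K" using rK(1) unfolding dp_def by blast
    have bn: "b \<notin> \<pi>" using plane_coll[OF \<pi>(1,2)] b(2) by blast
    have T: "tr \<pi> b \<in> lines \<Delta>" using tr_line[OF \<pi>(1) b(1) bn] .
    have bx2: "b \<sim> x2" using ra(1) unfolding dp_def by blast
    have xmn: "x2 \<noteq> m" using M(3,5) ra(3) by metis
    have "x2 \<in> tr \<pi> b" "m \<in> tr \<pi> b" "pr b K \<in> tr \<pi> b" unfolding tr_def using i k\<pi> bk bx2 M(4) by blast+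
    then have "b' \<sim> pr b K" using perp_line[OF T _ _ xmn B(7) M(6)] by blast
    moreover have "p2 \<in> \<pi>" using B(3) plane_jn[OF \<pi>(1,2) i(1) ra(5)] by blast
    then have "p2 \<sim> pr b K" using plane_coll[OF \<pi>(1) _ k\<pi>] by blast
    ultimately show ?thesis using proj4_fix[OF o rK(4) bk] rK(3) by simp
  qed
  have bm: "b \<sim> m1" "b \<sim> m2" using r1(1) r2(1) unfolding dp_def by blast+
  have pst: "proj4 p b p2 b' ` l \<subseteq> l" if l: "l \<in> lines (Res p)" "a \<in> l" for l
  proof -
    obtain \<pi> where \<pi>: "\<pi> \<in> planes \<Delta>" "p \<in> \<pi>" "l = star p \<pi>" using l(1) unfolding res_lines by blast
    have "x2 \<in> \<pi>" using star_jn[OF \<pi>(1,2) ra(4,5)] l(2) ra(3) \<pi>(3) by simp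
    then have "p2 \<in> \<pi>" using B(3) plane_jn[OF \<pi>(1,2) _ ra(5)] by blast
    then show ?thesis using proj4_stable[OF o b(1) B(2) \<pi>(1,2)] \<pi>(3) by simp
  qed
  have Qeq: "\<theta> Q = proj4 p b p2 b' Q" using B(10) rQ(3) rQ'(3) by simp
  let ?h = "inv_into (points (Res p)) \<theta> \<circ> proj4 p b p2 b'"
  note compare = G.compare[where \<psi> = "proj4 p b p2 b'", OF \<theta>]
  have cmp1: "?h K \<in> points (Res p)" if "K \<in> points (Res p)" for K
    by (rule compare(1), erule hom(1), erule hom(2), rule that)
  have cmp2: "coll (Res p) (?h K) (?h M)" if "coll (Res p) K M" for K M
    by (rule compare(2), erule hom(1), erule hom(2), rule that)
  have cmp3: "\<theta> K = proj4 p b p2 b' K \<longleftrightarrow> ?h K = K" if "K \<in> points (Res p)" for K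
    by (rule compare(3), erule hom(1), erule hom(2), rule that)
  have cmp4: "G.stable ?h l" if "l \<in> lines (Res p)" "\<theta> ` l = l" "proj4 p b p2 b' ` l \<subseteq> l" for l
    by (rule compare(4), erule hom(1), erule hom(2)) (rule that)+
  have nP: "K \<in> points (Res p)" if "l \<in> lines (Res p)" "K \<in> l" for l K using G.gline_sub that by blast
  have "?h K = K" if "K \<in> points (Res p)" for K
  proof (rule G.rigid_first[where h = ?h and ?N1.0 = N1 and ?N2.0 = N2 and a = a and Q = Q])
    show "?h K \<in> points (Res p)" if "K \<in> points (Res p)" for K using cmp1[OF that] .
    show "coll (Res p) (?h K) (?h M)" if "coll (Res p) K M" for K M using cmp2[OF that] .
    show "?h K = K" if "K \<in> N1" for K
      using cmp3[OF nP[OF N1(1) that]] fx[OF N1(1,2) _ that] N1(3) pN[OF N1 that r1(4,5,3) bm(1) ne(1) B(8)] by simp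
    show "?h K = K" if "K \<in> N2" for K
      using cmp3[OF nP[OF N2(1) that]] fx[OF N2(1,2) _ that] N2(3) pN[OF N2 that r2(4,5,3) bm(2) ne(2) B(9)] by simp
    show "G.stable ?h l" if "l \<in> lines (Res p)" "a \<in> l" for l using cmp4[OF that(1) st[OF that] pst[OF that]] .
    show "?h Q = Q" using cmp3[OF pts(4)] Qeq by simp
  qed (use N1 N2 N12 pts c that in auto)
  then have "\<forall>K\<in>points (Res p). \<theta> K = proj4 p b p2 b' K" using cmp3 by blast
  then show ?thesis using b B o by blast
qed

text \<open>Here \<open>p2\<close> on the line \<open>c\<close> makes the residue lines through
  \<open>c\<close> stable by \<open>proj4_stable\<close>, and \<open>b'\<close> on the line
  \<open>b x2\<close>, with \<open>x2\<close> representing \<open>a\<close>, does the same for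
  \<open>a\<close> by \<open>second_kind_stable\<close>.\<close>

lemma residue_second_kind:
  assumes p: "p \<in> P" and \<theta>: "collineation (Res p) \<theta>"
    and N: "N \<in> lines (Res p)" "a \<in> N" "c \<in> N" "a \<noteq> c" and Q: "coll (Res p) Q c" "\<not> coll (Res p) Q a"
    and st: "\<And>l. l \<in> lines (Res p) \<Longrightarrow> a \<in> l \<or> c \<in> l \<Longrightarrow> \<theta> ` l = l" and fx: "\<And>K. K \<in> N \<Longrightarrow> \<theta> K = K"
  shows "\<exists>p1\<in>P. \<exists>p2\<in>P. \<exists>p3\<in>P. \<not> p \<sim> p1 \<and> \<not> p1 \<sim> p2 \<and> \<not> p2 \<sim> p3 \<and> \<not> p3 \<sim> p \<and>
    (\<forall>K\<in>points (Res p). \<theta> K = proj4 p p1 p2 p3 K)"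
proof -
  interpret G: thick_gq "Res p" using residue_gq[OF p] .
  obtain b where b: "b \<in> P" "\<not> p \<sim> b" using opp_ex[OF p] by blast
  have inj: "inj_on \<theta> (points (Res p))" using \<theta> unfolding collineation_def bij_betw_def by blast
  have pts: "a \<in> points (Res p)" "c \<in> points (Res p)" "Q \<in> points (Res p)"
    using Q(1) G.gline_sub[OF N(1)] N(2,3) by (auto dest: coll_points)
  define x2 x3 t where "x2 = pr b a" and "x3 = pr b c" and "t = pr b Q"
  note ra = res_rep[OF pts(1) b(2,1), folded x2_def] and rc = res_rep[OF pts(2) b(2,1), folded x3_def]
    and rQ = res_rep[OF pts(3) b(2,1), folded t_def]
  have ac: "coll (Res p) a c" using G.gline_coll[OF N(1-3)] .
  have xt: "x2 \<sim> x3" "t \<sim> x3" "\<not> x2 \<sim> t"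
    using res_coll[OF ra(4,5) rc(4,5)] res_coll[OF rQ(4,5) rc(4,5)] res_coll[OF rQ(4,5) ra(4,5)] ac Q ra(3) rc(3) rQ(3) sym by metis+
  have Qc: "Q \<noteq> c" using Q(2) coll_sym[OF ac] by metis
  obtain l where l: "l \<in> lines (Res p)" "Q \<in> l" "c \<in> l" using G.gline_ex[OF Q(1) Qc] by blast
  \<comment> \<open>The residue line joining \<open>Q\<close> to \<open>c\<close> is stabilized, so
    the image of \<open>Q\<close> lies in the plane \<open>\<tau>\<close>, as
    \<open>second_kind_points\<close> demands of its target.\<close>
  have Q'l: "\<theta> Q \<in> l" using st[OF l(1)] l(2,3) by blast
  obtain \<tau> where \<tau>: "\<tau> \<in> planes \<Delta>" "p \<in> \<tau>" "l = star p \<tau>" using l(1) unfolding res_lines by blast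
  have i: "x3 \<in> \<tau>" "t \<in> \<tau>" using star_jn[OF \<tau>(1,2) rc(4,5)] star_jn[OF \<tau>(1,2) rQ(4,5)] l(2,3) rc(3) rQ(3) \<tau>(3) by simp_all
  have Q': "\<theta> Q \<in> lines \<Delta>" "p \<in> \<theta> Q" "\<theta> Q \<subseteq> \<tau>" using Q'l[unfolded \<tau>(3) star_iff] by blast+
  have "\<theta> Q \<noteq> c" using inj_onD[OF inj _ pts(3,2)] fx[OF N(3)] Qc by metis
  then have x3Q: "x3 \<notin> \<theta> Q" using jn_eq[OF Q'(1,2) _ rc(5)] rc(3) by metis
  obtain p2 b' where B: "p2 \<in> P" "b' \<in> P" "p2 \<in> jn p x3" "\<not> b \<sim> p2" "\<not> p2 \<sim> b'" "\<not> b' \<sim> p"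
    "b' \<in> jn b x2" "b' \<noteq> x2" "proj4 p b p2 b' (jn p t) = \<theta> Q"
    using second_kind_points[OF p b ra(1) rc(1) rQ(1) xt Q'(1,2) x3Q \<tau>(1,2) i Q'(3)] by blast
  note o = b(2) B(4,5,6)
  note hom = proj4_hom[OF o p b(1) B(1,2)]
  have bx: "b \<sim> x2" "b \<sim> x3" using ra(1) rc(1) unfolding dp_def by blast+
  have bx2: "b \<noteq> x2" using ra(4) b(2) by metis
  have p2x2: "p2 \<sim> x2" using perp_line[OF jn[OF rc(4,5)] rc(5) sym[OF ra(4)] xt(1) B(3)] sym by blast
  note jb = jn[OF bx(1) bx2]
  have nP: "K \<in> points (Res p)" if "l \<in> lines (Res p)" "K \<in> l" for l K using G.gline_sub that by blast
  have pN: "proj4 p b p2 b' K = K" if K: "K \<in> N" for K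
  proof -
    obtain \<pi> where \<pi>: "\<pi> \<in> planes \<Delta>" "p \<in> \<pi>" "N = star p \<pi>" using N(1) unfolding res_lines by blast
    have i: "x2 \<in> \<pi>" "x3 \<in> \<pi>" using star_jn[OF \<pi>(1,2) ra(4,5)] star_jn[OF \<pi>(1,2) rc(4,5)] N(2,3) ra(3) rc(3) \<pi>(3) by simp_all
    note rK = res_rep[OF nP[OF N(1) K] b(2,1)]
    have k\<pi>: "pr b K \<in> \<pi>" using rK(2) K[unfolded \<pi>(3) star_iff] by blast
    have bk: "b \<sim> pr b K" using rK(1) unfolding dp_def by blast
    have "x2 \<sim> pr b K" using plane_coll[OF \<pi>(1) i(1) k\<pi>] .
    then have "b' \<sim> pr b K" using perp_line[OF jb bx2 sym[OF bk] sym B(7)] sym by blast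
    moreover have "p2 \<in> \<pi>" using B(3) plane_jn[OF \<pi>(1,2) i(2) rc(5)] by blast
    then have "p2 \<sim> pr b K" using plane_coll[OF \<pi>(1) _ k\<pi>] by blast
    ultimately show ?thesis using proj4_fix[OF o rK(4) bk] rK(3) by simp
  qed
  have pst: "proj4 p b p2 b' ` m \<subseteq> m" if m: "m \<in> lines (Res p)" "a \<in> m \<or> c \<in> m" for m
  proof -
    obtain \<pi> where \<pi>: "\<pi> \<in> planes \<Delta>" "p \<in> \<pi>" "m = star p \<pi>" using m(1) unfolding res_lines by blast
    show ?thesis
    proof (cases "c \<in> m")
      case True
      then have "x3 \<in> \<pi>" using star_jn[OF \<pi>(1,2) rc(4,5)] rc(3) \<pi>(3) by simp
      then have "p2 \<in> \<pi>" using B(3) plane_jn[OF \<pi>(1,2) _ rc(5)] by blast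
      then show ?thesis using proj4_stable[OF o b(1) B(2) \<pi>(1,2)] \<pi>(3) by simp
    next
      case False
      then have "x2 \<in> \<pi>" using m(2) star_jn[OF \<pi>(1,2) ra(4,5)] ra(3) \<pi>(3) by simp
      then show ?thesis using second_kind_stable[OF o p b(1) B(1,2) ra(4) bx(1) p2x2 B(7,8) \<pi>(1,2)] \<pi>(3) by simp
    qed
  qed
  have Qeq: "\<theta> Q = proj4 p b p2 b' Q" using B(9) rQ(3) by simp
  let ?h = "inv_into (points (Res p)) \<theta> \<circ> proj4 p b p2 b'"
  note compare = G.compare[where \<psi> = "proj4 p b p2 b'", OF \<theta>]
  have cmp1: "?h K \<in> points (Res p)" if "K \<in> points (Res p)" for K
    by (rule compare(1), erule hom(1), erule hom(2), rule that)
  have cmp2: "coll (Res p) (?h K) (?h M)" if "coll (Res p) K M" for K M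
    by (rule compare(2), erule hom(1), erule hom(2), rule that)
  have cmp3: "\<theta> K = proj4 p b p2 b' K \<longleftrightarrow> ?h K = K" if "K \<in> points (Res p)" for K
    by (rule compare(3), erule hom(1), erule hom(2), rule that)
  have cmp4: "G.stable ?h l" if "l \<in> lines (Res p)" "\<theta> ` l = l" "proj4 p b p2 b' ` l \<subseteq> l" for l
    by (rule compare(4), erule hom(1), erule hom(2)) (rule that)+
  have "?h K = K" if "K \<in> points (Res p)" for K
  proof (rule G.rigid[where h = ?h and N = N and a = a and b = c and Q = Q])
    show "?h K \<in> points (Res p)" if "K \<in> points (Res p)" for K using cmp1[OF that] .
    show "coll (Res p) (?h K) (?h M)" if "coll (Res p) K M" for K M using cmp2[OF that] .
    show "?h K = K" if "K \<in> N" for K using cmp3[OF nP[OF N(1) that]] fx[OF that] pN[OF that] by simp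
    show "G.stable ?h l" if "l \<in> lines (Res p)" "a \<in> l" for l using cmp4[OF that(1) st pst] that by blast
    show "G.stable ?h l" if "l \<in> lines (Res p)" "c \<in> l" for l using cmp4[OF that(1) st pst] that by blast
    show "?h Q = Q" using cmp3[OF pts(3)] Qeq by simp
  qed (use N Q that in auto)
  then have "\<forall>K\<in>points (Res p). \<theta> K = proj4 p b p2 b' K" using cmp3 by blast
  then show ?thesis using b B o by blast
qed

lemma residue_root_elation:
  assumes p: "p \<in> P" and \<theta>: "root_elation (Res p) 2 \<theta>"
  shows "\<exists>p1\<in>P. \<exists>p2\<in>P. \<exists>p3\<in>P. \<not> p \<sim> p1 \<and> \<not> p1 \<sim> p2 \<and> \<not> p2 \<sim> p3 \<and> \<not> p3 \<sim> p \<and>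
    (\<forall>K\<in>points (Res p). \<theta> K = proj4 p p1 p2 p3 K)"
proof -
  interpret G: thick_gq "Res p" using residue_gq[OF p] .
  obtain \<alpha> \<alpha>i f where f: "polar_frame (Res p) 2 f" and e: "root_elation_for (Res p) \<alpha>i \<theta>"
    and c: "(\<exists>i\<in>frame_indices 2.
         \<alpha> = root_first (apartment (Res p) 2 f) f i \<and> \<alpha>i = interior_first (apartment (Res p) 2 f) f i) \<or>
      (\<exists>i\<in>frame_indices 2. \<exists>j\<in>frame_indices 2. f i \<noteq> f j \<and> coll (Res p) (f i) (f j) \<and>
         \<alpha> = root_second (apartment (Res p) 2 f) f i j \<and> \<alpha>i = interior_second (apartment (Res p) 2 f) f i j)"
    using \<theta> unfolding root_elation_def polar_root_def by (elim exE conjE)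
  have co: "collineation (Res p) \<theta>" using e unfolding root_elation_for_def by blast
  from c show ?thesis
  proof (elim disjE bexE conjE)
    fix i assume i: "i \<in> frame_indices 2" "\<alpha>i = interior_first (apartment (Res p) 2 f) f i"
    obtain a M1 M2 Q where d: "coll (Res p) a M1" "coll (Res p) a M2" "coll (Res p) Q M1" "coll (Res p) Q M2"
      "\<not> coll (Res p) Q a" "\<not> coll (Res p) M1 M2"
      "\<forall>l\<in>lines (Res p). a \<in> l \<longrightarrow> \<theta> ` l = l"
      "\<forall>l\<in>lines (Res p). a \<in> l \<and> (M1 \<in> l \<or> M2 \<in> l) \<longrightarrow> (\<forall>x\<in>l. \<theta> x = x)"
      using G.root_first_data[OF f i(1) e[unfolded i(2)]] by (elim exE conjE)
    show ?thesis by (rule residue_first_kind[OF p co d(1-6)]) (use d(7,8) in simp, use d(7,8) in meson)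
  next
    fix i j assume i: "i \<in> frame_indices 2" "j \<in> frame_indices 2" "f i \<noteq> f j" "coll (Res p) (f i) (f j)"
      "\<alpha>i = interior_second (apartment (Res p) 2 f) f i j"
    obtain a b N Q where d: "N \<in> lines (Res p)" "a \<in> N" "b \<in> N" "a \<noteq> b" "coll (Res p) Q b" "\<not> coll (Res p) Q a"
      "\<forall>l\<in>lines (Res p). a \<in> l \<or> b \<in> l \<longrightarrow> \<theta> ` l = l" "\<forall>x\<in>N. \<theta> x = x"
      using G.root_second_data[OF f i(1-4) e[unfolded i(5)]] by (elim exE conjE)
    show ?thesis by (rule residue_second_kind[OF p co d(1-6)]) (use d(7) in blast, use d(8) in blast)
  qed
qed

end

theorem corollary5p8:
  fixes \<Delta> :: "'a geometry"
  assumes "polar_space_of_rank \<Delta> 3" and "thick_rank3 \<Delta>"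
  shows "moufang \<Delta> 3 \<and>
    (\<forall>p\<in>points \<Delta>. \<forall>\<theta>. root_elation (point_residue \<Delta> p) 2 \<theta> \<longrightarrow>
      (\<exists>p0 p1 p2 p3 p4. p0 = p \<and> p4 = p \<and>
         opposite \<Delta> p0 p1 \<and> opposite \<Delta> p1 p2 \<and> opposite \<Delta> p2 p3 \<and> opposite \<Delta> p3 p4 \<and>
         (\<forall>K\<in>points (point_residue \<Delta> p).
            \<theta> K = (residue_proj \<Delta> p3 p4 \<circ> residue_proj \<Delta> p2 p3 \<circ> residue_proj \<Delta> p1 p2 \<circ> residue_proj \<Delta> p0 p1) K)))"
proof -
  interpret D: thick_polar3 \<Delta> using assms by unfold_locales
  have "\<exists>p0 p1 p2 p3 p4. p0 = p \<and> p4 = p \<and>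
      opposite \<Delta> p0 p1 \<and> opposite \<Delta> p1 p2 \<and> opposite \<Delta> p2 p3 \<and> opposite \<Delta> p3 p4 \<and>
      (\<forall>K\<in>points (point_residue \<Delta> p).
        \<theta> K = (residue_proj \<Delta> p3 p4 \<circ> residue_proj \<Delta> p2 p3 \<circ> residue_proj \<Delta> p1 p2 \<circ> residue_proj \<Delta> p0 p1) K)"
    if p: "p \<in> points \<Delta>" and \<theta>: "root_elation (point_residue \<Delta> p) 2 \<theta>" for p \<theta>
  proof -
    obtain p1 p2 p3 where "p1 \<in> points \<Delta>" "p2 \<in> points \<Delta>" "p3 \<in> points \<Delta>"
      "\<not> coll \<Delta> p p1" "\<not> coll \<Delta> p1 p2" "\<not> coll \<Delta> p2 p3" "\<not> coll \<Delta> p3 p"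
      "\<forall>K\<in>points (point_residue \<Delta> p). \<theta> K = D.proj4 p p1 p2 p3 K"
      using D.residue_root_elation[OF p \<theta>] by blast
    then show ?thesis using p unfolding opposite_def D.proj4_def
      by (intro exI[of _ p] exI[of _ p1] exI[of _ p2] exI[of _ p3]) simp
  qed
  then show ?thesis using D.moufang by blast
qed

end
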